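(* Let $\{X_i\}$ be strictly stationary with values in $\mathcal X\supseteq[0,1]^d$ and let the density $f_X$ of $X_i$ be such that $0<\inf_{x\in[0,1]^d}f_X(x)\le\sup_{x\in[0,1]^d}f_X(x)<\infty$. Let $B_K$ be the tensor product of $d$ univariate wavelet spaces $\mathrm{Wav}(K_0,[0,1])$ where $K=2^{dJ}$ and $K_0=2^J>2N$. Then $\|P_{K,n}\|_\infty\lesssim1$ with probability approaching one, i.e. there is a finite constant $C$ with $\mathbb P(\|P_{K,n}\|_\infty\le C)\to1$, provided that either (a), (b) or (c) is satisfied: (a) $\{X_i\}_{i=1}^n$ are i.i.d. and $\sqrt{(K\log n)/n}=o(1)$; (b) $\{X_i\}_{i=1}^n$ are exponentially $\beta$-mixing and $\sqrt{K(\log n)^2/n}=o(1)$; (c) $\{X_i\}_{i=1}^n$ are algebraically $\beta$-mixing at rate $\gamma$ and $\sqrt{(K\log n)/n^{\gamma/(1+\gamma)}}=o(1)$.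
   Context: Asymptotics are as $n\to\infty$ with $K=K(n)\to\infty$. Empirical projection: $P_{K,n}h(x)=b^K(x)'\big(\frac{B'B}{n}\big)^-\frac1n\sum_{i=1}^nb^K(X_i)h(X_i)$, where $B=(b^K(X_1),\ldots,b^K(X_n))'$, $^-$ is the Moore–Penrose inverse and the elements of $b^K$ are the tensor-product basis of $B_K$ described below; $\|P_{K,n}\|_\infty=\sup\{\|P_{K,n}h\|_\infty/\|h\|_\infty:h\text{ bounded on }\mathcal X,\|h\|_\infty\ne0\}$ with $\|h\|_\infty=\sup_{x\in\mathcal X}|h(x)|$. Wavelet space: let $(\varphi,\psi)$ be a Daubechies pair with $\varphi$ (continuous and) supported on $[-N+1,N]$, $N$ fixed. For $2^J>2N$, $\mathrm{Wav}(K_0,[0,1])$, $K_0=2^J$, is the span $V_J$ of the Cohen–Daubechies–Vial (1993) boundary-corrected scaling functions, which are orthonormal in $L^2([0,1])$ (Lebesgue measure): interior functions $2^{J/2}\varphi(2^Jx-k)$, $k=N,\ldots,2^J-N-1$; left functions $2^{J/2}\varphi^l_k(2^Jx)$, $k=0,\ldots,N-1$, supported on $[0,2^{-J}(N+k)]$; right functions $2^{J/2}\varphi^r_{-k}(2^J(x-1))$, $k=1,\ldots,N$; here $\varphi^l_k,\varphi^r_{-k}$ are fixed continuous compactly supported functions independent of $J$. The tensor-product basis $b^K$ consists of all $K=2^{dJ}$ products $\prod_{l=1}^d\varphi_{J,k_l}(x_l)$ of univariate basis functions, $x\in[0,1]^d$, and is zero outside $[0,1]^d$. $\beta$-mixing: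 $\beta(\mathcal A,\mathcal B)=\frac12\sup\sum_{i,j}|\mathbb P(A_i\cap B_j)-\mathbb P(A_i)\mathbb P(B_j)|$ over finite partitions $\{A_i\}\subset\mathcal A$, $\{B_j\}\subset\mathcal B$ of the sample space; $\beta(q)=\sup_i\beta(\sigma(\ldots,X_{i-1},X_i),\sigma(X_{i+q},X_{i+q+1},\ldots))$. Algebraically $\beta$-mixing at rate $\gamma$: $q^\gamma\beta(q)=o(1)$ for some $\gamma>1$. Exponentially $\beta$-mixing: $\beta(q)\le c\exp(-\gamma q)$ for some $\gamma>0$, $c\ge0$. *)

theory Defs
  imports "HOL-Probability.Probability"
begin

section \<open>Daubechies pairs and boundary-corrected scaling functions\<close>

text \<open>Compactly supported orthonormal scaling function with the refinement filter
  \<open>h\<close> living on \<open>{1 - N..N}\<close>, together with the associated wavelet, which has \<open>N\<close> vanishing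
  moments. All spectral factorisations (extremal phase, least asymmetric, ...) are covered.\<close>

definition daubechies_pair :: "nat \<Rightarrow> (real \<Rightarrow> real) \<Rightarrow> (real \<Rightarrow> real) \<Rightarrow> bool" where
  "daubechies_pair N \<phi> \<psi> \<longleftrightarrow>
     N \<ge> 1 \<and>
     (\<forall>x. x \<notin> {- real N + 1..real N} \<longrightarrow> \<phi> x = 0) \<and>
     (LINT x|lborel. \<phi> x) = 1 \<and>
     (\<forall>k::int. (LINT x|lborel. \<phi> x * \<phi> (x - of_int k)) = (if k = 0 then 1 else 0)) \<and>
     (\<exists>h :: int \<Rightarrow> real.
        (\<forall>x. \<phi> x = sqrt 2 * (\<Sum>m = 1 - int N..int N. h m * \<phi> (2 * x - of_int m))) \<and>
        (\<forall>x. \<psi> x = sqrt 2 * (\<Sum>m = 1 - int N..int N.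
                      (- 1) powi m * h (1 - m) * \<phi> (2 * x - of_int m)))) \<and>
     (\<forall>l<N. (LINT x|lborel. x ^ l * \<psi> x) = 0)"

text \<open>The functions of Cohen, Daubechies and Vial on the half line: the part of the polynomial
  \<open>\<Sum>n\<in>\<int>. (n choose k) \<phi> (x + n - N + 1)\<close> of degree \<open>k\<close> that is not carried by the interior
  translates \<open>\<phi> (x - m)\<close>, \<open>m \<ge> N\<close>. The support lies in \<open>[0, 2 * N - 1 - k]\<close>.\<close>

definition cdv_edge :: "nat \<Rightarrow> (real \<Rightarrow> real) \<Rightarrow> nat \<Rightarrow> real \<Rightarrow> real" where
  "cdv_edge N \<phi> k x =
     (if 0 \<le> x then \<Sum>n = k..2 * N - 2. real (n choose k) * \<phi> (x + real n - real N + 1) else 0)"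

text \<open>\<open>\<phi>l 0, ..., \<phi>l (N - 1)\<close> is the result of Gram-Schmidt orthonormalisation in
  \<open>L\<^sup>2([0, \<infinity>))\<close> of the edge functions in the order \<open>N - 1, N - 2, ..., 0\<close> of increasing support
  (determined up to signs). Hence \<open>\<phi>l k\<close> is supported on \<open>[0, N + k]\<close>.\<close>

definition cdv_left :: "nat \<Rightarrow> (real \<Rightarrow> real) \<Rightarrow> (nat \<Rightarrow> real \<Rightarrow> real) \<Rightarrow> bool" where
  "cdv_left N \<phi> \<phi>l \<longleftrightarrow>
     (\<forall>k<N. \<exists>c :: nat \<Rightarrow> real. \<forall>x. \<phi>l k x = (\<Sum>j = N - 1 - k..N - 1. c j * cdv_edge N \<phi> j x)) \<and>
     (\<forall>j<N. \<forall>k<N. (LINT x:{0..}|lborel. \<phi>l j x * \<phi>l k x) = (if j = k then 1 else 0))"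

text \<open>The right boundary is the mirror image of the left one. The scaling function \<open>\<phi> (1 - x)\<close>
  is again supported on \<open>[1 - N, N]\<close>. Here \<open>\<phi>r k\<close>, \<open>k = 1, ..., N\<close>, stands for the function
  usually written with index \<open>-k\<close>.\<close>

definition cdv_right :: "nat \<Rightarrow> (real \<Rightarrow> real) \<Rightarrow> (nat \<Rightarrow> real \<Rightarrow> real) \<Rightarrow> bool" where
  "cdv_right N \<phi> \<phi>r \<longleftrightarrow> cdv_left N (\<lambda>x. \<phi> (1 - x)) (\<lambda>k x. \<phi>r (Suc k) (- x))"

text \<open>The basis of \<open>V\<^sub>J\<close>, indexed by \<open>k < 2 ^ J\<close>. The index \<open>2 ^ J - k\<close> belongs to the right
  function \<open>\<phi>r k\<close>.\<close>

definition wav_basis ::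
  "nat \<Rightarrow> (real \<Rightarrow> real) \<Rightarrow> (nat \<Rightarrow> real \<Rightarrow> real) \<Rightarrow> (nat \<Rightarrow> real \<Rightarrow> real) \<Rightarrow> nat \<Rightarrow> nat \<Rightarrow> real \<Rightarrow> real"
where
  "wav_basis N \<phi> \<phi>l \<phi>r J k t =
     2 powr (real J / 2) *
       (if k < N then \<phi>l k (2 ^ J * t)
        else if k < 2 ^ J - N then \<phi> (2 ^ J * t - real k)
        else \<phi>r (2 ^ J - k) (2 ^ J * (t - 1)))"

definition tensor_index :: "nat \<Rightarrow> ('d \<Rightarrow> nat) set" where
  "tensor_index J = {k. \<forall>l. k l < 2 ^ J}"

definition tensor_basis ::
  "nat \<Rightarrow> (real \<Rightarrow> real) \<Rightarrow> (nat \<Rightarrow> real \<Rightarrow> real) \<Rightarrow> (nat \<Rightarrow> real \<Rightarrow> real) \<Rightarrow> nat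
    \<Rightarrow> ('d::finite \<Rightarrow> nat) \<Rightarrow> real ^ 'd \<Rightarrow> real"
where
  "tensor_basis N \<phi> \<phi>l \<phi>r J k x =
     (if x \<in> cbox 0 1 then \<Prod>l\<in>UNIV. wav_basis N \<phi> \<phi>l \<phi>r J (k l) (x $ l) else 0)"

section \<open>Empirical projection\<close>

text \<open>Matrices with rows and columns indexed by a finite set \<open>I\<close>, so that the basis needs no
  enumeration.\<close>

definition mat_prod :: "'i set \<Rightarrow> ('i \<Rightarrow> 'i \<Rightarrow> real) \<Rightarrow> ('i \<Rightarrow> 'i \<Rightarrow> real) \<Rightarrow> 'i \<Rightarrow> 'i \<Rightarrow> real" where
  "mat_prod I A B i j = (\<Sum>k\<in>I. A i k * B k j)"

definition is_moore_penrose :: "'i set \<Rightarrow> ('i \<Rightarrow> 'i \<Rightarrow> real) \<Rightarrow> ('i \<Rightarrow> 'i \<Rightarrow> real) \<Rightarrow> bool" where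
  "is_moore_penrose I A G \<longleftrightarrow>
     (\<forall>i\<in>I. \<forall>j\<in>I.
        mat_prod I (mat_prod I A G) A i j = A i j \<and>
        mat_prod I (mat_prod I G A) G i j = G i j \<and>
        mat_prod I A G i j = mat_prod I A G j i \<and>
        mat_prod I G A i j = mat_prod I G A j i)"

text \<open>The entries outside \<open>I \<times> I\<close> are set to 0 to make the inverse unique as a function.\<close>

definition moore_penrose :: "'i set \<Rightarrow> ('i \<Rightarrow> 'i \<Rightarrow> real) \<Rightarrow> 'i \<Rightarrow> 'i \<Rightarrow> real" where
  "moore_penrose I A =
     (THE G. is_moore_penrose I A G \<and> (\<forall>i j. i \<notin> I \<or> j \<notin> I \<longrightarrow> G i j = 0))"

text \<open>\<open>B'B / n\<close> for the design points \<open>x\<^sub>1, ..., x\<^sub>n\<close>\<close>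

definition emp_gram :: "('i \<Rightarrow> 'x \<Rightarrow> real) \<Rightarrow> nat \<Rightarrow> (nat \<Rightarrow> 'x) \<Rightarrow> 'i \<Rightarrow> 'i \<Rightarrow> real" where
  "emp_gram b n xs i j = (\<Sum>m = 1..n. b i (xs m) * b j (xs m)) / real n"

definition emp_proj ::
  "'i set \<Rightarrow> ('i \<Rightarrow> 'x \<Rightarrow> real) \<Rightarrow> nat \<Rightarrow> (nat \<Rightarrow> 'x) \<Rightarrow> ('x \<Rightarrow> real) \<Rightarrow> 'x \<Rightarrow> real"
where
  "emp_proj I b n xs h x =
     (\<Sum>i\<in>I. \<Sum>j\<in>I. b i x * moore_penrose I (emp_gram b n xs) i j *
        (1 / real n * (\<Sum>m = 1..n. b j (xs m) * h (xs m))))"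

definition sup_norm_on :: "'x set \<Rightarrow> ('x \<Rightarrow> real) \<Rightarrow> ereal" where
  "sup_norm_on S h = (SUP x\<in>S. ereal \<bar>h x\<bar>)"

definition sup_op_norm :: "'x set \<Rightarrow> (('x \<Rightarrow> real) \<Rightarrow> 'x \<Rightarrow> real) \<Rightarrow> ereal" where
  "sup_op_norm S P =
     (SUP h\<in>{h. bounded (h ` S) \<and> sup_norm_on S h \<noteq> 0}. sup_norm_on S (P h) / sup_norm_on S h)"

section \<open>Stationarity and mixing\<close>

definition strictly_stationary ::
  "'a measure \<Rightarrow> (int \<Rightarrow> 'a \<Rightarrow> 'b::topological_space) \<Rightarrow> bool"
where
  "strictly_stationary M X \<longleftrightarrow>
     (\<forall>i. X i \<in> measurable M borel) \<and>
     (\<forall>I s. finite I \<longrightarrow>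
        distr M (Pi\<^sub>M I (\<lambda>_. borel)) (\<lambda>\<omega>. \<lambda>i\<in>I. X (i + s) \<omega>) =
        distr M (Pi\<^sub>M I (\<lambda>_. borel)) (\<lambda>\<omega>. \<lambda>i\<in>I. X i \<omega>))"

definition gen_sigma ::
  "'a measure \<Rightarrow> (int \<Rightarrow> 'a \<Rightarrow> 'b::topological_space) \<Rightarrow> int set \<Rightarrow> 'a set set"
where
  "gen_sigma M X T =
     sigma_sets (space M) {X i -` S \<inter> space M | i S. i \<in> T \<and> S \<in> sets borel}"

text \<open>On a probability space the sums lie in \<open>[0, 1]\<close>, so the real suprema below are genuine.\<close>

definition beta_coeff :: "'a measure \<Rightarrow> 'a set set \<Rightarrow> 'a set set \<Rightarrow> real" where
  "beta_coeff M \<A> \<B> =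
     1 / 2 * (SUP (P, Q) \<in> {(P, Q). finite P \<and> partition_on (space M) P \<and> P \<subseteq> \<A> \<and>
                                   finite Q \<and> partition_on (space M) Q \<and> Q \<subseteq> \<B>}.
               \<Sum>A\<in>P. \<Sum>B\<in>Q. \<bar>measure M (A \<inter> B) - measure M A * measure M B\<bar>)"

definition beta_mix ::
  "'a measure \<Rightarrow> (int \<Rightarrow> 'a \<Rightarrow> 'b::topological_space) \<Rightarrow> nat \<Rightarrow> real"
where
  "beta_mix M X q = (SUP i. beta_coeff M (gen_sigma M X {..i}) (gen_sigma M X {i + int q..}))"

definition exp_beta_mixing ::
  "'a measure \<Rightarrow> (int \<Rightarrow> 'a \<Rightarrow> 'b::topological_space) \<Rightarrow> bool"
where
  "exp_beta_mixing M X \<longleftrightarrow>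
     (\<exists>\<gamma>>0. \<exists>c\<ge>0. \<forall>q. beta_mix M X q \<le> c * exp (- \<gamma> * real q))"

definition alg_beta_mixing ::
  "'a measure \<Rightarrow> (int \<Rightarrow> 'a \<Rightarrow> 'b::topological_space) \<Rightarrow> real \<Rightarrow> bool"
where
  "alg_beta_mixing M X \<gamma> \<longleftrightarrow>
     \<gamma> > 1 \<and> (\<lambda>q. real q powr \<gamma> * beta_mix M X q) \<longlonglongrightarrow> 0"

end

theory Submission
  imports Defs
begin

text \<open>The operator norm in question is a Lebesgue constant: the supremum over \<open>x\<close> of
\<open>(\<Sum>m. \<bar>\<kappa> x (X\<^sub>m)\<bar>) / n\<close>, where \<open>\<kappa> x y = b(x)' G b(y)\<close> and \<open>G\<close> is the Moore--Penrose inverse of the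
empirical Gram matrix \<open>A\<close> (\<open>sup_op_norm_emp_proj_le_iff\<close>). It is bounded on every sample whose Gram
matrix behaves like its expectation, and such samples have probability tending to one.

Deterministic part. At high resolution the wavelet basis is orthonormal, so the density bounds put the spectrum of
\<open>E A\<close> above a positive constant (\<open>mean_gram_coercive\<close>). Basis functions at distance of more than
\<open>4 N + 2\<close> grid points have disjoint supports, so \<open>A\<close> and \<open>E A\<close> are banded. For a banded matrix,
closeness of the entries gives closeness of the quadratic forms
(\<open>banded_quadratic_form_le\<close>), hence a lower bound on the spectrum of \<open>A\<close>. The inverse of a
banded coercive matrix is bounded in the supremum norm, uniformly in its size: this is the
Combes--Thomas argument, which tests the linear system with exponentially decaying weights
(\<open>combes_thomas\<close>). Together with \<open>\<bar>b\<^sub>i\<bar> \<le> B \<surd>K\<close> and \<open>(\<Sum>m. \<bar>b\<^sub>i (X\<^sub>m)\<bar>) / n \<le> T / \<surd>K\<close> this bounds the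
Lebesgue constant (\<open>lebesgue_fn_bounded\<close>).

Probabilistic part. Because only entries matter, a scalar Chernoff bound for \<open>b\<^sub>i b\<^sub>j\<close> and \<open>\<surd>K \<bar>b\<^sub>i\<bar>\<close>, whose supremum and second moment are of order
\<open>K\<close>, is combined with a union bound over the \<open>O(K\<^sup>2)\<close> of them. Under mixing the sample is cut
into blocks of length \<open>q\<close>, and blocks of equal parity are treated as independent at the price of a
dependence coefficient per block. This price is paid once for all entries simultaneously, since the
vector of all block sums is compared with an independent one
(\<open>expectation_sum_weakly_dependent_le\<close>). A factor \<open>K\<^sup>2\<close> on it would spoil the algebraic rate.
Rounding the block sums to a grid makes them finitely valued, so that the definition of
\<open>\<beta>\<close>-mixing by finite partitions applies to them directly. The failure
probability is then of order \<open>K\<^sup>2 exp (- \<kappa> n / (q K)) + (n / q) \<tau>\<close>, and it vanishes for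
\<open>q = 1\<close>, \<open>q \<approx> ln n\<close> and \<open>q \<approx> n powr (1 / (1 + \<gamma>))\<close> in the three cases.

Finally, the event that the norm is at most \<open>C\<close> has to be measurable. The Lebesgue function is
continuous on the cube, so countably many points decide the event, and the Moore--Penrose inverse of
\<open>\<Sum> v v'\<close> is a measurable function of the vectors \<open>v\<close> because it can be built up by rank-one updates
(\<open>psd_mp_rank_one_update\<close>).\<close>

section \<open>Moore--Penrose inverses of Gram matrices\<close>

lemma mat_prod_assoc:
  "mat_prod I (mat_prod I A B) C = mat_prod I A (mat_prod I B C)"
proof (intro ext)
  fix i j
  have "(\<Sum>k\<in>I. (\<Sum>l\<in>I. A i l * B l k) * C k j) = (\<Sum>k\<in>I. \<Sum>l\<in>I. A i l * B l k * C k j)"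
    by (simp add: sum_distrib_right)
  also have "\<dots> = (\<Sum>l\<in>I. \<Sum>k\<in>I. A i l * B l k * C k j)"
    by (rule sum.swap)
  also have "\<dots> = (\<Sum>l\<in>I. A i l * (\<Sum>k\<in>I. B l k * C k j))"
    by (simp add: sum_distrib_left mult.assoc)
  finally show "mat_prod I (mat_prod I A B) C i j = mat_prod I A (mat_prod I B C) i j"
    by (simp add: mat_prod_def)
qed

lemma mat_prod_cong:
  assumes "\<And>k. k \<in> I \<Longrightarrow> A i k = A' i k" "\<And>k. k \<in> I \<Longrightarrow> B k j = B' k j"
  shows "mat_prod I A B i j = mat_prod I A' B' i j"
  using assms by (simp add: mat_prod_def)

text \<open>Both products are the orthogonal projection onto the range of \<open>A\<close>: by symmetry,
\<open>A G = A H A G = (A G A H)' = (A H)' = A H\<close>.\<close>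

lemma moore_penrose_left_product_unique:
  assumes "is_moore_penrose I A G" "is_moore_penrose I A H" "i \<in> I" "j \<in> I"
  shows "mat_prod I A G i j = mat_prod I A H i j"
proof -
  note mp = assms(1,2)[unfolded is_moore_penrose_def]
  have "mat_prod I A G i j = mat_prod I (mat_prod I (mat_prod I A H) A) G i j"
    using mp assms(3,4) by (intro mat_prod_cong) auto
  also have "\<dots> = mat_prod I (mat_prod I A H) (mat_prod I A G) i j"
    by (simp add: mat_prod_assoc)
  also have "\<dots> = (\<Sum>k\<in>I. mat_prod I A G j k * mat_prod I A H k i)"
    unfolding mat_prod_def[of I "mat_prod I A H"] using mp assms(3,4)
    by (intro sum.cong refl) (metis mult.commute)
  also have "\<dots> = mat_prod I (mat_prod I (mat_prod I A G) A) H j i"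
    by (simp only: mat_prod_def[of I "mat_prod I A G" "mat_prod I A H", symmetric] mat_prod_assoc)
  also have "\<dots> = mat_prod I A H j i"
    using mp assms(3,4) by (intro mat_prod_cong) auto
  also have "\<dots> = mat_prod I A H i j"
    using mp assms(3,4) by metis
  finally show ?thesis .
qed

lemma moore_penrose_right_product_unique:
  assumes "is_moore_penrose I A G" "is_moore_penrose I A H" "i \<in> I" "j \<in> I"
  shows "mat_prod I G A i j = mat_prod I H A i j"
proof -
  note mp = assms(1,2)[unfolded is_moore_penrose_def]
  have "mat_prod I G A i j = mat_prod I G (mat_prod I (mat_prod I A H) A) i j"
    using mp assms(3,4) by (intro mat_prod_cong) auto
  also have "\<dots> = mat_prod I (mat_prod I G A) (mat_prod I H A) i j"
    by (simp add: mat_prod_assoc)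
  also have "\<dots> = (\<Sum>k\<in>I. mat_prod I H A j k * mat_prod I G A k i)"
    unfolding mat_prod_def[of I "mat_prod I G A"] using mp assms(3,4)
    by (intro sum.cong refl) (metis mult.commute)
  also have "\<dots> = mat_prod I H (mat_prod I (mat_prod I A G) A) j i"
    by (simp only: mat_prod_def[of I "mat_prod I H A" "mat_prod I G A", symmetric] mat_prod_assoc)
  also have "\<dots> = mat_prod I H A j i"
    using mp assms(3,4) by (intro mat_prod_cong) auto
  also have "\<dots> = mat_prod I H A i j"
    using mp assms(3,4) by metis
  finally show ?thesis .
qed

lemma moore_penrose_unique:
  assumes G: "is_moore_penrose I A G" and H: "is_moore_penrose I A H" and ij: "i \<in> I" "j \<in> I"
  shows "G i j = H i j"
proof -
  note mp = assms(1,2)[unfolded is_moore_penrose_def]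
  have "G i j = mat_prod I (mat_prod I G A) G i j"
    using mp ij by simp
  also have "\<dots> = mat_prod I (mat_prod I H A) G i j"
    by (rule mat_prod_cong) (use moore_penrose_right_product_unique[OF G H] ij in auto)
  also have "\<dots> = mat_prod I H (mat_prod I A G) i j"
    by (simp add: mat_prod_assoc)
  also have "\<dots> = mat_prod I H (mat_prod I A H) i j"
    by (rule mat_prod_cong) (use moore_penrose_left_product_unique[OF G H] ij in auto)
  also have "\<dots> = H i j"
    using mp ij by (simp add: mat_prod_assoc[symmetric])
  finally show ?thesis .
qed

lemma is_moore_penrose_cong:
  assumes G: "is_moore_penrose I A G" and eq: "\<And>i j. i \<in> I \<Longrightarrow> j \<in> I \<Longrightarrow> H i j = G i j"
  shows "is_moore_penrose I A H"
proof -
  have "mat_prod I A H i j = mat_prod I A G i j" "mat_prod I H A i j = mat_prod I G A i j"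
    if "i \<in> I" "j \<in> I" for i j
    using that by (auto intro!: mat_prod_cong eq)
  moreover from this have "mat_prod I (mat_prod I A H) A i j = mat_prod I (mat_prod I A G) A i j"
    "mat_prod I (mat_prod I H A) H i j = mat_prod I (mat_prod I G A) G i j"
    if "i \<in> I" "j \<in> I" for i j
    using that by (auto intro!: mat_prod_cong eq)
  ultimately show ?thesis
    using G by (auto simp: is_moore_penrose_def eq)
qed

text \<open>The description operator demands an inverse vanishing outside \<open>I \<times> I\<close>. Truncating \<open>G\<close> yields
one without affecting the products.\<close>

lemma moore_penrose_eq:
  assumes G: "is_moore_penrose I A G" and ij: "i \<in> I" "j \<in> I"
  shows "moore_penrose I A i j = G i j"
proof -
  define G0 where "G0 = (\<lambda>i j. if i \<in> I \<and> j \<in> I then G i j else 0)"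
  have mp0: "is_moore_penrose I A G0"
    using G by (rule is_moore_penrose_cong) (simp add: G0_def)
  have "moore_penrose I A = G0"
    unfolding moore_penrose_def
  proof (rule the_equality)
    fix H assume H: "is_moore_penrose I A H \<and> (\<forall>i j. i \<notin> I \<or> j \<notin> I \<longrightarrow> H i j = 0)"
    show "H = G0"
    proof (intro ext)
      fix i j
      show "H i j = G0 i j"
        using moore_penrose_unique[of I A H G0 i j] H mp0 by (cases "i \<in> I \<and> j \<in> I") (auto simp: G0_def)
    qed
  qed (use mp0 in \<open>auto simp: G0_def\<close>)
  then show ?thesis using ij by (simp add: G0_def)
qed

text \<open>Greville's formula for the Moore--Penrose inverse of \<open>A + v v'\<close>, given that \<open>G\<close> is the one of a
positive semidefinite \<open>A\<close>. Here \<open>c = (1 - A G) v\<close> is the component of \<open>v\<close> in the kernel of \<open>A\<close> and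
\<open>s\<close> its squared length. The first case is the Sherman--Morrison formula.\<close>

definition rank_one_update_mp ::
  "'i set \<Rightarrow> ('i \<Rightarrow> 'i \<Rightarrow> real) \<Rightarrow> ('i \<Rightarrow> 'i \<Rightarrow> real) \<Rightarrow> ('i \<Rightarrow> real) \<Rightarrow> 'i \<Rightarrow> 'i \<Rightarrow> real" where
  "rank_one_update_mp I A G v i j =
     (let w = (\<lambda>i. \<Sum>k\<in>I. G i k * v k);
          c = (\<lambda>i. v i - (\<Sum>k\<in>I. A i k * w k));
          s = (\<Sum>k\<in>I. c k * c k);
          g = (\<Sum>k\<in>I. v k * w k)
      in if s = 0 then G i j - w i * w j / (1 + g)
         else G i j - (w i * c j + c i * w j) / s + (1 + g) * (c i * c j) / s\<^sup>2)"

definition psd_mp :: "'i set \<Rightarrow> ('i \<Rightarrow> 'i \<Rightarrow> real) \<Rightarrow> ('i \<Rightarrow> 'i \<Rightarrow> real) \<Rightarrow> bool" where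
  "psd_mp I A G \<longleftrightarrow>
     (\<forall>i\<in>I. \<forall>j\<in>I. A i j = A j i \<and> G i j = G j i) \<and>
     (\<forall>x. 0 \<le> (\<Sum>i\<in>I. \<Sum>j\<in>I. A i j * x i * x j)) \<and> is_moore_penrose I A G"

text \<open>For symmetric \<open>A\<close> and \<open>G\<close> the four Penrose conditions reduce to statements about the single
product \<open>P = A G\<close>, because \<open>G A\<close> is its transpose.\<close>

lemma psd_mpI:
  assumes sym: "\<And>i j. i \<in> I \<Longrightarrow> j \<in> I \<Longrightarrow> A i j = A j i" "\<And>i j. i \<in> I \<Longrightarrow> j \<in> I \<Longrightarrow> G i j = G j i"
    and psd: "\<And>x. 0 \<le> (\<Sum>i\<in>I. \<Sum>j\<in>I. A i j * x i * x j)"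
    and P: "\<And>i j. i \<in> I \<Longrightarrow> j \<in> I \<Longrightarrow> (\<Sum>k\<in>I. A i k * G k j) = P i j"
    and P_sym: "\<And>i j. i \<in> I \<Longrightarrow> j \<in> I \<Longrightarrow> P i j = P j i"
    and PA: "\<And>i j. i \<in> I \<Longrightarrow> j \<in> I \<Longrightarrow> (\<Sum>k\<in>I. P i k * A k j) = A i j"
    and PG: "\<And>i j. i \<in> I \<Longrightarrow> j \<in> I \<Longrightarrow> (\<Sum>k\<in>I. P i k * G k j) = G i j"
  shows "psd_mp I A G"
proof -
  have AG: "mat_prod I A G i j = P i j" if "i \<in> I" "j \<in> I" for i j
    using P that by (simp add: mat_prod_def)
  have GA: "mat_prod I G A i j = P i j" if ij: "i \<in> I" "j \<in> I" for i j
  proof -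
    have "mat_prod I G A i j = (\<Sum>k\<in>I. A j k * G k i)"
      unfolding mat_prod_def using sym ij by (intro sum.cong refl) (simp add: mult.commute)
    then show ?thesis using P[OF ij(2,1)] P_sym[OF ij] by simp
  qed
  have "mat_prod I (mat_prod I A G) A i j = A i j" "mat_prod I (mat_prod I G A) G i j = G i j"
    if "i \<in> I" "j \<in> I" for i j
    using PA[OF that] PG[OF that] that by (simp_all add: mat_prod_def[of I "mat_prod _ _ _"] AG GA)
  moreover have "mat_prod I A G i j = mat_prod I A G j i" "mat_prod I G A i j = mat_prod I G A j i"
    if "i \<in> I" "j \<in> I" for i j
    using that P_sym by (simp_all add: AG GA)
  ultimately show ?thesis
    unfolding psd_mp_def is_moore_penrose_def using psd sym by blast
qed

text \<open>The new projection onto the range is \<open>A G\<close> if \<open>v\<close> lies in the range of \<open>A\<close>, and \<open>A G + c c' / s\<close>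
otherwise. In the first case the denominator \<open>1 + g\<close> is positive because \<open>g = w' A w\<close> with \<open>w = G v\<close>,
which is where semidefiniteness enters.\<close>

lemma psd_mp_rank_one_update:
  assumes fin: "finite I" and mp: "psd_mp I A G"
  shows "psd_mp I (\<lambda>i j. A i j + v i * v j) (rank_one_update_mp I A G v)"
proof -
  define w where "w = (\<lambda>i. \<Sum>k\<in>I. G i k * v k)"
  define p where "p = (\<lambda>i. \<Sum>k\<in>I. A i k * w k)"
  define c where "c = (\<lambda>i. v i - p i)"
  define s where "s = (\<Sum>k\<in>I. c k * c k)"
  define g where "g = (\<Sum>k\<in>I. v k * w k)"
  define P where "P = mat_prod I A G"
  define G' where "G' = rank_one_update_mp I A G v"
  have G': "G' i j = (if s = 0 then G i j - w i * w j / (1 + g)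
         else G i j - (w i * c j + c i * w j) / s + (1 + g) * (c i * c j) / s\<^sup>2)" for i j
    unfolding G'_def rank_one_update_mp_def Let_def s_def g_def c_def p_def w_def by simp
  have symA: "A i j = A j i" and symG: "G i j = G j i" if "i \<in> I" "j \<in> I" for i j
    using mp that unfolding psd_mp_def by blast+
  have psd: "0 \<le> (\<Sum>i\<in>I. \<Sum>j\<in>I. A i j * x i * x j)" for x
    using mp unfolding psd_mp_def by blast
  have symP: "P i j = P j i" and PA: "(\<Sum>k\<in>I. P i k * A k j) = A i j" if "i \<in> I" "j \<in> I" for i j
    using mp that unfolding psd_mp_def is_moore_penrose_def P_def[symmetric] mat_prod_def[of I P]
    by blast+
  have AG: "(\<Sum>k\<in>I. A i k * G k j) = P i j" for i j
    by (simp add: P_def mat_prod_def)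
  have GA: "(\<Sum>k\<in>I. G i k * A k j) = P i j" if ij: "i \<in> I" "j \<in> I" for i j
  proof -
    have "(\<Sum>k\<in>I. G i k * A k j) = (\<Sum>k\<in>I. A j k * G k i)"
      using symA symG ij by (intro sum.cong refl) (simp add: mult.commute)
    then show ?thesis using AG[of j i] symP[OF ij] by simp
  qed
  have PG: "(\<Sum>k\<in>I. P i k * G k j) = G i j" if ij: "i \<in> I" "j \<in> I" for i j
  proof -
    have "(\<Sum>k\<in>I. P i k * G k j) = mat_prod I (mat_prod I G A) G i j"
      unfolding mat_prod_def[of I "mat_prod I G A"]
      using GA ij by (intro sum.cong refl) (simp add: mat_prod_def)
    also have "\<dots> = G i j" using mp ij unfolding psd_mp_def is_moore_penrose_def by blast
    finally show ?thesis .
  qed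
  have GP: "(\<Sum>k\<in>I. G i k * P k j) = G i j" if ij: "i \<in> I" "j \<in> I" for i j
  proof -
    have "(\<Sum>k\<in>I. G i k * P k j) = (\<Sum>k\<in>I. P j k * G k i)"
      using symP symG ij by (intro sum.cong refl) (simp add: mult.commute)
    then show ?thesis using PG[OF ij(2,1)] symG[OF ij] by simp
  qed
  have AP: "(\<Sum>k\<in>I. A i k * P k j) = A i j" if ij: "i \<in> I" "j \<in> I" for i j
  proof -
    have "(\<Sum>k\<in>I. A i k * P k j) = (\<Sum>k\<in>I. P j k * A k i)"
      using symP symA ij by (intro sum.cong refl) (simp add: mult.commute)
    then show ?thesis using PA[OF ij(2,1)] symA[OF ij] by simp
  qed
  have apply_assoc: "(\<Sum>k\<in>I. B i k * (\<Sum>l\<in>I. C k l * x l)) = (\<Sum>l\<in>I. (\<Sum>k\<in>I. B i k * C k l) * x l)"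
    for B C :: "'a \<Rightarrow> 'a \<Rightarrow> real" and x i
  proof -
    have "(\<Sum>k\<in>I. B i k * (\<Sum>l\<in>I. C k l * x l)) = (\<Sum>k\<in>I. \<Sum>l\<in>I. B i k * C k l * x l)"
      by (simp add: sum_distrib_left mult.assoc)
    also have "\<dots> = (\<Sum>l\<in>I. \<Sum>k\<in>I. B i k * C k l * x l)" by (rule sum.swap)
    finally show ?thesis by (simp add: sum_distrib_right)
  qed
  have p: "p i = (\<Sum>k\<in>I. P i k * v k)" for i
    unfolding p_def w_def apply_assoc AG ..
  have Aw: "(\<Sum>k\<in>I. A i k * w k) = p i" for i
    by (simp add: p_def)
  have Ap: "(\<Sum>k\<in>I. A i k * p k) = (\<Sum>k\<in>I. A i k * v k)" if "i \<in> I" for i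
    unfolding p apply_assoc using AP that by (intro sum.cong refl) simp
  have Ac: "(\<Sum>k\<in>I. A i k * c k) = 0" if "i \<in> I" for i
    unfolding c_def right_diff_distrib sum_subtractf using Ap[OF that] by simp
  have Gp: "(\<Sum>k\<in>I. G i k * p k) = w i" if "i \<in> I" for i
    unfolding p apply_assoc w_def using GP that by (intro sum.cong refl) simp
  have Gc: "(\<Sum>k\<in>I. G i k * c k) = 0" if "i \<in> I" for i
    unfolding c_def right_diff_distrib sum_subtractf using Gp[OF that] by (simp add: w_def)
  have Pc: "(\<Sum>k\<in>I. P i k * c k) = 0" if "i \<in> I" for i
  proof -
    have "(\<Sum>k\<in>I. P i k * c k) = (\<Sum>k\<in>I. (\<Sum>l\<in>I. A i l * G l k) * c k)" by (simp add: AG)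
    also have "\<dots> = (\<Sum>k\<in>I. A i k * (\<Sum>l\<in>I. G k l * c l))" by (simp add: apply_assoc)
    finally show ?thesis using Gc by simp
  qed
  have Pw: "(\<Sum>k\<in>I. P i k * w k) = w i" if "i \<in> I" for i
    unfolding w_def apply_assoc using PG that by (intro sum.cong refl) simp
  have Pv: "(\<Sum>k\<in>I. P i k * v k) = p i" for i using p by simp
  have vG: "(\<Sum>k\<in>I. v k * G k j) = w j" if "j \<in> I" for j
    unfolding w_def using symG that by (intro sum.cong refl) (simp add: mult.commute)
  have cA: "(\<Sum>k\<in>I. c k * A k j) = 0" if "j \<in> I" for j
  proof -
    have "(\<Sum>k\<in>I. c k * A k j) = (\<Sum>k\<in>I. A j k * c k)"
      using symA that by (intro sum.cong refl) (simp add: mult.commute)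
    then show ?thesis using Ac[OF that] by simp
  qed
  have cG: "(\<Sum>k\<in>I. c k * G k j) = 0" if "j \<in> I" for j
  proof -
    have "(\<Sum>k\<in>I. c k * G k j) = (\<Sum>k\<in>I. G j k * c k)"
      using symG that by (intro sum.cong refl) (simp add: mult.commute)
    then show ?thesis using Gc[OF that] by simp
  qed
  have cw: "(\<Sum>k\<in>I. c k * w k) = 0"
  proof -
    have "(\<Sum>k\<in>I. c k * w k) = (\<Sum>l\<in>I. (\<Sum>k\<in>I. c k * G k l) * v l)"
      unfolding w_def by (rule apply_assoc[of "\<lambda>_. c" undefined])
    then show ?thesis using cG by simp
  qed
  have cp: "(\<Sum>k\<in>I. c k * p k) = 0"
  proof -
    have "(\<Sum>k\<in>I. c k * p k) = (\<Sum>l\<in>I. (\<Sum>k\<in>I. c k * A k l) * w l)"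
      unfolding p_def by (rule apply_assoc[of "\<lambda>_. c" undefined])
    then show ?thesis using cA by simp
  qed
  have cv: "(\<Sum>k\<in>I. c k * v k) = s"
  proof -
    have "s = (\<Sum>k\<in>I. c k * v k) - (\<Sum>k\<in>I. c k * p k)"
      unfolding s_def sum_subtractf[symmetric] by (intro sum.cong refl) (simp add: c_def algebra_simps)
    then show ?thesis using cp by simp
  qed
  have vc: "(\<Sum>k\<in>I. v k * c k) = s" using cv by (simp add: mult.commute)
  have psd': "0 \<le> (\<Sum>i\<in>I. \<Sum>j\<in>I. (A i j + v i * v j) * x i * x j)" for x
  proof -
    have "(\<Sum>i\<in>I. \<Sum>j\<in>I. (A i j + v i * v j) * x i * x j) =
        (\<Sum>i\<in>I. \<Sum>j\<in>I. A i j * x i * x j) + (\<Sum>i\<in>I. v i * x i) * (\<Sum>j\<in>I. v j * x j)"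
      unfolding sum_product by (simp add: sum.distrib[symmetric] algebra_simps)
    then show ?thesis using psd[of x] by simp
  qed
  have symG': "G' i j = G' j i" if "i \<in> I" "j \<in> I" for i j
    using symG[OF that] by (simp add: G' algebra_simps)
  show ?thesis
  proof (cases "s = 0")
    case True
    then have "\<forall>k\<in>I. c k * c k = 0"
      unfolding s_def by (subst (asm) sum_nonneg_eq_0_iff[OF fin]) auto
    then have vp: "v i = p i" if "i \<in> I" for i
      using that by (auto simp: c_def)
    have "g = (\<Sum>i\<in>I. \<Sum>j\<in>I. A i j * w i * w j)"
    proof -
      have "g = (\<Sum>i\<in>I. w i * (\<Sum>j\<in>I. A i j * w j))"
        unfolding g_def using vp by (intro sum.cong refl) (simp add: p_def)
      also have "\<dots> = (\<Sum>i\<in>I. \<Sum>j\<in>I. A i j * w i * w j)"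
        by (simp add: sum_distrib_left mult_ac)
      finally show ?thesis .
    qed
    then have g: "1 + g \<noteq> 0" using psd[of w] by linarith
    have G'0: "G' = (\<lambda>i j. G i j - w i * w j / (1 + g))" by (intro ext) (simp add: G' True)
    show ?thesis unfolding G'_def[symmetric]
    proof (rule psd_mpI[where P = P])
      fix i j assume ij: "i \<in> I" "j \<in> I"
      have "(\<Sum>k\<in>I. (A i k + v i * v k) * G' k j) =
          (\<Sum>k\<in>I. A i k * G k j) + v i * (\<Sum>k\<in>I. v k * G k j)
          - ((\<Sum>k\<in>I. A i k * w k) + v i * (\<Sum>k\<in>I. v k * w k)) * (w j / (1 + g))"
        unfolding G'0 sum_distrib_left sum_distrib_right sum.distrib[symmetric] sum_subtractf[symmetric]
        by (intro sum.cong refl) (simp add: algebra_simps add_divide_distrib)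
      also have "\<dots> = P i j + v i * w j - (v i * (1 + g)) * (w j / (1 + g))"
        unfolding AG vG[OF ij(2)] Aw vp[OF ij(1), symmetric] g_def[symmetric] by (simp add: algebra_simps)
      also have "\<dots> = P i j" using g by simp
      finally show "(\<Sum>k\<in>I. (A i k + v i * v k) * G' k j) = P i j" .
      have "(\<Sum>k\<in>I. P i k * (A k j + v k * v j)) = (\<Sum>k\<in>I. P i k * A k j) + (\<Sum>k\<in>I. P i k * v k) * v j"
        unfolding sum_distrib_right sum.distrib[symmetric]
        by (intro sum.cong refl) (simp add: algebra_simps)
      then show "(\<Sum>k\<in>I. P i k * (A k j + v k * v j)) = A i j + v i * v j"
        unfolding PA[OF ij] Pv vp[OF ij(1), symmetric] .
      have "(\<Sum>k\<in>I. P i k * G' k j) = (\<Sum>k\<in>I. P i k * G k j) - (\<Sum>k\<in>I. P i k * w k) * (w j / (1 + g))"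
        unfolding G'0 sum_distrib_right sum_subtractf[symmetric]
        by (intro sum.cong refl) (simp add: algebra_simps)
      then show "(\<Sum>k\<in>I. P i k * G' k j) = G' i j"
        using PG[OF ij] Pw ij by (simp add: G'0)
    qed (use symA symG' symP psd' in auto)
  next
    case False
    have G'1: "G' = (\<lambda>i j. G i j - (w i * c j + c i * w j) / s + (1 + g) * (c i * c j) / s\<^sup>2)"
      by (intro ext) (simp add: G' False)
    have expand: "(\<Sum>k\<in>I. B k * G' k j) = (\<Sum>k\<in>I. B k * G k j)
        - ((\<Sum>k\<in>I. B k * w k) * c j + (\<Sum>k\<in>I. B k * c k) * w j) / s
        + (1 + g) * ((\<Sum>k\<in>I. B k * c k) * c j) / s\<^sup>2" for B :: "'a \<Rightarrow> real" and j
      unfolding G'1 sum_distrib_left sum_distrib_right sum_divide_distrib sum.distrib[symmetric]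
        sum_subtractf[symmetric]
      by (intro sum.cong refl) (simp add: algebra_simps add_divide_distrib)
    show ?thesis unfolding G'_def[symmetric]
    proof (rule psd_mpI[where P = "\<lambda>i j. P i j + c i * c j / s"])
      fix i j assume ij: "i \<in> I" "j \<in> I"
      have split: "(\<Sum>k\<in>I. (A i k + v i * v k) * x k) = (\<Sum>k\<in>I. A i k * x k) + v i * (\<Sum>k\<in>I. v k * x k)" for x
        unfolding sum_distrib_left sum.distrib[symmetric]
        by (intro sum.cong refl) (simp add: algebra_simps)
      have "(\<Sum>k\<in>I. (A i k + v i * v k) * G' k j) = P i j + v i * w j
          - ((p i + v i * g) * c j + v i * s * w j) / s + (1 + g) * (v i * s * c j) / s\<^sup>2"
        unfolding expand split using ij by (simp add: AG vG Aw Ac vc g_def)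
      also have "\<dots> = P i j + (v i - p i) * c j / s"
        using False by (simp add: field_simps power2_eq_square)
      finally show "(\<Sum>k\<in>I. (A i k + v i * v k) * G' k j) = P i j + c i * c j / s"
        by (simp add: c_def)
      have split2: "(\<Sum>k\<in>I. (P i k + c i * c k / s) * x k) =
          (\<Sum>k\<in>I. P i k * x k) + c i / s * (\<Sum>k\<in>I. c k * x k)" for x
        unfolding sum_distrib_left sum.distrib[symmetric]
        by (intro sum.cong refl) (simp add: algebra_simps)
      have "(\<Sum>k\<in>I. (P i k + c i * c k / s) * (A k j + v k * v j)) =
         (\<Sum>k\<in>I. (P i k + c i * c k / s) * A k j) + (\<Sum>k\<in>I. (P i k + c i * c k / s) * v k) * v j"
        unfolding sum_distrib_right sum.distrib[symmetric]
        by (intro sum.cong refl) (simp add: algebra_simps)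
      also have "\<dots> = A i j + (p i + c i) * v j"
        unfolding split2 using ij False by (simp add: PA cA Pv cv)
      finally show "(\<Sum>k\<in>I. (P i k + c i * c k / s) * (A k j + v k * v j)) = A i j + v i * v j"
        by (simp add: c_def)
      have "(\<Sum>k\<in>I. (P i k + c i * c k / s) * G' k j) =
          G i j - (w i * c j + c i * w j) / s + (1 + g) * (c i * c j) / s\<^sup>2"
        unfolding expand split2 using ij False
        by (simp add: PG cG Pw cw Pc s_def[symmetric])
      then show "(\<Sum>k\<in>I. (P i k + c i * c k / s) * G' k j) = G' i j"
        by (simp add: G'1)
    qed (use symA symG' symP psd' in auto)
  qed
qed

primrec gram_mp :: "'i set \<Rightarrow> (nat \<Rightarrow> 'i \<Rightarrow> real) \<Rightarrow> nat \<Rightarrow> 'i \<Rightarrow> 'i \<Rightarrow> real" where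
  "gram_mp I v 0 = (\<lambda>i j. 0)"
| "gram_mp I v (Suc m) =
     rank_one_update_mp I (\<lambda>i j. \<Sum>l<m. v l i * v l j) (gram_mp I v m) (v m)"

lemma psd_mp_gram_mp:
  assumes "finite I"
  shows "psd_mp I (\<lambda>i j. \<Sum>l<m. v l i * v l j) (gram_mp I v m)"
proof (induction m)
  case 0
  show ?case by (simp add: psd_mp_def is_moore_penrose_def mat_prod_def)
next
  case (Suc m)
  then show ?case using psd_mp_rank_one_update[OF assms Suc, of "v m"] by simp
qed

text \<open>The recursion consists of arithmetic and a case distinction on \<open>s = 0\<close>, so measurability survives
although the Moore--Penrose inverse is a discontinuous function of the matrix.\<close>

lemma borel_measurable_gram_mp:
  assumes "finite I" "\<And>l i. i \<in> I \<Longrightarrow> (\<lambda>\<omega>. v \<omega> l i) \<in> borel_measurable M" "i \<in> I" "j \<in> I"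
  shows "(\<lambda>\<omega>. gram_mp I (v \<omega>) m i j) \<in> borel_measurable M"
  using assms(3,4)
proof (induction m arbitrary: i j)
  case (Suc m)
  note [measurable] = Suc.IH assms(2) Suc.prems
  show ?case
    unfolding gram_mp.simps rank_one_update_mp_def Let_def using Suc.prems by measurable
qed simp

lemma emp_gram_eq_sum:
  "emp_gram b n xs = (\<lambda>i j. \<Sum>l<n. (b i (xs (Suc l)) / sqrt n) * (b j (xs (Suc l)) / sqrt n))"
proof (intro ext)
  fix i j
  have "(\<Sum>m = 1..n. b i (xs m) * b j (xs m)) = (\<Sum>l<n. b i (xs (Suc l)) * b j (xs (Suc l)))"
    by (rule sum.reindex_bij_witness[of _ Suc "\<lambda>m. m - 1"]) auto
  then show "emp_gram b n xs i j = (\<Sum>l<n. (b i (xs (Suc l)) / sqrt n) * (b j (xs (Suc l)) / sqrt n))"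
    by (simp add: emp_gram_def sum_divide_distrib)
qed

lemma is_moore_penrose_emp_gram:
  assumes "finite I"
  shows "is_moore_penrose I (emp_gram b n xs) (moore_penrose I (emp_gram b n xs))"
proof -
  let ?A = "emp_gram b n xs" and ?G = "gram_mp I (\<lambda>l i. b i (xs (Suc l)) / sqrt n) n"
  have mp: "is_moore_penrose I ?A ?G"
    using psd_mp_gram_mp[OF assms, where m = n and v = "\<lambda>l i. b i (xs (Suc l)) / sqrt n"]
    by (simp add: psd_mp_def emp_gram_eq_sum)
  show ?thesis by (rule is_moore_penrose_cong[OF mp moore_penrose_eq[OF mp]])
qed

lemma borel_measurable_moore_penrose_emp_gram:
  assumes fin: "finite I" and b: "\<And>i. i \<in> I \<Longrightarrow> b i \<in> borel_measurable N"
    and X: "\<And>m. X m \<in> measurable M N" and ij: "i \<in> I" "j \<in> I"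
  shows "(\<lambda>\<omega>. moore_penrose I (emp_gram b n (\<lambda>m. X m \<omega>)) i j) \<in> borel_measurable M"
proof -
  have "moore_penrose I (emp_gram b n (\<lambda>m. X m \<omega>)) i j =
      gram_mp I (\<lambda>l i. b i (X (Suc l) \<omega>) / sqrt n) n i j" for \<omega>
    using psd_mp_gram_mp[OF fin, where m = n and v = "\<lambda>l i. b i (X (Suc l) \<omega>) / sqrt n"] ij
    by (intro moore_penrose_eq) (simp_all add: psd_mp_def emp_gram_eq_sum)
  moreover have "(\<lambda>\<omega>. gram_mp I (\<lambda>l i. b i (X (Suc l) \<omega>) / sqrt n) n i j) \<in> borel_measurable M"
    using b X by (intro borel_measurable_gram_mp fin ij) (measurable, auto)
  ultimately show ?thesis by simp
qed

section \<open>Inverses of banded matrices in the supremum norm\<close>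

text \<open>Schur's test: \<open>\<bar>x\<^sub>i x\<^sub>j\<bar> \<le> (x\<^sub>i\<^sup>2 + x\<^sub>j\<^sup>2) / 2\<close>, and each index has at most \<open>m\<close> neighbours.\<close>

lemma banded_quadratic_form_le:
  fixes B :: "'i \<Rightarrow> 'i \<Rightarrow> real"
  assumes fin: "finite I"
    and sym_nbr: "\<And>i j. i \<in> I \<Longrightarrow> j \<in> I \<Longrightarrow> nbr i j \<Longrightarrow> nbr j i"
    and card: "\<And>i. i \<in> I \<Longrightarrow> card {j \<in> I. nbr i j} \<le> m"
    and band: "\<And>i j. i \<in> I \<Longrightarrow> j \<in> I \<Longrightarrow> \<not> nbr i j \<Longrightarrow> B i j = 0"
    and le: "\<And>i j. i \<in> I \<Longrightarrow> j \<in> I \<Longrightarrow> \<bar>B i j\<bar> \<le> t"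
    and t: "0 \<le> t"
  shows "\<bar>\<Sum>i\<in>I. \<Sum>j\<in>I. B i j * x i * x j\<bar> \<le> t * m * (\<Sum>i\<in>I. (x i)\<^sup>2)"
proof -
  define q where "q = (\<lambda>i j. if nbr i j then (x i)\<^sup>2 else 0)"
  have row: "(\<Sum>j\<in>I. q i j) \<le> m * (x i)\<^sup>2" if "i \<in> I" for i
  proof -
    have "(\<Sum>j\<in>I. q i j) = card {j \<in> I. nbr i j} * (x i)\<^sup>2"
      using fin by (simp add: q_def sum.inter_filter[symmetric])
    also have "\<dots> \<le> m * (x i)\<^sup>2" using card[OF that] by (intro mult_right_mono) auto
    finally show ?thesis .
  qed
  have *: "(\<Sum>i\<in>I. \<Sum>j\<in>I. q i j) \<le> m * (\<Sum>i\<in>I. (x i)\<^sup>2)"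
    unfolding sum_distrib_left using row by (rule sum_mono)
  have "(\<Sum>i\<in>I. \<Sum>j\<in>I. q j i) = (\<Sum>i\<in>I. \<Sum>j\<in>I. q i j)"
    by (rule sum.swap)
  note swap = this
  have "\<bar>B i j * x i * x j\<bar> \<le> t / 2 * (q i j + q j i)" if "i \<in> I" "j \<in> I" for i j
  proof (cases "nbr i j")
    case True
    have "0 \<le> (\<bar>x i\<bar> - \<bar>x j\<bar>)\<^sup>2" by simp
    then have "\<bar>x i\<bar> * \<bar>x j\<bar> \<le> ((x i)\<^sup>2 + (x j)\<^sup>2) / 2"
      by (simp add: power2_diff)
    then have "\<bar>B i j\<bar> * (\<bar>x i\<bar> * \<bar>x j\<bar>) \<le> t * (((x i)\<^sup>2 + (x j)\<^sup>2) / 2)"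
      using le[OF that] t by (intro mult_mono) auto
    then show ?thesis using True sym_nbr[OF that True] by (simp add: q_def abs_mult mult.assoc)
  qed (use band that t in \<open>auto simp: q_def\<close>)
  then have "\<bar>\<Sum>i\<in>I. \<Sum>j\<in>I. B i j * x i * x j\<bar> \<le> (\<Sum>i\<in>I. \<Sum>j\<in>I. t / 2 * (q i j + q j i))"
    by (intro order_trans[OF sum_abs] sum_mono)
  also have "\<dots> = t / 2 * ((\<Sum>i\<in>I. \<Sum>j\<in>I. q i j) + (\<Sum>i\<in>I. \<Sum>j\<in>I. q j i))"
    by (simp only: sum_distrib_left[symmetric] sum.distrib)
  also have "\<dots> = t * (\<Sum>i\<in>I. \<Sum>j\<in>I. q i j)" unfolding swap by simp
  also have "\<dots> \<le> t * (m * (\<Sum>i\<in>I. (x i)\<^sup>2))" using * t by (rule mult_left_mono)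
  finally show ?thesis by (simp add: mult.assoc)
qed

text \<open>Testing the system \<open>A \<beta> = u\<close> with \<open>\<omega>\<^sup>2 \<beta>\<close> gives the quadratic form of \<open>A\<close> at \<open>y = \<omega> \<beta>\<close>, perturbed by
the entries \<open>A\<^sub>i\<^sub>j (\<omega>\<^sub>i / \<omega>\<^sub>j - 1)\<close>. If the weights vary slowly along the band, the perturbation is
absorbed by half of the coercivity constant, so that \<open>\<parallel>\<omega> \<beta>\<parallel> \<le> (2 / c) \<parallel>\<omega> u\<parallel>\<close> in the Euclidean norm.
Weights concentrated at \<open>i0\<close> turn this into a pointwise bound.\<close>

lemma combes_thomas:
  fixes A :: "'i \<Rightarrow> 'i \<Rightarrow> real" and \<beta> u \<omega> :: "'i \<Rightarrow> real"
  assumes fin: "finite I"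
    and sym_nbr: "\<And>i j. i \<in> I \<Longrightarrow> j \<in> I \<Longrightarrow> nbr i j \<Longrightarrow> nbr j i"
    and card: "\<And>i. i \<in> I \<Longrightarrow> card {j \<in> I. nbr i j} \<le> m"
    and band: "\<And>i j. i \<in> I \<Longrightarrow> j \<in> I \<Longrightarrow> \<not> nbr i j \<Longrightarrow> A i j = 0"
    and le: "\<And>i j. i \<in> I \<Longrightarrow> j \<in> I \<Longrightarrow> \<bar>A i j\<bar> \<le> R"
    and coercive: "\<And>x. c * (\<Sum>i\<in>I. (x i)\<^sup>2) \<le> (\<Sum>i\<in>I. \<Sum>j\<in>I. A i j * x i * x j)"
    and c: "0 < c" and R: "0 \<le> R"
    and \<omega>_pos: "\<And>i. i \<in> I \<Longrightarrow> 0 < \<omega> i"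
    and slow: "\<And>i j. i \<in> I \<Longrightarrow> j \<in> I \<Longrightarrow> nbr i j \<Longrightarrow> \<bar>\<omega> i / \<omega> j - 1\<bar> \<le> \<epsilon>"
    and \<epsilon>: "0 \<le> \<epsilon>" "R * \<epsilon> * m \<le> c / 2"
    and solve: "\<And>i. i \<in> I \<Longrightarrow> (\<Sum>j\<in>I. A i j * \<beta> j) = u i"
    and u: "\<And>i. i \<in> I \<Longrightarrow> \<bar>u i\<bar> \<le> U"
    and i0: "i0 \<in> I" "\<omega> i0 = 1"
  shows "\<bar>\<beta> i0\<bar> \<le> 2 / c * U * sqrt (\<Sum>i\<in>I. (\<omega> i)\<^sup>2)"
proof -
  define y where "y = (\<lambda>i. \<omega> i * \<beta> i)"
  define Y where "Y = (\<Sum>i\<in>I. (y i)\<^sup>2)"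
  define W where "W = (\<Sum>i\<in>I. (\<omega> i)\<^sup>2)"
  have Y: "0 \<le> Y" unfolding Y_def by (simp add: sum_nonneg)
  have W: "0 \<le> W" unfolding W_def by (simp add: sum_nonneg)
  have U: "0 \<le> U" using u[OF i0(1)] by linarith
  have "\<bar>\<Sum>i\<in>I. \<Sum>j\<in>I. A i j * (\<omega> i / \<omega> j - 1) * y i * y j\<bar> \<le> R * \<epsilon> * m * Y"
    unfolding Y_def
  proof (rule banded_quadratic_form_le[OF fin, where nbr = nbr])
    fix i j assume ij: "i \<in> I" "j \<in> I"
    show "\<bar>A i j * (\<omega> i / \<omega> j - 1)\<bar> \<le> R * \<epsilon>"
    proof (cases "nbr i j")
      case True
      then show ?thesis unfolding abs_mult using le slow ij R by (intro mult_mono) auto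
    qed (use band ij R \<epsilon> in auto)
  qed (use sym_nbr card band R \<epsilon> in auto)
  also have "\<dots> \<le> c / 2 * Y" using \<epsilon>(2) Y by (rule mult_right_mono)
  finally have pert: "\<bar>\<Sum>i\<in>I. \<Sum>j\<in>I. A i j * (\<omega> i / \<omega> j - 1) * y i * y j\<bar> \<le> c / 2 * Y" .
  have "(\<Sum>i\<in>I. \<omega> i * y i * u i) = (\<Sum>i\<in>I. \<Sum>j\<in>I. A i j * (\<omega> i / \<omega> j) * y i * y j)"
  proof (rule sum.cong[OF refl])
    fix i assume i: "i \<in> I"
    have "\<omega> i * y i * u i = (\<Sum>j\<in>I. \<omega> i * y i * (A i j * \<beta> j))"
      by (simp add: solve[OF i, symmetric] sum_distrib_left)
    also have "\<dots> = (\<Sum>j\<in>I. A i j * (\<omega> i / \<omega> j) * y i * y j)"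
    proof (rule sum.cong[OF refl])
      fix j assume "j \<in> I"
      then show "\<omega> i * y i * (A i j * \<beta> j) = A i j * (\<omega> i / \<omega> j) * y i * y j"
        using \<omega>_pos[of j] by (simp add: y_def)
    qed
    finally show "\<omega> i * y i * u i = (\<Sum>j\<in>I. A i j * (\<omega> i / \<omega> j) * y i * y j)" .
  qed
  also have "\<dots> = (\<Sum>i\<in>I. \<Sum>j\<in>I. A i j * y i * y j)
      + (\<Sum>i\<in>I. \<Sum>j\<in>I. A i j * (\<omega> i / \<omega> j - 1) * y i * y j)"
    unfolding sum.distrib[symmetric] by (intro sum.cong refl) (simp add: algebra_simps)
  finally have "c * Y - c / 2 * Y \<le> (\<Sum>i\<in>I. \<omega> i * y i * u i)"
    using coercive[of y] pert unfolding Y_def by linarith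
  also have "\<dots> \<le> (\<Sum>i\<in>I. U * (\<bar>\<omega> i\<bar> * \<bar>y i\<bar>))"
  proof (rule sum_mono)
    fix i assume i: "i \<in> I"
    have "\<omega> i * y i * u i \<le> \<bar>\<omega> i * y i * u i\<bar>" by simp
    also have "\<dots> \<le> \<bar>\<omega> i\<bar> * \<bar>y i\<bar> * U" unfolding abs_mult using u[OF i] by (intro mult_left_mono) auto
    finally show "\<omega> i * y i * u i \<le> U * (\<bar>\<omega> i\<bar> * \<bar>y i\<bar>)" by (simp add: mult_ac)
  qed
  also have "\<dots> \<le> U * (sqrt W * sqrt Y)"
    unfolding sum_distrib_left[symmetric] W_def Y_def
    using L2_set_mult_ineq[of "\<omega>" y I] U by (intro mult_left_mono) (auto simp: L2_set_def)
  finally have main: "c / 2 * Y \<le> U * sqrt W * sqrt Y" by (simp add: mult_ac)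
  have "c / 2 * sqrt Y \<le> U * sqrt W"
  proof (cases "Y = 0")
    case False
    then have "0 < sqrt Y" using Y by simp
    moreover have "(c / 2 * sqrt Y) * sqrt Y \<le> (U * sqrt W) * sqrt Y"
      using main Y by (simp add: mult.assoc)
    ultimately show ?thesis by (simp only: mult_le_cancel_right_pos)
  qed (use U W in auto)
  then have sY: "sqrt Y \<le> 2 / c * U * sqrt W" using c by (simp add: field_simps)
  have "(\<beta> i0)\<^sup>2 \<le> Y"
    unfolding Y_def using i0 member_le_sum[of i0 I "\<lambda>i. (y i)\<^sup>2"] fin by (simp add: y_def)
  then have "\<bar>\<beta> i0\<bar> \<le> sqrt Y" by (simp add: real_le_rsqrt abs_le_square_iff[symmetric] power2_abs)
  then show ?thesis using sY unfolding W_def by linarith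
qed

text \<open>With \<open>A\<close> coercive and symmetric, \<open>A (A G u - u) = 0\<close> forces \<open>A G u = u\<close>.\<close>

lemma moore_penrose_solves:
  assumes fin: "finite I" and mp: "is_moore_penrose I A G"
    and sym: "\<And>i j. i \<in> I \<Longrightarrow> j \<in> I \<Longrightarrow> A i j = A j i"
    and coercive: "\<And>x. c * (\<Sum>i\<in>I. (x i)\<^sup>2) \<le> (\<Sum>i\<in>I. \<Sum>j\<in>I. A i j * x i * x j)" and c: "0 < c"
    and i: "i \<in> I"
  shows "(\<Sum>j\<in>I. A i j * (\<Sum>k\<in>I. G j k * u k)) = u i"
proof -
  define r where "r = (\<lambda>i. (\<Sum>k\<in>I. mat_prod I A G i k * u k) - u i)"
  have swap: "(\<Sum>j\<in>I. B i j * (\<Sum>k\<in>I. C j k * u k)) = (\<Sum>k\<in>I. mat_prod I B C i k * u k)"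
    for B C :: "'a \<Rightarrow> 'a \<Rightarrow> real" and i
  proof -
    have "(\<Sum>j\<in>I. B i j * (\<Sum>k\<in>I. C j k * u k)) = (\<Sum>j\<in>I. \<Sum>k\<in>I. B i j * C j k * u k)"
      by (simp add: sum_distrib_left mult.assoc)
    also have "\<dots> = (\<Sum>k\<in>I. \<Sum>j\<in>I. B i j * C j k * u k)" by (rule sum.swap)
    finally show ?thesis by (simp add: sum_distrib_right mat_prod_def)
  qed
  have AAG: "mat_prod I A (mat_prod I A G) i k = A i k" if ik: "i \<in> I" "k \<in> I" for i k
  proof -
    have "mat_prod I A (mat_prod I A G) i k = mat_prod I (mat_prod I A G) A k i"
      unfolding mat_prod_def[of I A "mat_prod I A G"] mat_prod_def[of I "mat_prod I A G" A]
      using mp sym ik unfolding is_moore_penrose_def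
      by (intro sum.cong refl) (metis mult.commute)
    then show ?thesis using mp sym ik unfolding is_moore_penrose_def by metis
  qed
  have Ar: "(\<Sum>j\<in>I. A i j * r j) = 0" if "i \<in> I" for i
    unfolding r_def right_diff_distrib sum_subtractf swap using AAG that by simp
  have "(\<Sum>i\<in>I. \<Sum>j\<in>I. A i j * r i * r j) = (\<Sum>i\<in>I. r i * (\<Sum>j\<in>I. A i j * r j))"
    by (simp add: sum_distrib_left mult_ac)
  then have "c * (\<Sum>i\<in>I. (r i)\<^sup>2) \<le> 0" using coercive[of r] Ar by simp
  then have "(\<Sum>i\<in>I. (r i)\<^sup>2) \<le> 0" using c by (simp add: mult_le_0_iff)
  then have "(\<Sum>i\<in>I. (r i)\<^sup>2) = 0" by (intro antisym) (auto simp: sum_nonneg)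
  then have "r i = 0" using fin i by (simp add: sum_nonneg_eq_0_iff)
  then show ?thesis unfolding swap by (simp add: r_def)
qed

definition grid_dist :: "('d::finite \<Rightarrow> nat) \<Rightarrow> ('d \<Rightarrow> nat) \<Rightarrow> nat" where
  "grid_dist i j = (\<Sum>l\<in>UNIV. nat \<bar>int (i l) - int (j l)\<bar>)"

definition grid_nbr :: "nat \<Rightarrow> ('d::finite \<Rightarrow> nat) \<Rightarrow> ('d \<Rightarrow> nat) \<Rightarrow> bool" where
  "grid_nbr w i j \<longleftrightarrow> (\<forall>l. \<bar>int (i l) - int (j l)\<bar> \<le> int w)"

lemma tensor_index_eq_PiE: "tensor_index J = (\<Pi>\<^sub>E l\<in>UNIV. {..<2 ^ J})"
  by (auto simp: tensor_index_def PiE_def Pi_def)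

lemma finite_tensor_index [simp]: "finite (tensor_index J :: ('d::finite \<Rightarrow> nat) set)"
  unfolding tensor_index_eq_PiE by (intro finite_PiE) auto

lemma card_tensor_index: "card (tensor_index J :: ('d::finite \<Rightarrow> nat) set) = 2 ^ (CARD('d) * J)"
  unfolding tensor_index_eq_PiE by (subst card_PiE) (auto simp: power_mult[symmetric] mult.commute)

lemma card_grid_nbr_le:
  fixes i :: "'d::finite \<Rightarrow> nat"
  shows "card {j \<in> I. grid_nbr w i j} \<le> (2 * w + 1) ^ CARD('d)"
proof -
  have "{j \<in> I. grid_nbr w i j} \<subseteq> (\<Pi>\<^sub>E l\<in>UNIV. {i l - w..i l + w})"
  proof
    fix j assume "j \<in> {j \<in> I. grid_nbr w i j}"
    then have h: "\<bar>int (i l) - int (j l)\<bar> \<le> int w" for l by (simp add: grid_nbr_def)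
    have "j l \<in> {i l - w..i l + w}" for l using h[of l] by simp linarith
    then show "j \<in> (\<Pi>\<^sub>E l\<in>UNIV. {i l - w..i l + w})" by (simp add: PiE_def Pi_def)
  qed
  then have "card {j \<in> I. grid_nbr w i j} \<le> card (\<Pi>\<^sub>E l\<in>UNIV. {i l - w..i l + w})"
    by (intro card_mono finite_PiE) auto
  also have "\<dots> = (\<Prod>l\<in>UNIV. card {i l - w..i l + w})" by (simp add: card_PiE)
  also have "\<dots> \<le> (\<Prod>l\<in>(UNIV :: 'd set). 2 * w + 1)" by (intro prod_mono) auto
  finally show ?thesis by simp
qed

lemma sum_geometric_dist_le:
  fixes \<rho> :: real assumes "0 < \<rho>" "\<rho> < 1"
  shows "(\<Sum>k<m. \<rho> ^ nat \<bar>int a - int k\<bar>) \<le> 2 / (1 - \<rho>)"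
proof -
  have geo: "(\<Sum>k\<in>S. \<rho> ^ k) \<le> 1 / (1 - \<rho>)" if "finite S" for S
    using sum_le_suminf[of "\<lambda>k. \<rho> ^ k" S] assms that
    by (simp add: suminf_geometric summable_geometric)
  have "(\<Sum>k<m. \<rho> ^ nat \<bar>int a - int k\<bar>) =
      (\<Sum>k\<in>{..<m} \<inter> {..a}. \<rho> ^ nat \<bar>int a - int k\<bar>) + (\<Sum>k\<in>{..<m} - {..a}. \<rho> ^ nat \<bar>int a - int k\<bar>)"
    by (rule sum.Int_Diff) simp
  also have "(\<Sum>k\<in>{..<m} \<inter> {..a}. \<rho> ^ nat \<bar>int a - int k\<bar>) = (\<Sum>k\<in>(\<lambda>k. a - k) ` ({..<m} \<inter> {..a}). \<rho> ^ k)"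
    by (subst sum.reindex) (auto simp: inj_on_def intro!: sum.cong arg_cong[of _ _ "power \<rho>"])
  also have "\<dots> \<le> 1 / (1 - \<rho>)" by (rule geo) simp
  also have "(\<Sum>k\<in>{..<m} - {..a}. \<rho> ^ nat \<bar>int a - int k\<bar>) = (\<Sum>k\<in>(\<lambda>k. k - a) ` ({..<m} - {..a}). \<rho> ^ k)"
    by (subst sum.reindex) (auto simp: inj_on_def intro!: sum.cong arg_cong[of _ _ "power \<rho>"])
  also have "\<dots> \<le> 1 / (1 - \<rho>)" by (rule geo) simp
  finally show ?thesis by simp
qed

lemma sum_grid_dist_le:
  fixes \<rho> :: real and i :: "'d::finite \<Rightarrow> nat"
  assumes "0 < \<rho>" "\<rho> < 1"
  shows "(\<Sum>j\<in>tensor_index J. \<rho> ^ grid_dist i j) \<le> (2 / (1 - \<rho>)) ^ CARD('d)"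
proof -
  have "(\<Sum>j\<in>tensor_index J. \<rho> ^ grid_dist i j) =
      (\<Sum>j\<in>(\<Pi>\<^sub>E l\<in>UNIV. {..<2 ^ J}). \<Prod>l\<in>UNIV. \<rho> ^ nat \<bar>int (i l) - int (j l)\<bar>)"
    by (simp add: tensor_index_eq_PiE grid_dist_def power_sum)
  also have "\<dots> = (\<Prod>l\<in>UNIV. \<Sum>k<2 ^ J. \<rho> ^ nat \<bar>int (i l) - int k\<bar>)"
    by (rule prod_sum_PiE[symmetric]) auto
  also have "\<dots> \<le> (\<Prod>l\<in>(UNIV :: 'd set). 2 / (1 - \<rho>))"
    using assms by (intro prod_mono conjI sum_nonneg sum_geometric_dist_le) auto
  finally show ?thesis by simp
qed

lemma grid_dist_nbr:
  fixes i j i0 :: "'d::finite \<Rightarrow> nat"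
  assumes "grid_nbr w i j"
  shows "grid_dist i0 j \<le> grid_dist i0 i + CARD('d) * w"
proof -
  have "grid_dist i0 j \<le> (\<Sum>l\<in>UNIV. nat \<bar>int (i0 l) - int (i l)\<bar> + w)"
    unfolding grid_dist_def
  proof (rule sum_mono)
    fix l
    have "\<bar>int (i l) - int (j l)\<bar> \<le> int w" using assms by (simp add: grid_nbr_def)
    then show "nat \<bar>int (i0 l) - int (j l)\<bar> \<le> nat \<bar>int (i0 l) - int (i l)\<bar> + w" by linarith
  qed
  then show ?thesis by (simp add: sum.distrib grid_dist_def)
qed

lemma grid_nbr_sym: "grid_nbr w i j \<Longrightarrow> grid_nbr w j i"
  by (auto simp: grid_nbr_def abs_minus_commute)

text \<open>Neighbours differ by at most \<open>CARD('d) * w\<close> in distance to \<open>i0\<close>, so the ratio lies between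
\<open>z = \<rho> ^ (CARD('d) * w)\<close> and \<open>1 / z\<close>, and \<open>1 - z \<le> 1 / z - 1\<close>.\<close>

lemma grid_dist_weight_slow:
  fixes i j i0 :: "'d::finite \<Rightarrow> nat" and \<rho> :: real
  assumes "grid_nbr w i j" "0 < \<rho>" "\<rho> < 1"
  shows "\<bar>\<rho> ^ grid_dist i0 i / \<rho> ^ grid_dist i0 j - 1\<bar> \<le> 1 / \<rho> ^ (CARD('d) * w) - 1"
proof -
  let ?D = "CARD('d) * w"
  define x y z where "x = \<rho> ^ grid_dist i0 i" and "y = \<rho> ^ grid_dist i0 j" and "z = \<rho> ^ ?D"
  have "\<rho> ^ (grid_dist i0 i + ?D) \<le> y" "\<rho> ^ (grid_dist i0 j + ?D) \<le> x"
    unfolding x_def y_def using grid_dist_nbr[OF assms(1)] grid_dist_nbr[OF grid_nbr_sym[OF assms(1)]] assms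
    by (auto intro!: power_decreasing)
  then have *: "x * z \<le> y" "y * z \<le> x" by (auto simp: x_def y_def z_def power_add)
  have pos: "0 < x" "0 < y" "0 < z" "z \<le> 1" using assms by (auto simp: x_def y_def z_def power_le_one)
  have "x / y \<le> 1 / z" using * pos by (simp add: field_simps)
  moreover have "z \<le> x / y" using * pos by (simp add: field_simps)
  moreover have "2 \<le> z + 1 / z"
  proof -
    have "0 \<le> (z - 1)\<^sup>2" by simp
    then show ?thesis using pos by (simp add: field_simps power2_eq_square)
  qed
  ultimately show ?thesis unfolding x_def[symmetric] y_def[symmetric] z_def[symmetric] by linarith
qed

text \<open>The weights are \<open>\<rho> ^ dist(i0, i)\<close> with \<open>\<rho> < 1\<close> so close to one that \<open>combes_thomas\<close> applies. The sum
of their squares factorises over the coordinates into geometric series, which bounds it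
independently of the resolution \<open>J\<close>.\<close>

lemma banded_inverse_bounded:
  fixes c R :: real and w :: nat
  assumes "0 < c" "0 \<le> R"
  obtains C where "0 \<le> C"
    "\<And>J (A :: ('d::finite \<Rightarrow> nat) \<Rightarrow> ('d \<Rightarrow> nat) \<Rightarrow> real) \<beta> u U i.
      (\<And>i j. i \<in> tensor_index J \<Longrightarrow> j \<in> tensor_index J \<Longrightarrow> \<not> grid_nbr w i j \<Longrightarrow> A i j = 0) \<Longrightarrow>
      (\<And>i j. i \<in> tensor_index J \<Longrightarrow> j \<in> tensor_index J \<Longrightarrow> \<bar>A i j\<bar> \<le> R) \<Longrightarrow>
      (\<And>x. c * (\<Sum>i\<in>tensor_index J. (x i)\<^sup>2) \<le> (\<Sum>i\<in>tensor_index J. \<Sum>j\<in>tensor_index J. A i j * x i * x j)) \<Longrightarrow>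
      (\<And>i. i \<in> tensor_index J \<Longrightarrow> (\<Sum>j\<in>tensor_index J. A i j * \<beta> j) = u i) \<Longrightarrow>
      (\<And>i. i \<in> tensor_index J \<Longrightarrow> \<bar>u i\<bar> \<le> U) \<Longrightarrow> i \<in> tensor_index J \<Longrightarrow> \<bar>\<beta> i\<bar> \<le> C * U"
proof -
  define m where "m = (2 * w + 1) ^ CARD('d)"
  \<comment> \<open>the variation of the weights allowed by \<open>combes_thomas\<close>\<close>
  define \<epsilon> where "\<epsilon> = c / (2 * (R + 1) * m)"
  have m: "0 < m" by (simp add: m_def)
  have \<epsilon>: "0 < \<epsilon>" using assms m by (simp add: \<epsilon>_def)
  have "R * \<epsilon> * m = R / (R + 1) * (c / 2)" using assms m by (simp add: \<epsilon>_def)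
  also have "\<dots> \<le> 1 * (c / 2)" using assms by (intro mult_right_mono) auto
  finally have R\<epsilon>: "R * \<epsilon> * m \<le> c / 2" by simp
  have "((\<lambda>\<rho>::real. 1 / \<rho> ^ (CARD('d) * w) - 1) \<longlongrightarrow> 1 / 1 ^ (CARD('d) * w) - 1) (at_left 1)"
    by (intro tendsto_intros) auto
  then have "\<forall>\<^sub>F \<rho> in at_left (1::real). 1 / \<rho> ^ (CARD('d) * w) - 1 < \<epsilon>"
    using \<epsilon> by (simp add: order_tendsto_iff)
  moreover have "\<forall>\<^sub>F \<rho> in at_left (1::real). \<rho> \<in> {0<..<1}"
    by (rule eventually_at_left_real) simp
  ultimately have "\<forall>\<^sub>F \<rho> in at_left (1::real). 1 / \<rho> ^ (CARD('d) * w) - 1 < \<epsilon> \<and> \<rho> \<in> {0<..<1}"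
    by eventually_elim auto
  then obtain \<rho> :: real where \<rho>: "0 < \<rho>" "\<rho> < 1" "1 / \<rho> ^ (CARD('d) * w) - 1 \<le> \<epsilon>"
    using eventually_happens'[OF trivial_limit_at_left_real] by force
  define C where "C = 2 / c * sqrt ((2 / (1 - \<rho>\<^sup>2)) ^ CARD('d))"
  have \<rho>2: "0 < \<rho>\<^sup>2" "\<rho>\<^sup>2 < 1" using \<rho> by (auto simp: power_less_one_iff)
  show thesis
  proof (rule that)
    show "0 \<le> C" using assms \<rho>2 by (simp add: C_def)
    fix J and A :: "('d \<Rightarrow> nat) \<Rightarrow> ('d \<Rightarrow> nat) \<Rightarrow> real" and \<beta> u U i0
    let ?I = "tensor_index J :: ('d \<Rightarrow> nat) set"
    assume band: "\<And>i j. i \<in> ?I \<Longrightarrow> j \<in> ?I \<Longrightarrow> \<not> grid_nbr w i j \<Longrightarrow> A i j = 0"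
      and le: "\<And>i j. i \<in> ?I \<Longrightarrow> j \<in> ?I \<Longrightarrow> \<bar>A i j\<bar> \<le> R"
      and coercive: "\<And>x. c * (\<Sum>i\<in>?I. (x i)\<^sup>2) \<le> (\<Sum>i\<in>?I. \<Sum>j\<in>?I. A i j * x i * x j)"
      and solve: "\<And>i. i \<in> ?I \<Longrightarrow> (\<Sum>j\<in>?I. A i j * \<beta> j) = u i"
      and u: "\<And>i. i \<in> ?I \<Longrightarrow> \<bar>u i\<bar> \<le> U" and i0: "i0 \<in> ?I"
    have slow: "\<bar>\<rho> ^ grid_dist i0 i / \<rho> ^ grid_dist i0 j - 1\<bar> \<le> \<epsilon>" if "grid_nbr w i j" for i j :: "'d \<Rightarrow> nat"
      using grid_dist_weight_slow[OF that \<rho>(1,2), of i0] \<rho>(3) by linarith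
    have "\<bar>\<beta> i0\<bar> \<le> 2 / c * U * sqrt (\<Sum>i\<in>?I. (\<rho> ^ grid_dist i0 i)\<^sup>2)"
      by (rule combes_thomas[where nbr = "grid_nbr w" and m = m and A = A and R = R and \<epsilon> = \<epsilon> and u = u])
        (use grid_nbr_sym card_grid_nbr_le band le coercive assms \<rho> \<epsilon> R\<epsilon> solve u i0 slow
          in \<open>auto simp: m_def grid_dist_def\<close>)
    also have "(\<Sum>i\<in>?I. (\<rho> ^ grid_dist i0 i)\<^sup>2) = (\<Sum>i\<in>?I. (\<rho>\<^sup>2) ^ grid_dist i0 i)"
      by (simp add: power_mult[symmetric] mult.commute)
    also have "2 / c * U * sqrt \<dots> \<le> 2 / c * U * sqrt ((2 / (1 - \<rho>\<^sup>2)) ^ CARD('d))"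
      using sum_grid_dist_le[OF \<rho>2, where J = J and i = i0] assms(1) u[OF i0]
      by (intro mult_left_mono real_sqrt_le_mono) auto
    finally show "\<bar>\<beta> i0\<bar> \<le> C * U" by (simp add: C_def mult_ac)
  qed
qed

section \<open>The operator norm of the empirical projection\<close>

definition proj_kernel ::
  "'i set \<Rightarrow> ('i \<Rightarrow> 'x \<Rightarrow> real) \<Rightarrow> nat \<Rightarrow> (nat \<Rightarrow> 'x) \<Rightarrow> 'x \<Rightarrow> 'x \<Rightarrow> real" where
  "proj_kernel I b n xs x y =
     (\<Sum>i\<in>I. \<Sum>j\<in>I. b i x * moore_penrose I (emp_gram b n xs) i j * b j y)"

text \<open>The Lebesgue function of the empirical projection, whose supremum is its operator norm.\<close>

definition lebesgue_fn ::
  "'i set \<Rightarrow> ('i \<Rightarrow> 'x \<Rightarrow> real) \<Rightarrow> nat \<Rightarrow> (nat \<Rightarrow> 'x) \<Rightarrow> 'x \<Rightarrow> real" where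
  "lebesgue_fn I b n xs x = (\<Sum>m = 1..n. \<bar>proj_kernel I b n xs x (xs m)\<bar>) / real n"

lemma emp_proj_eq_kernel:
  "emp_proj I b n xs h x = (\<Sum>m = 1..n. proj_kernel I b n xs x (xs m) * h (xs m)) / real n"
proof -
  let ?G = "moore_penrose I (emp_gram b n xs)"
  have "emp_proj I b n xs h x =
      (\<Sum>i\<in>I. \<Sum>j\<in>I. \<Sum>m = 1..n. b i x * ?G i j * b j (xs m) * h (xs m) / real n)"
    unfolding emp_proj_def by (simp add: sum_distrib_left sum_divide_distrib mult.assoc)
  also have "\<dots> = (\<Sum>i\<in>I. \<Sum>m = 1..n. \<Sum>j\<in>I. b i x * ?G i j * b j (xs m) * h (xs m) / real n)"
    by (intro sum.cong refl sum.swap)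
  also have "\<dots> = (\<Sum>m = 1..n. \<Sum>i\<in>I. \<Sum>j\<in>I. b i x * ?G i j * b j (xs m) * h (xs m) / real n)"
    by (rule sum.swap)
  finally show ?thesis
    by (simp add: proj_kernel_def sum_distrib_right sum_divide_distrib)
qed

text \<open>The extremal function at \<open>x\<close> is the sign of the kernel \<open>\<kappa> x\<close>. Repeated design points do no harm,
since the sign depends on the point only.\<close>

lemma sup_op_norm_emp_proj_le_iff:
  assumes C: "0 \<le> C" and xs: "\<And>m. m \<in> {1..n} \<Longrightarrow> xs m \<in> S"
  shows "sup_op_norm S (emp_proj I b n xs) \<le> ereal C \<longleftrightarrow> (\<forall>x\<in>S. lebesgue_fn I b n xs x \<le> C)"
    (is "?L \<longleftrightarrow> ?R")
proof
  assume L: ?L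
  show ?R
  proof
    fix x assume x: "x \<in> S"
    define h where "h = (\<lambda>y. sgn (proj_kernel I b n xs x y))"
    have h1: "\<bar>h y\<bar> \<le> 1" for y by (simp add: h_def sgn_if)
    have bdd: "bounded (h ` S)" unfolding bounded_iff using h1 by (intro exI[of _ 1]) auto
    have "emp_proj I b n xs h x = lebesgue_fn I b n xs x"
      unfolding emp_proj_eq_kernel lebesgue_fn_def h_def
      by (intro arg_cong2[of _ _ _ _ "(/)"] sum.cong refl) (metis abs_sgn)
    note val = this
    have norm_le: "sup_norm_on S h \<le> 1"
      unfolding sup_norm_on_def using h1 by (intro SUP_least) (simp add: one_ereal_def)
    have ge: "ereal \<bar>h y\<bar> \<le> sup_norm_on S h" if "y \<in> S" for y
      unfolding sup_norm_on_def using that by (rule SUP_upper)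
    show "lebesgue_fn I b n xs x \<le> C"
    proof (cases "sup_norm_on S h = 0")
      case True
      then have "h (xs m) = 0" if "m \<in> {1..n}" for m
        using ge[OF xs[OF that]] by simp
      then have "lebesgue_fn I b n xs x = 0" unfolding val[symmetric] emp_proj_eq_kernel by simp
      then show ?thesis using C by simp
    next
      case False
      have "0 \<le> sup_norm_on S h" using ge[OF x] by (rule order_trans[rotated]) simp
      then obtain H where H: "sup_norm_on S h = ereal H" "0 < H" "H \<le> 1"
        using norm_le False by (cases "sup_norm_on S h") (auto simp: one_ereal_def)
      have "ereal (lebesgue_fn I b n xs x) / ereal H \<le> sup_norm_on S (emp_proj I b n xs h) / ereal H"
      proof (rule ereal_divide_right_mono)
        have "ereal \<bar>emp_proj I b n xs h x\<bar> \<le> sup_norm_on S (emp_proj I b n xs h)"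
          unfolding sup_norm_on_def using x by (rule SUP_upper)
        then show "ereal (lebesgue_fn I b n xs x) \<le> sup_norm_on S (emp_proj I b n xs h)"
          unfolding val using abs_ge_self ereal_less_eq(3) order_trans by blast
      qed (use H in simp)
      also have "\<dots> \<le> sup_op_norm S (emp_proj I b n xs)"
        unfolding sup_op_norm_def H(1)[symmetric] using bdd False by (intro SUP_upper) auto
      also have "\<dots> \<le> ereal C" by (rule L)
      finally have "lebesgue_fn I b n xs x / H \<le> C" using H by simp
      then have "lebesgue_fn I b n xs x \<le> C * H" using H by (simp add: field_simps)
      also have "\<dots> \<le> C * 1" using C H by (intro mult_left_mono) auto
      finally show ?thesis by simp
    qed
  qed
next
  assume R: ?R
  show ?L unfolding sup_op_norm_def
  proof (rule SUP_least)
    fix h assume "h \<in> {h. bounded (h ` S) \<and> sup_norm_on S h \<noteq> 0}"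
    then have bdd: "bounded (h ` S)" and nz: "sup_norm_on S h \<noteq> 0" by auto
    have ge: "ereal \<bar>h y\<bar> \<le> sup_norm_on S h" if "y \<in> S" for y
      unfolding sup_norm_on_def using that by (rule SUP_upper)
    show "sup_norm_on S (emp_proj I b n xs h) / sup_norm_on S h \<le> ereal C"
    proof (cases "S = {}")
      case True
      have "- \<infinity> / (- \<infinity> :: ereal) = 0" by simp
      then show ?thesis using C True by (simp add: sup_norm_on_def bot_ereal_def)
    next
      case False
      then obtain y where y: "y \<in> S" by auto
      have "0 \<le> sup_norm_on S h" using ge[OF y] by (rule order_trans[rotated]) simp
      moreover obtain B where "\<And>y. y \<in> S \<Longrightarrow> \<bar>h y\<bar> \<le> B" using bdd unfolding bounded_iff by auto
      then have "sup_norm_on S h \<le> ereal B" unfolding sup_norm_on_def by (intro SUP_least) simp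
      ultimately obtain H where H: "sup_norm_on S h = ereal H" "0 < H"
        using nz by (cases "sup_norm_on S h") auto
      have hH: "\<bar>h y\<bar> \<le> H" if "y \<in> S" for y using ge[OF that] H by simp
      have "sup_norm_on S (emp_proj I b n xs h) \<le> ereal (C * H)"
        unfolding sup_norm_on_def
      proof (rule SUP_least)
        fix x assume x: "x \<in> S"
        have "\<bar>\<Sum>m = 1..n. proj_kernel I b n xs x (xs m) * h (xs m)\<bar>
            \<le> (\<Sum>m = 1..n. \<bar>proj_kernel I b n xs x (xs m)\<bar> * H)"
          by (intro order_trans[OF sum_abs] sum_mono) (auto simp: abs_mult intro!: mult_left_mono hH xs)
        then have "\<bar>emp_proj I b n xs h x\<bar> \<le> lebesgue_fn I b n xs x * H"
          unfolding emp_proj_eq_kernel lebesgue_fn_def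
          by (simp add: sum_distrib_right divide_right_mono)
        also have "\<dots> \<le> C * H" using R x H by (intro mult_right_mono) auto
        finally show "ereal \<bar>emp_proj I b n xs h x\<bar> \<le> ereal (C * H)" by simp
      qed
      then have "sup_norm_on S (emp_proj I b n xs h) / sup_norm_on S h \<le> ereal (C * H) / ereal H"
        unfolding H(1) using H by (intro ereal_divide_right_mono) auto
      then show ?thesis using H by simp
    qed
  qed
qed

text \<open>The Lebesgue function is continuous on the cube and vanishes outside of it, so it is enough to
check the bound on a countable dense subset of the cube.\<close>

lemma sets_sup_op_norm_emp_proj_le:
  fixes b :: "'i \<Rightarrow> 'x::euclidean_space \<Rightarrow> real"
  assumes C: "0 \<le> C" and fin: "finite I"
    and b_meas: "\<And>i. i \<in> I \<Longrightarrow> b i \<in> borel_measurable borel"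
    and b_cont: "\<And>i. i \<in> I \<Longrightarrow> continuous_on Q (b i)"
    and b_zero: "\<And>i x. i \<in> I \<Longrightarrow> x \<notin> Q \<Longrightarrow> b i x = 0"
    and Q: "closed Q" "Q \<subseteq> S"
    and X: "\<And>m. X m \<in> borel_measurable M" and XS: "\<And>m \<omega>. \<omega> \<in> space M \<Longrightarrow> X m \<omega> \<in> S"
  shows "{\<omega> \<in> space M. sup_op_norm S (emp_proj I b n (\<lambda>m. X m \<omega>)) \<le> ereal C} \<in> sets M"
proof -
  obtain D where D: "countable D" "D \<subseteq> Q" "Q \<subseteq> closure D" by (rule separable)
  have clD: "closure D = Q" using D Q closure_minimal by blast
  have "sup_op_norm S (emp_proj I b n (\<lambda>m. X m \<omega>)) \<le> ereal C \<longleftrightarrow>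
      (\<forall>x\<in>D. lebesgue_fn I b n (\<lambda>m. X m \<omega>) x \<le> C)" if \<omega>: "\<omega> \<in> space M" for \<omega>
  proof -
    let ?xs = "\<lambda>m. X m \<omega>"
    have "lebesgue_fn I b n ?xs x \<le> C" if "x \<notin> Q" for x
      using b_zero[OF _ that] C by (simp add: lebesgue_fn_def proj_kernel_def)
    moreover have "lebesgue_fn I b n ?xs x \<le> C"
      if le: "\<And>x. x \<in> D \<Longrightarrow> lebesgue_fn I b n ?xs x \<le> C" and x: "x \<in> Q" for x
    proof (rule continuous_le_on_closure[where S = D and f = "lebesgue_fn I b n ?xs"])
      show "continuous_on (closure D) (lebesgue_fn I b n ?xs)"
        unfolding clD lebesgue_fn_def proj_kernel_def divide_inverse
        by (intro continuous_intros b_cont)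
    qed (use le x clD in auto)
    ultimately have "(\<forall>x\<in>S. lebesgue_fn I b n ?xs x \<le> C) \<longleftrightarrow> (\<forall>x\<in>D. lebesgue_fn I b n ?xs x \<le> C)"
      using D Q by blast
    then show ?thesis using sup_op_norm_emp_proj_le_iff[OF C, of n ?xs S I b] XS[OF \<omega>] by simp
  qed
  then have "{\<omega> \<in> space M. sup_op_norm S (emp_proj I b n (\<lambda>m. X m \<omega>)) \<le> ereal C} =
      {\<omega> \<in> space M. \<forall>x\<in>D. lebesgue_fn I b n (\<lambda>m. X m \<omega>) x \<le> C}" by blast
  also have "\<dots> \<in> sets M"
  proof -
    note [measurable] = X
    have [measurable]: "(\<lambda>\<omega>. moore_penrose I (emp_gram b n (\<lambda>m. X m \<omega>)) i j) \<in> borel_measurable M"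
      if "i \<in> I" "j \<in> I" for i j
      using fin b_meas X that by (rule borel_measurable_moore_penrose_emp_gram)
    have [measurable]: "(\<lambda>\<omega>. b j (X m \<omega>)) \<in> borel_measurable M" if "j \<in> I" for j m
      using measurable_compose[OF X b_meas[OF that]] .
    have "Measurable.pred M (\<lambda>\<omega>. lebesgue_fn I b n (\<lambda>m. X m \<omega>) x \<le> C)" for x
      unfolding lebesgue_fn_def proj_kernel_def by measurable
    then have "Measurable.pred M (\<lambda>\<omega>. \<forall>x\<in>D. lebesgue_fn I b n (\<lambda>m. X m \<omega>) x \<le> C)"
      using D(1) by (intro measurable_pred_countable)
    then show ?thesis by (simp add: pred_def)
  qed
  finally show ?thesis .
qed

text \<open>The properties of a sample on which the projection is stable: \<open>r\<close> is the scale \<open>\<surd>K\<close> of the basis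
functions, \<open>w\<close> the band width, and the last three conditions are the ones that hold with high
probability.\<close>

definition well_conditioned_design ::
  "nat \<Rightarrow> real \<Rightarrow> real \<Rightarrow> real \<Rightarrow> real \<Rightarrow> nat \<Rightarrow> real \<Rightarrow> nat \<Rightarrow>
    (('d::finite \<Rightarrow> nat) \<Rightarrow> 'x \<Rightarrow> real) \<Rightarrow> (nat \<Rightarrow> 'x) \<Rightarrow> bool" where
  "well_conditioned_design w c R B T J r n b xs \<longleftrightarrow>
     0 < r \<and>
     (\<forall>i\<in>tensor_index J. \<forall>j\<in>tensor_index J. \<not> grid_nbr w i j \<longrightarrow> (\<forall>x. b i x * b j x = 0)) \<and>
     (\<forall>i\<in>tensor_index J. \<forall>x. \<bar>b i x\<bar> \<le> B * r) \<and>
     (\<forall>i\<in>tensor_index J. (\<Sum>m = 1..n. r * \<bar>b i (xs m)\<bar>) / real n \<le> T) \<and>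
     (\<forall>i\<in>tensor_index J. \<forall>j\<in>tensor_index J. \<bar>emp_gram b n xs i j\<bar> \<le> R) \<and>
     (\<forall>v. c * (\<Sum>i\<in>tensor_index J. (v i)\<^sup>2) \<le>
        (\<Sum>i\<in>tensor_index J. \<Sum>j\<in>tensor_index J. emp_gram b n xs i j * v i * v j))"

text \<open>The value at \<open>x\<close> equals \<open>\<Sum>i. b\<^sub>i(x) \<beta>\<^sub>i\<close>, where \<open>A \<beta> = u\<close> and \<open>u\<close> consists of the empirical inner
products of the basis with a function of modulus at most one, so \<open>\<bar>u\<^sub>i\<bar> \<le> T / r\<close>. Hence \<open>\<beta>\<close> is of order
\<open>1 / r\<close>, which balances the factor \<open>r\<close> in \<open>b\<^sub>i(x)\<close>, and only boundedly many \<open>b\<^sub>i(x)\<close> are nonzero.\<close>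

lemma lebesgue_fn_bounded:
  fixes c R B T :: real and w :: nat
  assumes c: "0 < c" and R: "0 \<le> R" and B: "0 \<le> B" and T: "0 \<le> T"
  shows "\<exists>C\<ge>0. \<forall>J r n (b :: ('d::finite \<Rightarrow> nat) \<Rightarrow> 'x \<Rightarrow> real) xs x.
    well_conditioned_design w c R B T J r n b xs \<longrightarrow> lebesgue_fn (tensor_index J) b n xs x \<le> C"
proof -
  obtain C where C: "0 \<le> C" and inv: "\<And>J (A :: ('d \<Rightarrow> nat) \<Rightarrow> ('d \<Rightarrow> nat) \<Rightarrow> real) \<beta> u U i.
      (\<And>i j. i \<in> tensor_index J \<Longrightarrow> j \<in> tensor_index J \<Longrightarrow> \<not> grid_nbr w i j \<Longrightarrow> A i j = 0) \<Longrightarrow>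
      (\<And>i j. i \<in> tensor_index J \<Longrightarrow> j \<in> tensor_index J \<Longrightarrow> \<bar>A i j\<bar> \<le> R) \<Longrightarrow>
      (\<And>x. c * (\<Sum>i\<in>tensor_index J. (x i)\<^sup>2) \<le> (\<Sum>i\<in>tensor_index J. \<Sum>j\<in>tensor_index J. A i j * x i * x j)) \<Longrightarrow>
      (\<And>i. i \<in> tensor_index J \<Longrightarrow> (\<Sum>j\<in>tensor_index J. A i j * \<beta> j) = u i) \<Longrightarrow>
      (\<And>i. i \<in> tensor_index J \<Longrightarrow> \<bar>u i\<bar> \<le> U) \<Longrightarrow> i \<in> tensor_index J \<Longrightarrow> \<bar>\<beta> i\<bar> \<le> C * U"
    using banded_inverse_bounded[OF c R, where 'd = 'd and w = w] by blast
  define m where "m = (2 * w + 1) ^ CARD('d)"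
  show ?thesis
  proof (intro exI[of _ "m * (B * (C * T))"] conjI allI impI)
    show "0 \<le> m * (B * (C * T))" using B C T by simp
    fix J n and xs :: "nat \<Rightarrow> 'x" and x r and b :: "('d \<Rightarrow> nat) \<Rightarrow> 'x \<Rightarrow> real"
    let ?I = "tensor_index J :: ('d \<Rightarrow> nat) set"
    assume "well_conditioned_design w c R B T J r n b xs"
    then have r: "0 < r"
      and band: "\<And>i j x. i \<in> ?I \<Longrightarrow> j \<in> ?I \<Longrightarrow> \<not> grid_nbr w i j \<Longrightarrow> b i x * b j x = 0"
      and bB: "\<And>i x. i \<in> ?I \<Longrightarrow> \<bar>b i x\<bar> \<le> B * r"
      and bT: "\<And>i. i \<in> ?I \<Longrightarrow> (\<Sum>m = 1..n. r * \<bar>b i (xs m)\<bar>) / real n \<le> T"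
      and gR: "\<And>i j. i \<in> ?I \<Longrightarrow> j \<in> ?I \<Longrightarrow> \<bar>emp_gram b n xs i j\<bar> \<le> R"
      and coercive: "\<And>v. c * (\<Sum>i\<in>?I. (v i)\<^sup>2) \<le> (\<Sum>i\<in>?I. \<Sum>j\<in>?I. emp_gram b n xs i j * v i * v j)"
      unfolding well_conditioned_design_def by blast+
    let ?G = "moore_penrose ?I (emp_gram b n xs)"
    define \<sigma> where "\<sigma> = (\<lambda>y. sgn (proj_kernel ?I b n xs x y))"
    define u where "u = (\<lambda>j. (1 / real n * (\<Sum>m = 1..n. b j (xs m) * \<sigma> (xs m))))"
    define \<beta> where "\<beta> = (\<lambda>i. \<Sum>j\<in>?I. ?G i j * u j)"
    have \<sigma>1: "\<bar>\<sigma> y\<bar> \<le> 1" for y by (simp add: \<sigma>_def sgn_if)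
    have uT: "\<bar>u j\<bar> \<le> T / r" if "j \<in> ?I" for j
    proof -
      have "\<bar>\<Sum>m = 1..n. b j (xs m) * \<sigma> (xs m)\<bar> \<le> (\<Sum>m = 1..n. \<bar>b j (xs m)\<bar>)"
        using \<sigma>1 by (intro order_trans[OF sum_abs] sum_mono) (simp add: abs_mult mult_left_le)
      then have "\<bar>u j\<bar> \<le> (\<Sum>m = 1..n. \<bar>b j (xs m)\<bar>) / real n"
        unfolding u_def by (simp add: abs_mult divide_right_mono)
      moreover have "(\<Sum>m = 1..n. \<bar>b j (xs m)\<bar>) / real n * r \<le> T"
        using bT[OF that] by (simp add: sum_distrib_left[symmetric] mult_ac)
      ultimately show ?thesis using r by (smt (verit) mult_right_mono pos_le_divide_eq)
    qed
    have \<beta>: "\<bar>\<beta> i\<bar> \<le> C * (T / r)" if "i \<in> ?I" for i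
    proof (rule inv[where A = "emp_gram b n xs" and u = u])
      show "emp_gram b n xs i j = 0" if "i \<in> ?I" "j \<in> ?I" "\<not> grid_nbr w i j" for i j
        unfolding emp_gram_def using band[OF that] by (simp only: sum.neutral_const div_0)
      show "(\<Sum>j\<in>?I. emp_gram b n xs i j * \<beta> j) = u i" if "i \<in> ?I" for i
        unfolding \<beta>_def
        by (rule moore_penrose_solves[OF _ is_moore_penrose_emp_gram _ coercive c that])
          (auto simp: emp_gram_def mult.commute)
    qed (use gR coercive uT that in auto)
    have "lebesgue_fn ?I b n xs x = emp_proj ?I b n xs \<sigma> x"
      unfolding emp_proj_eq_kernel lebesgue_fn_def \<sigma>_def
      by (intro arg_cong2[of _ _ _ _ "(/)"] sum.cong refl) (metis abs_sgn)
    also have "\<dots> = (\<Sum>i\<in>?I. b i x * \<beta> i)"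
      unfolding emp_proj_def \<beta>_def u_def by (simp add: sum_distrib_left mult.assoc)
    also have "\<dots> = (\<Sum>i\<in>{i\<in>?I. b i x \<noteq> 0}. b i x * \<beta> i)"
      by (intro sum.mono_neutral_right) auto
    also have "\<dots> \<le> (\<Sum>i\<in>{i\<in>?I. b i x \<noteq> 0}. B * (C * T))"
    proof (rule sum_mono)
      fix i assume i: "i \<in> {i\<in>?I. b i x \<noteq> 0}"
      have "b i x * \<beta> i \<le> \<bar>b i x\<bar> * \<bar>\<beta> i\<bar>" by (metis abs_ge_self abs_mult)
      also have "\<dots> \<le> (B * r) * (C * (T / r))" using bB \<beta> i B r by (intro mult_mono) auto
      finally show "b i x * \<beta> i \<le> B * (C * T)" using r by simp
    qed
    also have "\<dots> = card {i\<in>?I. b i x \<noteq> 0} * (B * (C * T))" by simp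
    also have "\<dots> \<le> m * (B * (C * T))"
    proof (rule mult_right_mono)
      show "real (card {i\<in>?I. b i x \<noteq> 0}) \<le> real m"
      proof (cases "{i\<in>?I. b i x \<noteq> 0} = {}")
        case False
        then obtain i0 where i0: "i0 \<in> ?I" "b i0 x \<noteq> 0" by auto
        then have "{i\<in>?I. b i x \<noteq> 0} \<subseteq> {i\<in>?I. grid_nbr w i0 i}" using band by fastforce
        then have "card {i\<in>?I. b i x \<noteq> 0} \<le> card {i\<in>?I. grid_nbr w i0 i}"
          by (intro card_mono) auto
        also have "\<dots> \<le> m" unfolding m_def by (rule card_grid_nbr_le)
        finally show ?thesis by simp
      qed (simp only: card.empty of_nat_0 of_nat_0_le_iff)
    qed (use B C T in simp)
    finally show "lebesgue_fn ?I b n xs x \<le> m * (B * (C * T))" .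
  qed
qed

section \<open>Deviations of sums of weakly dependent variables\<close>

text \<open>The sum here is at most \<open>2 \<beta>\<close> for the \<open>\<beta>\<close>-coefficient of the two families, and \<open>0\<close> for
independent ones, so that the mixing and the independent case can be treated together.\<close>

definition dependence_le :: "'a measure \<Rightarrow> 'a set set \<Rightarrow> 'a set set \<Rightarrow> real \<Rightarrow> bool" where
  "dependence_le M \<A> \<B> \<tau> \<longleftrightarrow>
     (\<forall>P Q. finite P \<and> partition_on (space M) P \<and> P \<subseteq> \<A> \<and>
            finite Q \<and> partition_on (space M) Q \<and> Q \<subseteq> \<B> \<longrightarrow>
        (\<Sum>A\<in>P. \<Sum>B\<in>Q. \<bar>measure M (A \<inter> B) - measure M A * measure M B\<bar>) \<le> \<tau>)"

text \<open>The measurable space generated by part of the sequence, as a measure so that measurability and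
simple functions with respect to it are available.\<close>

definition gen_measure :: "'a measure \<Rightarrow> (int \<Rightarrow> 'a \<Rightarrow> 'b::topological_space) \<Rightarrow> int set \<Rightarrow> 'a measure" where
  "gen_measure M X T = sigma (space M) {X i -` S \<inter> space M | i S. i \<in> T \<and> S \<in> sets borel}"

lemma space_gen_measure [simp]: "space (gen_measure M X T) = space M"
  unfolding gen_measure_def by (rule space_measure_of) auto

lemma sets_gen_measure: "sets (gen_measure M X T) = gen_sigma M X T"
  unfolding gen_measure_def gen_sigma_def by (rule sets_measure_of) auto

lemma gen_sigma_subset:
  assumes "\<And>i. X i \<in> borel_measurable M"
  shows "gen_sigma M X T \<subseteq> sets M"
  unfolding gen_sigma_def using assms by (intro sets.sigma_sets_subset) (auto intro: measurable_sets)

lemma gen_sigma_mono: "T \<subseteq> U \<Longrightarrow> gen_sigma M X T \<subseteq> gen_sigma M X U"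
  unfolding gen_sigma_def by (intro sigma_sets_mono') blast

lemma measurable_gen_measure: "i \<in> T \<Longrightarrow> X i \<in> borel_measurable (gen_measure M X T)"
  by (rule measurableI) (simp, simp only: sets_gen_measure gen_sigma_def space_gen_measure,
    rule sigma_sets.Basic, blast)

lemma dependence_le_mono:
  "dependence_le M \<A> \<B> \<tau> \<Longrightarrow> \<A>' \<subseteq> \<A> \<Longrightarrow> \<B>' \<subseteq> \<B> \<Longrightarrow> dependence_le M \<A>' \<B>' \<tau>"
  unfolding dependence_le_def by (meson subset_trans)

lemma simple_function_level_sets:
  assumes Z: "simple_function M Z"
  shows "finite ((\<lambda>a. {\<omega> \<in> space M. Z \<omega> = a}) ` Z ` space M)"
    and "partition_on (space M) ((\<lambda>a. {\<omega> \<in> space M. Z \<omega> = a}) ` Z ` space M)"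
    and "(\<lambda>a. {\<omega> \<in> space M. Z \<omega> = a}) ` Z ` space M \<subseteq> sets M"
    and "inj_on (\<lambda>a. {\<omega> \<in> space M. Z \<omega> = a}) (Z ` space M)"
proof -
  show "finite ((\<lambda>a. {\<omega> \<in> space M. Z \<omega> = a}) ` Z ` space M)"
    using Z by (simp add: simple_function_def)
  show "partition_on (space M) ((\<lambda>a. {\<omega> \<in> space M. Z \<omega> = a}) ` Z ` space M)"
    by (rule partition_onI) (auto simp: disjnt_def)
  show "(\<lambda>a. {\<omega> \<in> space M. Z \<omega> = a}) ` Z ` space M \<subseteq> sets M"
  proof (rule image_subsetI)
    fix a
    have "Z -` {a} \<inter> space M = {\<omega> \<in> space M. Z \<omega> = a}" by auto
    then show "{\<omega> \<in> space M. Z \<omega> = a} \<in> sets M"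
      using simple_functionD(2)[OF Z, of "{a}"] by simp
  qed
  show "inj_on (\<lambda>a. {\<omega> \<in> space M. Z \<omega> = a}) (Z ` space M)"
  proof (rule inj_onI)
    fix a b assume "a \<in> Z ` space M" and eq: "{\<omega> \<in> space M. Z \<omega> = a} = {\<omega> \<in> space M. Z \<omega> = b}"
    then obtain \<omega> where "\<omega> \<in> {\<omega> \<in> space M. Z \<omega> = a}" by auto
    then have "\<omega> \<in> {\<omega> \<in> space M. Z \<omega> = a} \<inter> {\<omega> \<in> space M. Z \<omega> = b}" using eq by simp
    then show "a = b" by (simp only: Int_iff mem_Collect_eq) metis
  qed
qed

text \<open>The level sets of a simple function form a finite partition.\<close>

lemma dependence_le_simple_functions:
  assumes dep: "dependence_le M (sets M1) (sets M2) \<tau>"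
    and sp: "space M1 = space M" "space M2 = space M"
    and U: "simple_function M1 U" and V: "simple_function M2 V"
  shows "(\<Sum>a\<in>U ` space M. \<Sum>b\<in>V ` space M.
      \<bar>measure M {\<omega> \<in> space M. U \<omega> = a \<and> V \<omega> = b} -
       measure M {\<omega> \<in> space M. U \<omega> = a} * measure M {\<omega> \<in> space M. V \<omega> = b}\<bar>) \<le> \<tau>"
proof -
  note U' = simple_function_level_sets[OF U, unfolded sp]
  note V' = simple_function_level_sets[OF V, unfolded sp]
  have int: "{\<omega> \<in> space M. U \<omega> = a} \<inter> {\<omega> \<in> space M. V \<omega> = b} = {\<omega> \<in> space M. U \<omega> = a \<and> V \<omega> = b}" for a b
    by auto
  let ?P = "(\<lambda>a. {\<omega> \<in> space M. U \<omega> = a}) ` U ` space M"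
  let ?Q = "(\<lambda>b. {\<omega> \<in> space M. V \<omega> = b}) ` V ` space M"
  have "(\<Sum>A\<in>?P. \<Sum>B\<in>?Q. \<bar>measure M (A \<inter> B) - measure M A * measure M B\<bar>) \<le> \<tau>"
    using dep[unfolded dependence_le_def, rule_format, of ?P ?Q] U' V' by blast
  then show ?thesis
    unfolding sum.reindex[OF U'(4)] sum.reindex[OF V'(4)] o_def int .
qed

context prob_space begin

lemma integrable_simple_function_compose:
  fixes g :: "'b \<Rightarrow> real"
  assumes "simple_function M Z"
  shows "integrable M (\<lambda>\<omega>. g (Z \<omega>))"
proof -
  have sf: "simple_function M (\<lambda>\<omega>. g (Z \<omega>))" using assms by (rule simple_function_compose1)
  have fin: "finite ((\<lambda>\<omega>. norm (g (Z \<omega>))) ` space M)"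
    using simple_functionD(1)[OF simple_function_compose1[OF sf, of norm]] .
  show ?thesis
    using sf fin
    by (intro integrable_const_bound[where B = "Max ((\<lambda>\<omega>. norm (g (Z \<omega>))) ` space M)"])
      (auto intro: borel_measurable_simple_function)
qed

lemma expectation_simple_function_compose:
  fixes g :: "'b \<Rightarrow> real"
  assumes Z: "simple_function M Z" and F: "finite F" "Z ` space M \<subseteq> F"
  shows "expectation (\<lambda>\<omega>. g (Z \<omega>)) = (\<Sum>z\<in>F. g z * prob {\<omega> \<in> space M. Z \<omega> = z})"
proof -
  have meas: "{\<omega> \<in> space M. Z \<omega> = z} \<in> events" for z
  proof -
    have "Z -` {z} \<inter> space M = {\<omega> \<in> space M. Z \<omega> = z}" by auto
    then show ?thesis using simple_functionD(2)[OF Z, of "{z}"] by simp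
  qed
  have "expectation (\<lambda>\<omega>. g (Z \<omega>)) =
      expectation (\<lambda>\<omega>. \<Sum>z\<in>F. g z * indicator {\<omega> \<in> space M. Z \<omega> = z} \<omega>)"
  proof (rule Bochner_Integration.integral_cong[OF refl])
    fix \<omega> assume \<omega>: "\<omega> \<in> space M"
    have "(\<Sum>z\<in>F. g z * indicator {\<omega> \<in> space M. Z \<omega> = z} \<omega>) = (\<Sum>z\<in>F. if Z \<omega> = z then g z else 0)"
      using \<omega> by (intro sum.cong) (auto simp: indicator_def)
    also have "\<dots> = g (Z \<omega>)" using F \<omega> by (simp add: sum.delta' image_subset_iff)
    finally show "g (Z \<omega>) = (\<Sum>z\<in>F. g z * indicator {\<omega> \<in> space M. Z \<omega> = z} \<omega>)" ..
  qed
  also have "\<dots> = (\<Sum>z\<in>F. g z * prob {\<omega> \<in> space M. Z \<omega> = z})"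
  proof -
    have "integrable M (\<lambda>\<omega>. g z * indicator {\<omega> \<in> space M. Z \<omega> = z} \<omega>)" for z
      by (intro integrable_mult_right integrable_real_indicator meas) (simp add: less_top[symmetric])
    then have "expectation (\<lambda>\<omega>. \<Sum>z\<in>F. g z * indicator {\<omega> \<in> space M. Z \<omega> = z} \<omega>) =
        (\<Sum>z\<in>F. expectation (\<lambda>\<omega>. g z * indicator {\<omega> \<in> space M. Z \<omega> = z} \<omega>))"
      by (rule Bochner_Integration.integral_sum)
    then show ?thesis using sets.Int_space_eq2[OF meas] by (simp only: integral_mult_right_zero Bochner_Integration.integral_indicator)
  qed
  finally show ?thesis .
qed

text \<open>Replacing the last summand by an independent copy costs at most \<open>\<tau>\<close>, since \<open>0 \<le> f \<le> 1\<close>. What remains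
is the same statement for \<open>\<lambda>a. E (f (a + W k))\<close>, which again lies in \<open>[0, 1]\<close> and satisfies the
exponential bound with each \<open>c e\<close> multiplied by the moment generating function of \<open>W k\<close>. As \<open>f\<close>
is a function of the whole vector, the cost does not depend on the size of \<open>E\<close>.\<close>

lemma expectation_sum_weakly_dependent_le:
  fixes W :: "nat \<Rightarrow> 'a \<Rightarrow> 'e \<Rightarrow> real"
  defines "S \<equiv> \<lambda>k \<omega> e. \<Sum>j<k. W j \<omega> e"
  assumes W: "\<And>j. simple_function M (W j)"
    and dep: "\<And>k. (\<Sum>a\<in>S k ` space M. \<Sum>b\<in>W k ` space M.
      \<bar>prob {\<omega> \<in> space M. S k \<omega> = a \<and> W k \<omega> = b} -
       prob {\<omega> \<in> space M. S k \<omega> = a} * prob {\<omega> \<in> space M. W k \<omega> = b}\<bar>) \<le> \<tau>"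
    and f: "\<And>v. 0 \<le> f v" "\<And>v. f v \<le> 1" "\<And>v. f v \<le> (\<Sum>e\<in>E. c e * exp (\<theta> * v e))"
  shows "expectation (\<lambda>\<omega>. f (S k \<omega>)) \<le>
    (\<Sum>e\<in>E. c e * (\<Prod>j<k. expectation (\<lambda>\<omega>. exp (\<theta> * W j \<omega> e)))) + real k * \<tau>"
  using f
proof (induction k arbitrary: f c)
  case 0
  then show ?case using "0"(3)[of "\<lambda>_. 0"] by (simp add: S_def prob_space)
next
  case (Suc k)
  have S: "simple_function M (S k)" for k
  proof (induction k)
    case (Suc k)
    have "S (Suc k) = (\<lambda>\<omega>. (\<lambda>a b e. a e + b e) (S k \<omega>) (W k \<omega>))" by (simp add: S_def fun_eq_iff)
    then show ?case using simple_function_compose2[OF Suc W] by simp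
  qed (simp add: S_def)
  let ?P = "\<lambda>a b. prob {\<omega> \<in> space M. S k \<omega> = a \<and> W k \<omega> = b}"
  let ?PS = "\<lambda>a. prob {\<omega> \<in> space M. S k \<omega> = a}"
  let ?PW = "\<lambda>b. prob {\<omega> \<in> space M. W k \<omega> = b}"
  let ?A = "S k ` space M" and ?B = "W k ` space M"
  have finA: "finite ?A" and finB: "finite ?B"
    using simple_functionD(1)[OF S] simple_functionD(1)[OF W] by auto
  define g where "g = (\<lambda>a. expectation (\<lambda>\<omega>. f (\<lambda>e. a e + W k \<omega> e)))"
  have g_eq: "g a = (\<Sum>b\<in>?B. f (\<lambda>e. a e + b e) * ?PW b)" for a
    unfolding g_def using finB by (intro expectation_simple_function_compose[OF W]) auto
  have "expectation (\<lambda>\<omega>. f (S (Suc k) \<omega>)) =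
      expectation (\<lambda>\<omega>. (\<lambda>(a, b). f (\<lambda>e. a e + b e)) (S k \<omega>, W k \<omega>))"
    by (simp add: S_def)
  also have "\<dots> = (\<Sum>z\<in>?A \<times> ?B. (\<lambda>(a, b). f (\<lambda>e. a e + b e)) z * prob {\<omega> \<in> space M. (S k \<omega>, W k \<omega>) = z})"
    using finA finB by (intro expectation_simple_function_compose simple_function_Pair S W) auto
  also have "\<dots> = (\<Sum>a\<in>?A. \<Sum>b\<in>?B. f (\<lambda>e. a e + b e) * ?P a b)"
    unfolding sum.cartesian_product by (intro sum.cong) auto
  also have "\<dots> \<le> (\<Sum>a\<in>?A. \<Sum>b\<in>?B. f (\<lambda>e. a e + b e) * (?PS a * ?PW b) + \<bar>?P a b - ?PS a * ?PW b\<bar>)"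
  proof (intro sum_mono)
    fix a b
    let ?f = "f (\<lambda>e. a e + b e)"
    have "?f * (?P a b - ?PS a * ?PW b) \<le> 1 * \<bar>?P a b - ?PS a * ?PW b\<bar>"
      using Suc.prems(1,2) by (meson abs_ge_self abs_ge_zero mult_left_mono mult_right_mono order_trans)
    then show "?f * ?P a b \<le> ?f * (?PS a * ?PW b) + \<bar>?P a b - ?PS a * ?PW b\<bar>"
      by (simp add: right_diff_distrib)
  qed
  also have "\<dots> \<le> (\<Sum>a\<in>?A. \<Sum>b\<in>?B. f (\<lambda>e. a e + b e) * (?PS a * ?PW b)) + \<tau>"
    unfolding sum.distrib using dep[of k] by simp
  also have "(\<Sum>a\<in>?A. \<Sum>b\<in>?B. f (\<lambda>e. a e + b e) * (?PS a * ?PW b)) = (\<Sum>a\<in>?A. g a * ?PS a)"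
    unfolding g_eq by (simp add: sum_distrib_left sum_distrib_right mult_ac)
  also have "\<dots> = expectation (\<lambda>\<omega>. g (S k \<omega>))"
    using finA by (intro expectation_simple_function_compose[OF S, symmetric]) auto
  also have "\<dots> \<le> (\<Sum>e\<in>E. c e * expectation (\<lambda>\<omega>. exp (\<theta> * W k \<omega> e)) *
      (\<Prod>j<k. expectation (\<lambda>\<omega>. exp (\<theta> * W j \<omega> e)))) + real k * \<tau>"
  proof (rule Suc.IH)
    fix v
    have int: "integrable M (\<lambda>\<omega>. h (W k \<omega>))" for h :: "_ \<Rightarrow> real"
      by (rule integrable_simple_function_compose[OF W])
    show "0 \<le> g v" unfolding g_def using Suc.prems(1) by (intro integral_nonneg_AE) auto
    have "g v \<le> expectation (\<lambda>_. 1)"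
      unfolding g_def using Suc.prems(2) int[of "\<lambda>b. f (\<lambda>e. v e + b e)"] by (intro integral_mono) auto
    then show "g v \<le> 1" by (simp add: prob_space)
    have "g v \<le> expectation (\<lambda>\<omega>. \<Sum>e\<in>E. c e * exp (\<theta> * (v e + W k \<omega> e)))"
      unfolding g_def using Suc.prems(3) int[of "\<lambda>b. f (\<lambda>e. v e + b e)"]
        int[of "\<lambda>b. \<Sum>e\<in>E. c e * exp (\<theta> * (v e + b e))"] by (intro integral_mono) auto
    also have "\<dots> = (\<Sum>e\<in>E. expectation (\<lambda>\<omega>. c e * exp (\<theta> * (v e + W k \<omega> e))))"
      using int[of "\<lambda>b. c _ * exp (\<theta> * (v _ + b _))"] by (intro Bochner_Integration.integral_sum)
    also have "\<dots> = (\<Sum>e\<in>E. c e * expectation (\<lambda>\<omega>. exp (\<theta> * W k \<omega> e)) * exp (\<theta> * v e))"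
      by (simp add: distrib_left exp_add mult_ac)
    finally show "g v \<le> (\<Sum>e\<in>E. c e * expectation (\<lambda>\<omega>. exp (\<theta> * W k \<omega> e)) * exp (\<theta> * v e))" .
  qed
  finally show ?case by (simp add: algebra_simps)
qed

end

lemma simple_function_vector:
  assumes "finite E" "\<And>e. e \<in> E \<Longrightarrow> simple_function M (Z e)"
  shows "simple_function M (\<lambda>\<omega> e. if e \<in> E then Z e \<omega> else (0::real))"
  using assms
proof (induction E rule: finite_induct)
  case (insert e0 E)
  have "(\<lambda>\<omega> e. if e \<in> insert e0 E then Z e \<omega> else 0) =
      (\<lambda>\<omega>. (\<lambda>v z. v(e0 := z)) (\<lambda>e. if e \<in> E then Z e \<omega> else 0) (Z e0 \<omega>))"
    by (auto simp: fun_eq_iff)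
  moreover have "simple_function M (\<lambda>\<omega>. (\<lambda>v z. v(e0 := z)) (\<lambda>e. if e \<in> E then Z e \<omega> else 0) (Z e0 \<omega>))"
    using insert by (intro simple_function_compose2[of M _ _ "\<lambda>v z. v(e0 := z)"]) auto
  ultimately show ?case by simp
qed simp

lemma simple_function_round_down:
  fixes Z :: "'a \<Rightarrow> real"
  assumes Z: "Z \<in> borel_measurable M" and B: "\<And>\<omega>. \<omega> \<in> space M \<Longrightarrow> \<bar>Z \<omega>\<bar> \<le> B" and \<delta>: "0 < \<delta>"
  shows "simple_function M (\<lambda>\<omega>. \<delta> * of_int \<lfloor>Z \<omega> / \<delta>\<rfloor>)"
proof (rule simple_function_borel_measurable)
  show "(\<lambda>\<omega>. \<delta> * of_int \<lfloor>Z \<omega> / \<delta>\<rfloor>) \<in> borel_measurable M" using Z by measurable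
  have "(\<lambda>\<omega>. \<delta> * of_int \<lfloor>Z \<omega> / \<delta>\<rfloor>) ` space M \<subseteq> (\<lambda>i. \<delta> * of_int i) ` {\<lfloor>- B / \<delta>\<rfloor>..\<lfloor>B / \<delta>\<rfloor>}"
  proof (intro image_subsetI imageI)
    fix \<omega> assume "\<omega> \<in> space M"
    then have "- B \<le> Z \<omega>" "Z \<omega> \<le> B" using B[of \<omega>] by auto
    then have "- B / \<delta> \<le> Z \<omega> / \<delta>" "Z \<omega> / \<delta> \<le> B / \<delta>" using divide_right_mono[of "- B" "Z \<omega>" \<delta>] divide_right_mono[of "Z \<omega>" B \<delta>] \<delta> by auto
    then show "\<lfloor>Z \<omega> / \<delta>\<rfloor> \<in> {\<lfloor>- B / \<delta>\<rfloor>..\<lfloor>B / \<delta>\<rfloor>}" by (auto intro: floor_mono)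
  qed
  then show "finite ((\<lambda>\<omega>. \<delta> * of_int \<lfloor>Z \<omega> / \<delta>\<rfloor>) ` space M)" by (rule finite_subset) simp
qed

lemma exp_le_quadratic:
  fixes x :: real assumes "\<bar>x\<bar> \<le> 1"
  shows "exp x \<le> 1 + x + x\<^sup>2"
proof (cases "0 \<le> x")
  case True
  then show ?thesis using assms exp_bound by simp
next
  case False
  have "1 - x \<le> exp (- x)" using exp_ge_add_one_self[of "- x"] by simp
  then have "exp x * (1 - x) \<le> exp x * exp (- x)" by (intro mult_left_mono) auto
  also have "\<dots> = 1" by (simp add: exp_minus)
  also have "\<dots> \<le> (1 + x + x\<^sup>2) * (1 - x)"
  proof -
    have "(1 + x + x\<^sup>2) * (1 - x) = 1 - x ^ 3" by (simp add: algebra_simps power2_eq_square power3_eq_cube)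
    moreover have "x ^ 3 \<le> 0" using False by (simp add: power3_eq_cube mult_nonneg_nonpos mult_nonpos_nonpos)
    ultimately show ?thesis by simp
  qed
  finally show ?thesis using False by (simp add: mult_le_cancel_right)
qed

definition block :: "nat \<Rightarrow> nat \<Rightarrow> nat \<Rightarrow> nat set" where
  "block n q k = {k * q + 1..(k + 1) * q} \<inter> {1..n}"

lemma finite_block [simp]: "finite (block n q k)"
  by (simp add: block_def)

lemma card_block_le: "card (block n q k) \<le> q"
proof -
  have "card (block n q k) \<le> card {k * q + 1..(k + 1) * q}"
    unfolding block_def by (intro card_mono) auto
  then show ?thesis by simp
qed

lemma sum_alternate_blocks:
  fixes y :: "nat \<Rightarrow> real"
  assumes q: "1 \<le> q" and L: "n \<le> 2 * L * q"
  shows "(\<Sum>m = 1..n. y m) = (\<Sum>j<L. \<Sum>m\<in>block n q (2 * j). y m) + (\<Sum>j<L. \<Sum>m\<in>block n q (2 * j + 1). y m)"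
proof -
  have un: "{1..n} = (\<Union>k\<in>{..<2 * L}. block n q k)"
  proof (intro equalityI subsetI)
    fix m assume m: "m \<in> {1..n}"
    define k where "k = (m - 1) div q"
    have "m - 1 = k * q + (m - 1) mod q" "(m - 1) mod q < q" using q by (auto simp: k_def)
    then have "m \<in> block n q k" using m by (auto simp: block_def)
    moreover have "k < 2 * L"
    proof -
      have "m - 1 < 2 * L * q" using m L by auto
      then show ?thesis unfolding k_def using q by (simp add: less_mult_imp_div_less)
    qed
    ultimately show "m \<in> (\<Union>k\<in>{..<2 * L}. block n q k)" by auto
  qed (auto simp: block_def)
  have disj: "block n q k \<inter> block n q k' = {}" if "k \<noteq> k'" for k k'
  proof -
    have "block n q k \<inter> block n q k' = {}" if "k < k'" for k k'
    proof -
      have "(k + 1) * q \<le> k' * q" using that by (intro mult_right_mono) auto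
      then show ?thesis by (auto simp: block_def)
    qed
    then show ?thesis using \<open>k \<noteq> k'\<close> by (metis Int_commute linorder_neqE_nat)
  qed
  have "(\<Sum>m = 1..n. y m) = (\<Sum>k<2 * L. \<Sum>m\<in>block n q k. y m)"
    unfolding un using disj by (subst sum.UNION_disjoint) auto
  also have "(\<Sum>k<2 * L. F k) = (\<Sum>j<L. F (2 * j)) + (\<Sum>j<L. F (2 * j + 1))" for F :: "nat \<Rightarrow> real"
    by (induction L) auto
  finally show ?thesis .
qed

lemma sets_exists_exceeds:
  assumes "finite E" "\<And>e. e \<in> E \<Longrightarrow> F e \<in> borel_measurable M"
  shows "{\<omega> \<in> space M. \<exists>e\<in>E. (s::real) < F e \<omega>} \<in> sets M"
proof -
  have "{\<omega> \<in> space M. s < F e \<omega>} \<in> sets M" if "e \<in> E" for e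
    using assms(2)[OF that] by (intro borel_measurable_less) auto
  then have "(\<Union>e\<in>E. {\<omega> \<in> space M. s < F e \<omega>}) \<in> sets M"
    using assms(1) by (intro sets.finite_UN) auto
  moreover have "{\<omega> \<in> space M. \<exists>e\<in>E. s < F e \<omega>} = (\<Union>e\<in>E. {\<omega> \<in> space M. s < F e \<omega>})" by auto
  ultimately show ?thesis by simp
qed

context prob_space begin

text \<open>Sums over the blocks of one parity, which are separated by gaps of length \<open>q\<close>. Rounding the block
sums down decreases the moment generating function and loses at most \<open>s / 2\<close> in total. The
moment generating function of a block is bounded through \<open>exp x \<le> 1 + x + x\<^sup>2\<close> and the crude variance
bound \<open>q\<^sup>2 V\<close>, which holds for arbitrary dependence inside the block.\<close>

lemma alternate_blocks_deviation:
  fixes X :: "int \<Rightarrow> 'a \<Rightarrow> 'x::topological_space" and Y :: "'e \<Rightarrow> 'x \<Rightarrow> real"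
  assumes X: "\<And>i. X i \<in> borel_measurable M"
    and E: "finite E" and Y: "\<And>e. e \<in> E \<Longrightarrow> Y e \<in> borel_measurable borel"
    and B: "\<And>e x. e \<in> E \<Longrightarrow> \<bar>Y e x\<bar> \<le> B"
    and mean: "\<And>e i. e \<in> E \<Longrightarrow> 1 \<le> i \<Longrightarrow> expectation (\<lambda>\<omega>. Y e (X i \<omega>)) = 0"
    and var: "\<And>e i. e \<in> E \<Longrightarrow> 1 \<le> i \<Longrightarrow> expectation (\<lambda>\<omega>. (Y e (X i \<omega>))\<^sup>2) \<le> V"
    and dep: "\<And>i. dependence_le M (gen_sigma M X {1..i}) (gen_sigma M X {i + int q..}) \<tau>"
    and \<theta>: "0 < \<theta>" "\<theta> * q * B \<le> 1" and s: "0 < s" and L: "1 \<le> L"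
  shows "prob {\<omega> \<in> space M. \<exists>e\<in>E. s < (\<Sum>j<L. \<Sum>m\<in>block n q (2 * j + p). Y e (X (int m) \<omega>))}
    \<le> card E * exp (L * (\<theta>\<^sup>2 * (real q)\<^sup>2 * V) - \<theta> * s / 2) + L * \<tau>"
proof -
  define Z where "Z = (\<lambda>j e \<omega>. \<Sum>m\<in>block n q (2 * j + p). Y e (X (int m) \<omega>))"
  \<comment> \<open>rounding \<open>L\<close> block sums down to multiples of \<open>\<delta>\<close> loses less than \<open>s / 2\<close>\<close>
  define \<delta> where "\<delta> = s / (2 * L)"
  have \<delta>: "0 < \<delta>" using s L by (simp add: \<delta>_def)
  define W where "W = (\<lambda>j \<omega> e. if e \<in> E then \<delta> * of_int \<lfloor>Z j e \<omega> / \<delta>\<rfloor> else 0)"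
  define S where "S = (\<lambda>k \<omega> e. \<Sum>j<k. W j \<omega> e)"
  have ZB: "\<bar>Z j e \<omega>\<bar> \<le> q * B" if e: "e \<in> E" for j e \<omega>
  proof -
    have "0 \<le> B" using B[OF e, of undefined] by linarith
    have "\<bar>Z j e \<omega>\<bar> \<le> (\<Sum>m\<in>block n q (2 * j + p). B)"
      unfolding Z_def using B[OF e] by (intro order_trans[OF sum_abs] sum_mono)
    also have "\<dots> \<le> q * B" using card_block_le \<open>0 \<le> B\<close> by (simp add: mult_right_mono)
    finally show ?thesis .
  qed
  have W_sub: "simple_function (gen_measure M X T) (W j)"
    if T: "\<And>m. m \<in> block n q (2 * j + p) \<Longrightarrow> int m \<in> T" for T j
    unfolding W_def
  proof (rule simple_function_vector[OF E])
    fix e assume e: "e \<in> E"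
    show "simple_function (gen_measure M X T) (\<lambda>\<omega>. \<delta> * of_int \<lfloor>Z j e \<omega> / \<delta>\<rfloor>)"
    proof (rule simple_function_round_down[OF _ ZB[OF e] \<delta>])
      show "Z j e \<in> borel_measurable (gen_measure M X T)"
        unfolding Z_def using measurable_compose[OF measurable_gen_measure[OF T] Y[OF e]]
        by (intro borel_measurable_sum) auto
    qed
  qed
  have S_sub: "simple_function (gen_measure M X T) (S k)"
    if T: "\<And>j m. j < k \<Longrightarrow> m \<in> block n q (2 * j + p) \<Longrightarrow> int m \<in> T" for T k
    using T
  proof (induction k)
    case (Suc k)
    have "S (Suc k) = (\<lambda>\<omega>. (\<lambda>a b e. a e + b e) (S k \<omega>) (W k \<omega>))" by (simp add: S_def fun_eq_iff)
    moreover have "simple_function (gen_measure M X T) (S k)" "simple_function (gen_measure M X T) (W k)"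
      by (rule Suc.IH, erule (1) Suc.prems[OF less_SucI]) (rule W_sub, erule Suc.prems[OF lessI])
    ultimately show ?case
      using simple_function_compose2[of "gen_measure M X T" "S k" "W k" "\<lambda>a b e. a e + b e"] by simp
  qed (simp add: S_def)
  have sub: "sets (gen_measure M X T) \<subseteq> events" for T
    unfolding sets_gen_measure using X by (rule gen_sigma_subset)
  have W: "simple_function M (W j)" for j
    using W_sub[of j UNIV] sub[of UNIV] by (fastforce simp: simple_function_def)
  have S: "simple_function M (S j)" for j
    using S_sub[of j UNIV] sub[of UNIV] by (fastforce simp: simple_function_def)
  have dep': "(\<Sum>a\<in>S k ` space M. \<Sum>b\<in>W k ` space M.
      \<bar>prob {\<omega> \<in> space M. S k \<omega> = a \<and> W k \<omega> = b} -
       prob {\<omega> \<in> space M. S k \<omega> = a} * prob {\<omega> \<in> space M. W k \<omega> = b}\<bar>) \<le> \<tau>" for k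
  proof (rule dependence_le_simple_functions)
    \<comment> \<open>the last time before the gap that precedes block \<open>2 k + p\<close>, possibly negative for \<open>k = 0\<close>\<close>
    define i where "i = (2 * int k + int p - 1) * int q"
    show "dependence_le M (sets (gen_measure M X {1..i})) (sets (gen_measure M X {i + int q..})) \<tau>"
      unfolding sets_gen_measure by (rule dep)
    show "simple_function (gen_measure M X {1..i}) (S k)"
    proof (rule S_sub)
      fix j m assume "j < k" and m: "m \<in> block n q (2 * j + p)"
      then have "(2 * int j + int p + 1) * int q \<le> i" unfolding i_def by (intro mult_right_mono) auto
      moreover have "m \<le> (2 * j + p + 1) * q" "1 \<le> m" using m by (simp_all add: block_def)
      then have "int m \<le> int ((2 * j + p + 1) * q)" "1 \<le> m" by (simp_all only: of_nat_le_iff)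
      ultimately show "int m \<in> {1..i}" by (simp add: algebra_simps)
    qed
    show "simple_function (gen_measure M X {i + int q..}) (W k)"
    proof (rule W_sub)
      fix m assume "m \<in> block n q (2 * k + p)"
      then have "(2 * k + p) * q + 1 \<le> m" by (simp add: block_def)
      then have "int ((2 * k + p) * q + 1) \<le> int m" by (simp only: of_nat_le_iff)
      then show "int m \<in> {i + int q..}" by (simp add: i_def algebra_simps)
    qed
  qed simp_all
  define f where "f = (\<lambda>v. if \<exists>e\<in>E. s / 2 < v e then 1 else (0::real))"
  have f: "0 \<le> f v" "f v \<le> 1" for v by (auto simp: f_def)
  have f_exp: "f v \<le> (\<Sum>e\<in>E. exp (- \<theta> * s / 2) * exp (\<theta> * v e))" for v
  proof (cases "\<exists>e\<in>E. s / 2 < v e")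
    case True
    then obtain e where e: "e \<in> E" "s / 2 < v e" by auto
    have "0 \<le> \<theta> * (v e - s / 2)" using \<theta> e by (intro mult_nonneg_nonneg) auto
    then have "1 \<le> exp (- \<theta> * s / 2) * exp (\<theta> * v e)"
      unfolding exp_add[symmetric] by (simp add: algebra_simps)
    also have "\<dots> \<le> (\<Sum>e\<in>E. exp (- \<theta> * s / 2) * exp (\<theta> * v e))"
      using e E by (intro member_le_sum) auto
    finally show ?thesis using True by (simp add: f_def)
  next
    case False
    then show ?thesis by (simp add: f_def sum_nonneg)
  qed
  have mgf: "expectation (\<lambda>\<omega>. exp (\<theta> * W j \<omega> e)) \<le> exp (\<theta>\<^sup>2 * (real q)\<^sup>2 * V)" if e: "e \<in> E" for j e
  proof -
    let ?b = "block n q (2 * j + p)"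
    have Ym [measurable]: "(\<lambda>\<omega>. Y e (X i \<omega>)) \<in> borel_measurable M" for i
      using measurable_compose[OF X Y[OF e]] .
    have Zm [measurable]: "Z j e \<in> borel_measurable M" unfolding Z_def by measurable
    have Yint: "integrable M (\<lambda>\<omega>. Y e (X i \<omega>))" for i
      using B[OF e] by (intro integrable_const_bound[where B = B]) auto
    have Y2int: "integrable M (\<lambda>\<omega>. (Y e (X i \<omega>))\<^sup>2)" for i
    proof (rule integrable_const_bound[where B = "B\<^sup>2"])
      show "AE \<omega> in M. norm ((Y e (X i \<omega>))\<^sup>2) \<le> B\<^sup>2"
        using power_mono[OF B[OF e] abs_ge_zero, of _ 2] by simp
    qed simp
    have Zint: "integrable M (Z j e)" unfolding Z_def using Yint by (intro Bochner_Integration.integrable_sum)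
    have Z2int: "integrable M (\<lambda>\<omega>. (Z j e \<omega>)\<^sup>2)"
    proof (rule integrable_const_bound[where B = "(q * B)\<^sup>2"])
      show "AE \<omega> in M. norm ((Z j e \<omega>)\<^sup>2) \<le> (q * B)\<^sup>2"
        using power_mono[OF ZB[OF e] abs_ge_zero, of _ _ 2] by simp
    qed simp
    have EZ: "expectation (Z j e) = 0"
    proof -
      have "expectation (Z j e) = (\<Sum>m\<in>?b. expectation (\<lambda>\<omega>. Y e (X (int m) \<omega>)))"
        unfolding Z_def using Yint by (intro Bochner_Integration.integral_sum)
      also have "\<dots> = 0" using mean[OF e] by (intro sum.neutral) (auto simp: block_def)
      finally show ?thesis .
    qed
    have V: "0 \<le> V" using var[OF e, of 1] by (rule order_trans[rotated]) (auto intro: integral_nonneg_AE)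
    have EZ2: "expectation (\<lambda>\<omega>. (Z j e \<omega>)\<^sup>2) \<le> (real q)\<^sup>2 * V"
    proof -
      have "expectation (\<lambda>\<omega>. (Z j e \<omega>)\<^sup>2) \<le> expectation (\<lambda>\<omega>. (\<Sum>m\<in>?b. (Y e (X (int m) \<omega>))\<^sup>2) * card ?b)"
        using Z2int Y2int unfolding Z_def
        by (intro integral_mono integrable_mult_left Bochner_Integration.integrable_sum sum_squared_le_sum_of_squares)
      also have "\<dots> = (\<Sum>m\<in>?b. expectation (\<lambda>\<omega>. (Y e (X (int m) \<omega>))\<^sup>2)) * card ?b"
        using Y2int by (simp add: Bochner_Integration.integral_sum)
      also have "\<dots> \<le> (\<Sum>m\<in>?b. V) * card ?b"
        using var[OF e] by (intro mult_right_mono sum_mono) (auto simp: block_def)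
      also have "\<dots> = V * (card ?b)\<^sup>2" by (simp add: power2_eq_square)
      also have "\<dots> \<le> V * (real q)\<^sup>2" using card_block_le V by (intro mult_left_mono power_mono) auto
      finally show ?thesis by (simp add: mult.commute)
    qed
    have "expectation (\<lambda>\<omega>. exp (\<theta> * W j \<omega> e)) \<le> expectation (\<lambda>\<omega>. 1 + \<theta> * Z j e \<omega> + \<theta>\<^sup>2 * (Z j e \<omega>)\<^sup>2)"
    proof (rule integral_mono)
      show "integrable M (\<lambda>\<omega>. exp (\<theta> * W j \<omega> e))"
        by (rule integrable_simple_function_compose[OF W])
      show "integrable M (\<lambda>\<omega>. 1 + \<theta> * Z j e \<omega> + \<theta>\<^sup>2 * (Z j e \<omega>)\<^sup>2)"
        using Zint Z2int by (intro Bochner_Integration.integrable_add integrable_mult_right) auto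
      fix \<omega>
      have "\<delta> * of_int \<lfloor>Z j e \<omega> / \<delta>\<rfloor> \<le> \<delta> * (Z j e \<omega> / \<delta>)"
        using \<delta> by (intro mult_left_mono of_int_floor_le) simp
      then have "W j \<omega> e \<le> Z j e \<omega>" using \<delta> e by (simp add: W_def)
      then have "exp (\<theta> * W j \<omega> e) \<le> exp (\<theta> * Z j e \<omega>)" using \<theta> by simp
      also have "\<dots> \<le> 1 + \<theta> * Z j e \<omega> + (\<theta> * Z j e \<omega>)\<^sup>2"
      proof (rule exp_le_quadratic)
        have "\<theta> * \<bar>Z j e \<omega>\<bar> \<le> \<theta> * (q * B)" using ZB[OF e] \<theta> by (intro mult_left_mono) auto
        moreover have "\<bar>\<theta> * Z j e \<omega>\<bar> = \<theta> * \<bar>Z j e \<omega>\<bar>" using \<theta> by (simp add: abs_mult)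
        moreover have "\<theta> * (q * B) = \<theta> * q * B" by simp
        ultimately show "\<bar>\<theta> * Z j e \<omega>\<bar> \<le> 1" using \<theta>(2) by linarith
      qed
      finally show "exp (\<theta> * W j \<omega> e) \<le> 1 + \<theta> * Z j e \<omega> + \<theta>\<^sup>2 * (Z j e \<omega>)\<^sup>2"
        by (simp add: power_mult_distrib)
    qed
    also have "\<dots> = 1 + \<theta>\<^sup>2 * expectation (\<lambda>\<omega>. (Z j e \<omega>)\<^sup>2)"
      using Zint Z2int EZ by (simp add: prob_space)
    also have "\<dots> \<le> 1 + \<theta>\<^sup>2 * (q\<^sup>2 * V)" using EZ2 by (intro add_left_mono mult_left_mono) auto
    also have "\<dots> \<le> exp (\<theta>\<^sup>2 * (real q)\<^sup>2 * V)" using exp_ge_add_one_self[of "\<theta>\<^sup>2 * (real q)\<^sup>2 * V"] by (simp add: mult.assoc)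
    finally show ?thesis .
  qed
  let ?bad = "{\<omega> \<in> space M. \<exists>e\<in>E. s < (\<Sum>j<L. Z j e \<omega>)}"
  have f_meas: "integrable M (\<lambda>\<omega>. f (S L \<omega>))" by (rule integrable_simple_function_compose[OF S])
  have Zm: "Z j e \<in> borel_measurable M" if "e \<in> E" for j e
    unfolding Z_def using measurable_compose[OF X Y[OF that]] by (intro borel_measurable_sum) auto
  have bad: "?bad \<in> events"
    by (rule sets_exists_exceeds[OF E]) (use Zm in \<open>auto intro!: borel_measurable_sum\<close>)
  have "prob ?bad = expectation (indicator ?bad)" using bad by simp
  also have "\<dots> \<le> expectation (\<lambda>\<omega>. f (S L \<omega>))"
  proof (rule integral_mono)
    show "integrable M (indicat_real ?bad)" using bad by (intro integrable_real_indicator) (auto simp: less_top[symmetric])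
    show "integrable M (\<lambda>\<omega>. f (S L \<omega>))" by (rule f_meas)
    fix \<omega> assume "\<omega> \<in> space M"
    show "indicat_real ?bad \<omega> \<le> f (S L \<omega>)"
    proof (cases "\<omega> \<in> ?bad")
      case True
      then obtain e where e: "e \<in> E" "s < (\<Sum>j<L. Z j e \<omega>)" by auto
      have "Z j e \<omega> \<le> W j \<omega> e + \<delta>" for j
      proof -
        have "\<delta> * (Z j e \<omega> / \<delta>) \<le> \<delta> * (of_int \<lfloor>Z j e \<omega> / \<delta>\<rfloor> + 1)"
          using \<delta> by (intro mult_left_mono) linarith+
        then show ?thesis using \<delta> e by (simp add: W_def distrib_left)
      qed
      then have "(\<Sum>j<L. Z j e \<omega>) \<le> (\<Sum>j<L. W j \<omega> e + \<delta>)" by (rule sum_mono)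
      also have "\<dots> = S L \<omega> e + s / 2" using L by (simp add: S_def \<delta>_def sum.distrib)
      finally have "s / 2 < S L \<omega> e" using e(2) by linarith
      then show ?thesis using e(1) by (auto simp: f_def)
    qed (use f in simp)
  qed
  also have "\<dots> \<le> (\<Sum>e\<in>E. exp (- \<theta> * s / 2) * (\<Prod>j<L. expectation (\<lambda>\<omega>. exp (\<theta> * W j \<omega> e)))) + real L * \<tau>"
    unfolding S_def
    by (rule expectation_sum_weakly_dependent_le[OF W dep'[unfolded S_def] f f_exp])
  also have "\<dots> \<le> (\<Sum>e\<in>E. exp (- \<theta> * s / 2) * (\<Prod>j<L. exp (\<theta>\<^sup>2 * (real q)\<^sup>2 * V))) + real L * \<tau>"
    using mgf by (intro add_right_mono sum_mono mult_left_mono prod_mono) (auto intro: integral_nonneg_AE)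
  also have "\<dots> = card E * exp (L * (\<theta>\<^sup>2 * (real q)\<^sup>2 * V) - \<theta> * s / 2) + L * \<tau>"
    by (simp add: exp_of_nat_mult[symmetric] exp_add[symmetric])
  finally show ?thesis unfolding Z_def .
qed

text \<open>Combines the even and the odd blocks, at most \<open>2 n / q\<close> of either kind.\<close>

lemma block_deviation:
  fixes X :: "int \<Rightarrow> 'a \<Rightarrow> 'x::topological_space" and Y :: "'e \<Rightarrow> 'x \<Rightarrow> real"
  assumes X: "\<And>i. X i \<in> borel_measurable M"
    and E: "finite E" and Y: "\<And>e. e \<in> E \<Longrightarrow> Y e \<in> borel_measurable borel"
    and B: "\<And>e x. e \<in> E \<Longrightarrow> \<bar>Y e x\<bar> \<le> B"
    and mean: "\<And>e i. e \<in> E \<Longrightarrow> 1 \<le> i \<Longrightarrow> expectation (\<lambda>\<omega>. Y e (X i \<omega>)) = 0"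
    and var: "\<And>e i. e \<in> E \<Longrightarrow> 1 \<le> i \<Longrightarrow> expectation (\<lambda>\<omega>. (Y e (X i \<omega>))\<^sup>2) \<le> V"
    and dep: "\<And>i. dependence_le M (gen_sigma M X {1..i}) (gen_sigma M X {i + int q..}) \<tau>"
    and \<theta>: "0 < \<theta>" "\<theta> * q * B \<le> 1" and t: "0 < t" and q: "1 \<le> q" "q \<le> n" and V: "0 \<le> V" and \<tau>: "0 \<le> \<tau>"
  shows "prob {\<omega> \<in> space M. \<exists>e\<in>E. n * t < (\<Sum>m = 1..n. Y e (X (int m) \<omega>))}
    \<le> 2 * (card E * exp (2 * real n * \<theta>\<^sup>2 * q * V - \<theta> * n * t / 4) + 2 * real n / q * \<tau>)"
proof -
  define L where "L = n div (2 * q) + 1"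
  have "n = 2 * q * (n div (2 * q)) + n mod (2 * q)" by simp
  moreover have "n mod (2 * q) < 2 * q" using q by simp
  ultimately have nL: "n \<le> 2 * L * q" by (simp add: L_def algebra_simps)
  have "real (2 * q * (n div (2 * q))) \<le> real n" by (subst of_nat_le_iff) (rule times_div_less_eq_dividend)
  then have "real (n div (2 * q)) \<le> real n / (2 * real q)" using q by (simp add: field_simps)
  moreover have "1 \<le> real n / real q" using q by simp
  ultimately have L: "real L \<le> 2 * real n / q" using q by (simp add: L_def field_simps)
  let ?bad = "\<lambda>p. {\<omega> \<in> space M. \<exists>e\<in>E. n * t / 2 < (\<Sum>j<L. \<Sum>m\<in>block n q (2 * j + p). Y e (X (int m) \<omega>))}"
  have bad: "?bad p \<in> events" for p
  proof (rule sets_exists_exceeds[OF E])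
    show "(\<lambda>\<omega>. \<Sum>j<L. \<Sum>m\<in>block n q (2 * j + p). Y e (X (int m) \<omega>)) \<in> borel_measurable M" if "e \<in> E" for e
      using measurable_compose[OF X Y[OF that]] by (intro borel_measurable_sum) auto
  qed
  have n: "0 < n" using q by simp
  have each: "prob (?bad p) \<le> card E * exp (2 * real n * \<theta>\<^sup>2 * q * V - \<theta> * n * t / 4) + 2 * real n / q * \<tau>" for p
  proof -
    have "prob (?bad p) \<le> card E * exp (L * (\<theta>\<^sup>2 * (real q)\<^sup>2 * V) - \<theta> * (n * t / 2) / 2) + L * \<tau>"
      using n t by (intro alternate_blocks_deviation[OF X E Y B mean var dep \<theta>]) (auto simp: L_def)
    also have "\<dots> \<le> card E * exp (2 * real n / q * (\<theta>\<^sup>2 * (real q)\<^sup>2 * V) - \<theta> * (n * t / 2) / 2) + 2 * real n / q * \<tau>"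
    proof -
      have "L * (\<theta>\<^sup>2 * (real q)\<^sup>2 * V) \<le> 2 * real n / q * (\<theta>\<^sup>2 * (real q)\<^sup>2 * V)"
        using L V by (intro mult_right_mono) auto
      then show ?thesis using mult_right_mono[OF L \<tau>] by (intro add_mono mult_left_mono) auto
    qed
    also have "2 * real n / q * (\<theta>\<^sup>2 * (real q)\<^sup>2 * V) - \<theta> * (n * t / 2) / 2 = 2 * real n * \<theta>\<^sup>2 * q * V - \<theta> * n * t / 4"
      using q by (simp add: power2_eq_square field_simps)
    finally show ?thesis .
  qed
  have "prob {\<omega> \<in> space M. \<exists>e\<in>E. n * t < (\<Sum>m = 1..n. Y e (X (int m) \<omega>))} \<le> prob (?bad 0 \<union> ?bad 1)"
  proof (rule finite_measure_mono)
    show "{\<omega> \<in> space M. \<exists>e\<in>E. n * t < (\<Sum>m = 1..n. Y e (X (int m) \<omega>))} \<subseteq> ?bad 0 \<union> ?bad 1"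
    proof
      fix \<omega> assume "\<omega> \<in> {\<omega> \<in> space M. \<exists>e\<in>E. n * t < (\<Sum>m = 1..n. Y e (X (int m) \<omega>))}"
      then obtain e where e: "e \<in> E" "n * t < (\<Sum>m = 1..n. Y e (X (int m) \<omega>))" and \<omega>: "\<omega> \<in> space M" by auto
      let ?s = "\<lambda>p. \<Sum>j<L. \<Sum>m\<in>block n q (2 * j + p). Y e (X (int m) \<omega>)"
      have "n * t < ?s 0 + ?s 1"
        using e(2) unfolding sum_alternate_blocks[OF q(1) nL, of "\<lambda>m. Y e (X (int m) \<omega>)"] by simp
      then have "n * t / 2 < ?s 0 \<or> n * t / 2 < ?s 1" by linarith
      then show "\<omega> \<in> ?bad 0 \<union> ?bad 1" using e(1) \<omega> by blast
    qed
    show "?bad 0 \<union> ?bad 1 \<in> events" using bad by (intro sets.Un)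
  qed
  also have "\<dots> \<le> prob (?bad 0) + prob (?bad 1)" using bad by (intro measure_Un_le)
  also have "\<dots> \<le> 2 * (card E * exp (2 * real n * \<theta>\<^sup>2 * q * V - \<theta> * n * t / 4) + 2 * real n / q * \<tau>)"
    using add_mono[OF each[of 0] each[of 1]] unfolding mult_2[symmetric] .
  finally show ?thesis .
qed

end

section \<open>Dependence coefficients of mixing and of independent sequences\<close>

lemma dependence_le_weaken: "dependence_le M \<A> \<B> \<tau> \<Longrightarrow> \<tau> \<le> \<tau>' \<Longrightarrow> dependence_le M \<A> \<B> \<tau>'"
  unfolding dependence_le_def by (blast intro: order_trans)

context prob_space begin

lemma sum_partition_measure:
  assumes "finite P" "partition_on (space M) P" "P \<subseteq> events" "B \<in> events"
  shows "(\<Sum>A\<in>P. prob (A \<inter> B)) = prob B"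
proof -
  have "disjoint_family_on (\<lambda>A. A \<inter> B) P"
    unfolding disjoint_family_on_def using disjointD[OF partition_onD2[OF assms(2)]] by blast
  then have "(\<Sum>A\<in>P. prob (A \<inter> B)) = prob (\<Union>A\<in>P. A \<inter> B)"
    using assms by (intro finite_measure_finite_Union[symmetric]) auto
  also have "(\<Union>A\<in>P. A \<inter> B) = B"
    using partition_onD1[OF assms(2)] sets.sets_into_space[OF assms(4)] by auto
  finally show ?thesis .
qed

lemma dependence_sum_le_2:
  assumes P: "finite P" "partition_on (space M) P" "P \<subseteq> events"
    and Q: "finite Q" "partition_on (space M) Q" "Q \<subseteq> events"
  shows "(\<Sum>A\<in>P. \<Sum>B\<in>Q. \<bar>prob (A \<inter> B) - prob A * prob B\<bar>) \<le> 2"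
proof -
  have tot: "(\<Sum>A\<in>P. prob A) = 1" if "finite P" "partition_on (space M) P" "P \<subseteq> events" for P
  proof -
    have "(\<Sum>A\<in>P. prob A) = (\<Sum>A\<in>P. prob (A \<inter> space M))"
      using that(3) by (intro sum.cong refl) (auto intro!: arg_cong[where f = prob] dest: sets.sets_into_space)
    then show ?thesis using sum_partition_measure[OF that, of "space M"] by (simp add: prob_space)
  qed
  have "(\<Sum>A\<in>P. \<Sum>B\<in>Q. \<bar>prob (A \<inter> B) - prob A * prob B\<bar>) \<le> (\<Sum>A\<in>P. \<Sum>B\<in>Q. prob (A \<inter> B) + prob A * prob B)"
    by (intro sum_mono) (smt (verit) measure_nonneg mult_nonneg_nonneg)
  also have "\<dots> = (\<Sum>B\<in>Q. \<Sum>A\<in>P. prob (A \<inter> B)) + (\<Sum>A\<in>P. prob A) * (\<Sum>B\<in>Q. prob B)"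
    unfolding sum.distrib sum_product by (subst sum.swap) simp
  also have "(\<Sum>B\<in>Q. \<Sum>A\<in>P. prob (A \<inter> B)) = (\<Sum>B\<in>Q. prob B)"
    using P Q by (intro sum.cong refl sum_partition_measure) auto
  finally show ?thesis using tot[OF P] tot[OF Q] by simp
qed

text \<open>The suprema in the definition of the mixing coefficients are taken over bounded sets of reals, so they
dominate the individual values.\<close>

lemma beta_coeff_bounds:
  assumes "\<A> \<subseteq> events" "\<B> \<subseteq> events" "space M \<in> \<A>" "space M \<in> \<B>"
  shows "dependence_le M \<A> \<B> (2 * beta_coeff M \<A> \<B>)" "0 \<le> beta_coeff M \<A> \<B>" "beta_coeff M \<A> \<B> \<le> 1"
proof -
  let ?S = "{(P, Q). finite P \<and> partition_on (space M) P \<and> P \<subseteq> \<A> \<and>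
                     finite Q \<and> partition_on (space M) Q \<and> Q \<subseteq> \<B>}"
  let ?f = "\<lambda>(P, Q). \<Sum>A\<in>P. \<Sum>B\<in>Q. \<bar>prob (A \<inter> B) - prob A * prob B\<bar>"
  have le: "?f PQ \<le> 2" if "PQ \<in> ?S" for PQ
    using that assms(1,2) by (cases PQ) (auto intro!: dependence_sum_le_2)
  then have bdd: "bdd_above (?f ` ?S)" by (rule bdd_aboveI2)
  have triv: "({space M}, {space M}) \<in> ?S"
    using assms(3,4) not_empty by (auto intro!: partition_on_space)
  have upper: "?f PQ \<le> 2 * beta_coeff M \<A> \<B>" if "PQ \<in> ?S" for PQ
    unfolding beta_coeff_def using cSUP_upper[OF that bdd] by simp
  show "dependence_le M \<A> \<B> (2 * beta_coeff M \<A> \<B>)"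
    unfolding dependence_le_def
  proof (intro allI impI)
    fix P Q assume "finite P \<and> partition_on (space M) P \<and> P \<subseteq> \<A> \<and>
      finite Q \<and> partition_on (space M) Q \<and> Q \<subseteq> \<B>"
    then have "(P, Q) \<in> ?S" by (simp only: mem_Collect_eq case_prod_conv)
    from upper[OF this] show "(\<Sum>A\<in>P. \<Sum>B\<in>Q. \<bar>prob (A \<inter> B) - prob A * prob B\<bar>) \<le> 2 * beta_coeff M \<A> \<B>"
      by (simp only: case_prod_conv)
  qed
  have "0 \<le> ?f ({space M}, {space M})" by simp
  also have "\<dots> \<le> 2 * beta_coeff M \<A> \<B>" unfolding beta_coeff_def using cSUP_upper[OF triv bdd] by simp
  finally show "0 \<le> beta_coeff M \<A> \<B>" by simp
  have "(SUP PQ\<in>?S. ?f PQ) \<le> 2"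
  proof (rule cSUP_least)
    show "?S \<noteq> {}" using triv by blast
  qed (rule le)
  then show "beta_coeff M \<A> \<B> \<le> 1" unfolding beta_coeff_def by simp
qed

lemma dependence_le_beta_mix:
  assumes X: "\<And>i. X i \<in> borel_measurable M"
  shows "dependence_le M (gen_sigma M X {1..i}) (gen_sigma M X {i + int q..}) (2 * beta_mix M X q)"
    and "0 \<le> beta_mix M X q"
proof -
  have top: "space M \<in> gen_sigma M X T" for T unfolding gen_sigma_def by (rule sigma_sets_top)
  note b = beta_coeff_bounds[OF gen_sigma_subset[OF X] gen_sigma_subset[OF X] top top]
  let ?b = "\<lambda>i. beta_coeff M (gen_sigma M X {..i}) (gen_sigma M X {i + int q..})"
  have "bdd_above (range ?b)" by (rule bdd_aboveI2[where M = 1]) (rule b(3))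
  then have le: "?b i \<le> beta_mix M X q" for i unfolding beta_mix_def by (intro cSUP_upper) auto
  have "dependence_le M (gen_sigma M X {..i}) (gen_sigma M X {i + int q..}) (2 * ?b i)" by (rule b(1))
  then have "dependence_le M (gen_sigma M X {..i}) (gen_sigma M X {i + int q..}) (2 * beta_mix M X q)"
    by (rule dependence_le_weaken) (use le[of i] in simp)
  then show "dependence_le M (gen_sigma M X {1..i}) (gen_sigma M X {i + int q..}) (2 * beta_mix M X q)"
    by (rule dependence_le_mono) (auto intro!: gen_sigma_mono)
  show "0 \<le> beta_mix M X q" using b(2) le by (rule order_trans)
qed

text \<open>Independence is known for positive indices only. For \<open>i < 1\<close> the past is trivial.\<close>

lemma dependence_le_indep_vars:
  assumes X: "\<And>i. X i \<in> borel_measurable M" and indep: "indep_vars (\<lambda>_. borel) X {1..}"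
  shows "dependence_le M (gen_sigma M X {1..i}) (gen_sigma M X {i + 1..}) 0"
proof -
  let ?E = "\<lambda>i. {X i -` A \<inter> space M | A. A \<in> sets borel}"
  let ?I = "\<lambda>b. if b then {1..i} else {i + 1..}"
  have gen: "gen_sigma M X T = sigma_sets (space M) (\<Union>i\<in>T. ?E i)" for T
    unfolding gen_sigma_def by (rule arg_cong[where f = "sigma_sets (space M)"]) auto
  have "prob (A \<inter> B) = prob A * prob B"
    if A: "A \<in> gen_sigma M X {1..i}" and B: "B \<in> gen_sigma M X {i + 1..}" for A B
  proof (cases "1 \<le> i")
    case True
    have "indep_sets (\<lambda>b. sigma_sets (space M) (\<Union>i\<in>?I b. ?E i)) UNIV"
    proof (rule indep_sets_collect_sigma)
      have ind: "indep_sets ?E {1..}" using indep unfolding indep_vars_def2 by blast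
      show "indep_sets ?E (\<Union>b\<in>UNIV. ?I b)"
        by (rule indep_sets_mono_index[OF _ ind]) (use True in \<open>auto simp: UNIV_bool\<close>)
      show "Int_stable (?E i)" for i
        unfolding Int_stable_def
      proof (intro ballI)
        fix a b assume "a \<in> ?E i" "b \<in> ?E i"
        then obtain S T where "a = X i -` S \<inter> space M" "b = X i -` T \<inter> space M" "S \<in> sets borel" "T \<in> sets borel"
          by auto
        then have "a \<inter> b = X i -` (S \<inter> T) \<inter> space M" "S \<inter> T \<in> sets borel" by auto
        then show "a \<inter> b \<in> ?E i" by blast
      qed
    qed (auto simp: disjoint_family_on_def)
    moreover have "\<forall>b\<in>UNIV. (if b then A else B) \<in> sigma_sets (space M) (\<Union>i\<in>?I b. ?E i)"
      using A B unfolding gen by simp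
    ultimately have "prob (\<Inter>b\<in>UNIV. if b then A else B) = (\<Prod>b\<in>UNIV. prob (if b then A else B))"
      by (intro indep_setsD[where J = UNIV and I = UNIV and A = "\<lambda>b. if b then A else B"]) simp_all
    then show ?thesis by (simp add: UNIV_bool Int_commute mult.commute)
  next
    case False
    then have "gen_sigma M X {1..i} = {{}, space M}" by (simp add: gen sigma_sets_empty_eq)
    then consider "A = {}" | "A = space M" using A by auto
    moreover have "B \<subseteq> space M"
      by (rule sets.sets_into_space, rule subsetD[OF gen_sigma_subset[OF X] B])
    ultimately show ?thesis by cases (simp_all add: prob_space Int_absorb1)
  qed
  note product = this
  show ?thesis unfolding dependence_le_def
  proof (intro allI impI)
    fix P Q assume "finite P \<and> partition_on (space M) P \<and> P \<subseteq> gen_sigma M X {1..i} \<and>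
      finite Q \<and> partition_on (space M) Q \<and> Q \<subseteq> gen_sigma M X {i + 1..}"
    then have "\<bar>prob (A \<inter> B) - prob A * prob B\<bar> = 0" if "A \<in> P" "B \<in> Q" for A B
      using product[of A B] that by auto
    then show "(\<Sum>A\<in>P. \<Sum>B\<in>Q. \<bar>prob (A \<inter> B) - prob A * prob B\<bar>) \<le> 0"
      by (intro sum_nonpos) simp
  qed
qed

end

section \<open>Orthonormality and localisation of the boundary-corrected wavelets\<close>

text \<open>The part of the definition of a Daubechies pair from which orthonormality and locality of the
basis follow.\<close>

definition scaling_fn :: "nat \<Rightarrow> (real \<Rightarrow> real) \<Rightarrow> bool" where
  "scaling_fn N \<phi> \<longleftrightarrow> 1 \<le> N \<and> continuous_on UNIV \<phi> \<and>
     (\<forall>x. x \<notin> {- real N + 1..real N} \<longrightarrow> \<phi> x = 0) \<and>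
     (\<forall>k::int. (LINT x|lborel. \<phi> x * \<phi> (x - of_int k)) = (if k = 0 then 1 else 0))"

lemma scaling_fn_mirror:
  assumes "scaling_fn N \<phi>"
  shows "scaling_fn N (\<lambda>x. \<phi> (1 - x))"
proof -
  have "(LINT x|lborel. \<phi> (1 - x) * \<phi> (1 - (x - of_int k))) = (if k = 0 then 1 else 0)" for k :: int
  proof -
    have arg: "1 + - 1 * x = 1 - x" "1 - x - of_int (- k) = 1 - (x - of_int k)" for x :: real
      by simp_all
    have "(LINT x|lborel. \<phi> x * \<phi> (x - of_int (- k))) =
        (LINT x|lborel. \<phi> (1 - x) * \<phi> (1 - (x - of_int k)))"
      using lborel_integral_real_affine[of "- 1" "\<lambda>x. \<phi> x * \<phi> (x - of_int (- k))" 1]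
      unfolding arg by (simp only: abs_minus_cancel abs_one scaleR_one)
    moreover have "(LINT x|lborel. \<phi> x * \<phi> (x - of_int (- k))) = (if - k = 0 then 1 else 0)"
      using assms unfolding scaling_fn_def by blast
    ultimately show ?thesis by (simp only: neg_equal_0_iff_equal)
  qed
  moreover have "continuous_on UNIV (\<lambda>x. \<phi> (1 - x))"
    using assms unfolding scaling_fn_def
    by (intro continuous_on_compose2[of UNIV \<phi> UNIV "\<lambda>x. 1 - x"]) (auto intro: continuous_intros)
  moreover have "\<phi> (1 - x) = 0" if "x \<notin> {- real N + 1..real N}" for x
  proof -
    have "1 - x \<notin> {- real N + 1..real N}" using that by auto
    then show ?thesis using assms unfolding scaling_fn_def by blast
  qed
  ultimately show ?thesis using assms unfolding scaling_fn_def by blast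
qed

lemma scaling_fn_bounded:
  assumes "scaling_fn N \<phi>"
  obtains B where "0 \<le> B" "\<And>x. \<bar>\<phi> x\<bar> \<le> B"
proof -
  have "continuous_on {- real N + 1..real N} \<phi>"
    using assms unfolding scaling_fn_def by (meson continuous_on_subset subset_UNIV)
  then have "bounded (\<phi> ` {- real N + 1..real N})"
    by (intro compact_imp_bounded compact_continuous_image) auto
  then obtain B where "\<forall>y\<in>\<phi> ` {- real N + 1..real N}. norm y \<le> B"
    unfolding bounded_iff by blast
  then have B: "\<bar>\<phi> x\<bar> \<le> B" if "x \<in> {- real N + 1..real N}" for x
    using that by (simp only: ball_simps real_norm_def) blast
  have "\<bar>\<phi> x\<bar> \<le> max B 0" for x
    using B[of x] assms unfolding scaling_fn_def by (cases "x \<in> {- real N + 1..real N}") auto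
  then show thesis by (intro that[of "max B 0"]) auto
qed

lemma scaling_fn_translates:
  assumes \<phi>: "scaling_fn N \<phi>"
  shows "integrable lborel (\<lambda>x. \<phi> (x - p) * \<phi> (x - r))"
    and "(LINT x|lborel. \<phi> (x - of_int a) * \<phi> (x - of_int b)) = (if a = b then 1 else 0)"
proof -
  have cont: "continuous_on A (\<lambda>x. \<phi> (x - p) * \<phi> (x - r))" for p r A
  proof -
    have "continuous_on UNIV \<phi>" using \<phi> unfolding scaling_fn_def by blast
    note comp = continuous_on_compose2[OF this]
    show ?thesis by (intro continuous_intros comp) auto
  qed
  let ?S = "{- real N + 1 + p..real N + p}"
  have "integrable lborel (\<lambda>x. indicator ?S x *\<^sub>R (\<phi> (x - p) * \<phi> (x - r)))"
    by (rule borel_integrable_compact) (auto intro: cont)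
  moreover have "(\<lambda>x. indicator ?S x *\<^sub>R (\<phi> (x - p) * \<phi> (x - r))) = (\<lambda>x. \<phi> (x - p) * \<phi> (x - r))"
  proof
    fix x
    have "\<phi> (x - p) = 0" if "x \<notin> ?S"
    proof -
      have "x - p \<notin> {- real N + 1..real N}" using that by auto
      then show ?thesis using \<phi> unfolding scaling_fn_def by blast
    qed
    then show "indicator ?S x *\<^sub>R (\<phi> (x - p) * \<phi> (x - r)) = \<phi> (x - p) * \<phi> (x - r)"
      by (cases "x \<in> ?S") auto
  qed
  ultimately show "integrable lborel (\<lambda>x. \<phi> (x - p) * \<phi> (x - r))" by simp
  have "(LINT x|lborel. \<phi> (x - of_int a) * \<phi> (x - of_int b)) =
      (LINT x|lborel. \<phi> x * \<phi> (x - of_int (b - a)))"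
    by (subst lborel_integral_real_affine[where c = 1 and t = "of_int a"]) (simp_all add: algebra_simps)
  note shift = this
  show "(LINT x|lborel. \<phi> (x - of_int a) * \<phi> (x - of_int b)) = (if a = b then 1 else 0)"
  proof -
    have "(LINT x|lborel. \<phi> x * \<phi> (x - of_int (b - a))) = (if b - a = 0 then 1 else 0)"
      using \<phi> unfolding scaling_fn_def by blast
    moreover have "(b - a = 0) = (a = b)" by auto
    ultimately show ?thesis unfolding shift by (simp only:)
  qed
qed

text \<open>Binomial weights and Gram--Schmidt act linearly, so all left functions are cut-off combinations of
the same \<open>2 N - 1\<close> integer translates of \<open>\<phi>\<close>, none of which is an interior function.\<close>

lemma cdv_left_expansion:
  assumes \<phi>l: "cdv_left N \<phi> \<phi>l" and k: "k < N"
  obtains a :: "nat \<Rightarrow> real" where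
    "\<And>x. \<phi>l k x = (if 0 \<le> x then \<Sum>n\<le>2 * N - 2. a n * \<phi> (x + real n - real N + 1) else 0)"
proof -
  obtain c :: "nat \<Rightarrow> real" where c: "\<And>x. \<phi>l k x = (\<Sum>j = N - 1 - k..N - 1. c j * cdv_edge N \<phi> j x)"
    using \<phi>l k unfolding cdv_left_def by blast
  define a where "a = (\<lambda>n. \<Sum>j = N - 1 - k..N - 1. c j * real (n choose j))"
  have edge: "cdv_edge N \<phi> j x = (\<Sum>n\<le>2 * N - 2. real (n choose j) * \<phi> (x + real n - real N + 1))"
    if "0 \<le> x" for j x
    using that unfolding cdv_edge_def
    by (simp only: if_True, intro sum.mono_neutral_left) (auto simp: binomial_eq_0)
  have "\<phi>l k x = (if 0 \<le> x then \<Sum>n\<le>2 * N - 2. a n * \<phi> (x + real n - real N + 1) else 0)" for x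
  proof (cases "0 \<le> x")
    case True
    have "\<phi>l k x = (\<Sum>j = N - 1 - k..N - 1. \<Sum>n\<le>2 * N - 2. c j * real (n choose j) * \<phi> (x + real n - real N + 1))"
      unfolding c edge[OF True] by (simp add: sum_distrib_left mult.assoc)
    also have "\<dots> = (\<Sum>n\<le>2 * N - 2. \<Sum>j = N - 1 - k..N - 1. c j * real (n choose j) * \<phi> (x + real n - real N + 1))"
      by (rule sum.swap)
    finally show ?thesis using True by (simp add: a_def sum_distrib_right)
  qed (simp add: c cdv_edge_def)
  then show thesis by (rule that)
qed

text \<open>The basis functions on \<open>[0, \<infinity>)\<close> at unit scale, without a right boundary.\<close>

definition half_line_basis :: "nat \<Rightarrow> (real \<Rightarrow> real) \<Rightarrow> (nat \<Rightarrow> real \<Rightarrow> real) \<Rightarrow> nat \<Rightarrow> real \<Rightarrow> real" where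
  "half_line_basis N \<phi> \<phi>l k y = (if k < N then \<phi>l k y else \<phi> (y - real k))"

lemma half_line_basis_support:
  assumes \<phi>: "scaling_fn N \<phi>" and \<phi>l: "cdv_left N \<phi> \<phi>l" and nz: "half_line_basis N \<phi> \<phi>l k y \<noteq> 0"
  shows "0 \<le> y" "\<bar>y - real k\<bar> \<le> 2 * real N" "k < N \<Longrightarrow> y \<le> 2 * real N - 1" "N \<le> k \<Longrightarrow> y \<le> real k + real N"
proof -
  have supp: "- real N + 1 \<le> x \<and> x \<le> real N" if "\<phi> x \<noteq> 0" for x
    using \<phi> that unfolding scaling_fn_def by (meson atLeastAtMost_iff)
  have N: "1 \<le> N" using \<phi> unfolding scaling_fn_def by blast
  have left: "0 \<le> y \<and> y \<le> 2 * real N - 1" if k: "k < N"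
  proof -
    obtain a where a: "\<And>x. \<phi>l k x = (if 0 \<le> x then \<Sum>n\<le>2 * N - 2. a n * \<phi> (x + real n - real N + 1) else 0)"
      using cdv_left_expansion[OF \<phi>l k] by blast
    have "(\<Sum>n\<le>2 * N - 2. a n * \<phi> (y + real n - real N + 1)) \<noteq> 0" and y: "0 \<le> y"
      using nz k a[of y] by (auto simp: half_line_basis_def split: if_splits)
    then obtain n where "\<phi> (y + real n - real N + 1) \<noteq> 0"
      by (metis (no_types, lifting) mult_zero_right sum.neutral)
    then show ?thesis using supp y by fastforce
  qed
  have right: "real k - real N + 1 \<le> y \<and> y \<le> real k + real N" if "\<not> k < N"
    using supp[of "y - real k"] nz that by (auto simp: half_line_basis_def)
  show "0 \<le> y" "\<bar>y - real k\<bar> \<le> 2 * real N" "k < N \<Longrightarrow> y \<le> 2 * real N - 1" "N \<le> k \<Longrightarrow> y \<le> real k + real N"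
    using left right N by (cases "k < N"; force)+
qed

lemma half_line_basis_continuous:
  assumes \<phi>: "scaling_fn N \<phi>" and \<phi>l: "cdv_left N \<phi> \<phi>l"
  shows "continuous_on {0..} (half_line_basis N \<phi> \<phi>l k)"
proof -
  have cont: "continuous_on UNIV \<phi>" using \<phi> unfolding scaling_fn_def by blast
  show ?thesis
  proof (cases "k < N")
    case True
    obtain a where a: "\<And>x. \<phi>l k x = (if 0 \<le> x then \<Sum>n\<le>2 * N - 2. a n * \<phi> (x + real n - real N + 1) else 0)"
      using cdv_left_expansion[OF \<phi>l True] by blast
    have "continuous_on {0..} (\<lambda>x. \<Sum>n\<le>2 * N - 2. a n * \<phi> (x + real n - real N + 1))"
      by (intro continuous_intros continuous_on_compose2[OF cont]) auto
    then show ?thesis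
      by (rule continuous_on_eq) (simp add: half_line_basis_def True a)
  next
    case False
    have "continuous_on {0..} (\<lambda>x. \<phi> (x - real k))"
      by (intro continuous_intros continuous_on_compose2[OF cont]) auto
    then show ?thesis
      by (rule continuous_on_eq) (simp add: half_line_basis_def False)
  qed
qed

lemma half_line_basis_bounded:
  assumes \<phi>: "scaling_fn N \<phi>" and \<phi>l: "cdv_left N \<phi> \<phi>l"
  obtains B where "0 \<le> B" "\<And>k y. \<bar>half_line_basis N \<phi> \<phi>l k y\<bar> \<le> B"
proof -
  obtain B0 where B0: "0 \<le> B0" "\<And>x. \<bar>\<phi> x\<bar> \<le> B0" using scaling_fn_bounded[OF \<phi>] by blast
  have "\<forall>k\<in>{..<N}. \<exists>B. \<forall>y. \<bar>\<phi>l k y\<bar> \<le> B"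
  proof
    fix k assume "k \<in> {..<N}"
    then obtain a where a: "\<And>x. \<phi>l k x = (if 0 \<le> x then \<Sum>n\<le>2 * N - 2. a n * \<phi> (x + real n - real N + 1) else 0)"
      using cdv_left_expansion[OF \<phi>l] by blast
    have "\<bar>\<phi>l k y\<bar> \<le> (\<Sum>n\<le>2 * N - 2. \<bar>a n\<bar> * B0)" for y
    proof -
      have "\<bar>\<Sum>n\<le>2 * N - 2. a n * \<phi> (y + real n - real N + 1)\<bar> \<le> (\<Sum>n\<le>2 * N - 2. \<bar>a n\<bar> * B0)"
        by (intro order_trans[OF sum_abs] sum_mono) (auto simp: abs_mult intro!: mult_left_mono B0)
      then show ?thesis using B0 by (auto simp: a intro!: sum_nonneg)
    qed
    then show "\<exists>B. \<forall>y. \<bar>\<phi>l k y\<bar> \<le> B" by blast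
  qed
  then obtain B1 where B1: "\<And>k y. k < N \<Longrightarrow> \<bar>\<phi>l k y\<bar> \<le> B1 k" by (metis lessThan_iff)
  have B1_nonneg: "0 \<le> B1 k" if "k < N" for k using B1[OF that, of 0] by linarith
  have "\<bar>half_line_basis N \<phi> \<phi>l k y\<bar> \<le> B0 + (\<Sum>k<N. B1 k)" for k y
  proof (cases "k < N")
    case True
    have "B1 k \<le> (\<Sum>k<N. B1 k)" using True B1_nonneg by (intro member_le_sum) auto
    then show ?thesis using B1[OF True, of y] B0 True by (simp add: half_line_basis_def)
  next
    case False
    have "0 \<le> (\<Sum>k<N. B1 k)" using B1_nonneg by (intro sum_nonneg) auto
    then show ?thesis using B0(2)[of "y - real k"] False by (simp add: half_line_basis_def)
  qed
  moreover have "0 \<le> B0 + (\<Sum>k<N. B1 k)" using B0 B1_nonneg by (intro add_nonneg_nonneg sum_nonneg) auto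
  ultimately show thesis by (rule that[rotated])
qed

text \<open>An edge function is cut off at \<open>0\<close>, but the interior translate vanishes there anyway, so the inner
product is one of full translates of \<open>\<phi>\<close>. The translates occurring in the edge function
have index at most \<open>N - 1 < m\<close>.\<close>

lemma half_line_basis_edge_interior:
  assumes \<phi>: "scaling_fn N \<phi>" and \<phi>l: "cdv_left N \<phi> \<phi>l" and k: "k < N" and m: "N \<le> m"
  shows "(LINT y|lborel. \<phi>l k y * \<phi> (y - real m)) = 0"
proof -
  obtain a where a: "\<And>x. \<phi>l k x = (if 0 \<le> x then \<Sum>n\<le>2 * N - 2. a n * \<phi> (x + real n - real N + 1) else 0)"
    using cdv_left_expansion[OF \<phi>l k] by blast
  have zero: "\<phi> (y - real m) = 0" if "y < 0" for y
    using \<phi> that m unfolding scaling_fn_def by auto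
  have shift: "y + real n - real N + 1 = y - of_int (int N - 1 - int n)" for y n by simp
  have "(\<lambda>y. \<phi>l k y * \<phi> (y - real m)) =
      (\<lambda>y. \<Sum>n\<le>2 * N - 2. a n * (\<phi> (y - of_int (int N - 1 - int n)) * \<phi> (y - of_int (int m))))"
  proof
    fix y
    show "\<phi>l k y * \<phi> (y - real m) =
      (\<Sum>n\<le>2 * N - 2. a n * (\<phi> (y - of_int (int N - 1 - int n)) * \<phi> (y - of_int (int m))))"
      using zero[of y] unfolding a shift by (auto simp: sum_distrib_right mult.assoc simp del: of_int_diff)
  qed
  then have "(LINT y|lborel. \<phi>l k y * \<phi> (y - real m)) =
      (\<Sum>n\<le>2 * N - 2. LINT y|lborel. a n * (\<phi> (y - of_int (int N - 1 - int n)) * \<phi> (y - of_int (int m))))"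
    by (simp only:) (intro Bochner_Integration.integral_sum integrable_mult_right scaling_fn_translates(1)[OF \<phi>])
  also have "\<dots> = 0"
    using m unfolding integral_mult_right_zero scaling_fn_translates(2)[OF \<phi>]
    by (intro sum.neutral ballI) simp
  finally show ?thesis .
qed

lemma half_line_basis_orthonormal:
  assumes \<phi>: "scaling_fn N \<phi>" and \<phi>l: "cdv_left N \<phi> \<phi>l"
  shows "(LINT y|lborel. half_line_basis N \<phi> \<phi>l k y * half_line_basis N \<phi> \<phi>l m y) = (if k = m then 1 else 0)"
proof -
  consider "k < N" "m < N" | "k < N" "N \<le> m" | "N \<le> k" "m < N" | "N \<le> k" "N \<le> m" by linarith
  then show ?thesis
  proof cases
    case 1
    have "indicator {0..} y *\<^sub>R (\<phi>l k y * \<phi>l m y) = \<phi>l k y * \<phi>l m y" for y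
      using half_line_basis_support(1)[OF \<phi> \<phi>l, of k y] 1 by (auto simp: half_line_basis_def indicator_def)
    moreover have "(LINT y:{0..}|lborel. \<phi>l k y * \<phi>l m y) = (if k = m then 1 else 0)"
      using \<phi>l 1 unfolding cdv_left_def by blast
    ultimately have "(LINT y|lborel. \<phi>l k y * \<phi>l m y) = (if k = m then 1 else 0)"
      unfolding set_lebesgue_integral_def by (simp only:)
    then show ?thesis using 1 by (simp add: half_line_basis_def)
  next
    case 2
    then show ?thesis using half_line_basis_edge_interior[OF \<phi> \<phi>l, of k m] by (simp add: half_line_basis_def)
  next
    case 3
    then show ?thesis using half_line_basis_edge_interior[OF \<phi> \<phi>l, of m k]
      by (simp add: half_line_basis_def mult.commute)
  next
    case 4
    then show ?thesis using scaling_fn_translates(2)[OF \<phi>, of "int k" "int m"]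
      by (simp add: half_line_basis_def)
  qed
qed

text \<open>The support ends at \<open>2 N - 1\<close> or at \<open>k + N\<close>, in either case before \<open>2 ^ J\<close>.\<close>

lemma half_line_basis_eq_0:
  assumes \<phi>: "scaling_fn N \<phi>" and \<phi>l: "cdv_left N \<phi> \<phi>l"
    and J: "2 * N < 2 ^ J" and k: "k < 2 ^ J - N" and t: "t \<notin> {0..1}"
  shows "half_line_basis N \<phi> \<phi>l k (2 ^ J * t) = 0"
proof (rule ccontr)
  assume nz: "half_line_basis N \<phi> \<phi>l k (2 ^ J * t) \<noteq> 0"
  note s = half_line_basis_support[OF \<phi> \<phi>l nz]
  have J': "2 * real N < 2 ^ J" and k': "real k + real N < 2 ^ J"
    using J k by (metis of_nat_less_iff of_nat_mult of_nat_numeral of_nat_power)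
      (metis k less_diff_conv of_nat_add of_nat_less_iff of_nat_numeral of_nat_power)
  have "2 ^ J * t \<le> 2 ^ J * 1"
  proof (cases "k < N")
    case True
    show ?thesis using s(3)[OF True] J' by linarith
  next
    case False
    then show ?thesis using s(4) k' by linarith
  qed
  then have "t \<le> 1" by simp
  moreover have "0 \<le> t" using s(1) by (intro mult_left_le_imp_le[of "2 ^ J" 0 t]) simp_all
  ultimately show False using t by simp
qed

locale cdv_basis =
  fixes N :: nat and \<phi> :: "real \<Rightarrow> real" and \<phi>l \<phi>r :: "nat \<Rightarrow> real \<Rightarrow> real"
  assumes scaling: "scaling_fn N \<phi>"
    and left: "cdv_left N \<phi> \<phi>l" and right: "cdv_right N \<phi> \<phi>r"
begin

definition restricted_basis :: "nat \<Rightarrow> nat \<Rightarrow> real \<Rightarrow> real" where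
  "restricted_basis J k t = (if t \<in> {0..1} then wav_basis N \<phi> \<phi>l \<phi>r J k t else 0)"

text \<open>Reflection of the interval exchanges the two boundaries and turns \<open>\<phi>\<close> into \<open>\<lambda>x. \<phi> (1 - x)\<close>. Statements
about the right boundary thus follow from those about the left one.\<close>

definition mirrored_basis :: "nat \<Rightarrow> real \<Rightarrow> real" where
  "mirrored_basis = half_line_basis N (\<lambda>x. \<phi> (1 - x)) (\<lambda>k x. \<phi>r (Suc k) (- x))"

lemmas mirror_scaling = scaling_fn_mirror[OF scaling]
lemmas mirror_left = right[unfolded cdv_right_def]

text \<open>All basis functions but those of the right boundary are dilated half-line functions on the entire
real line, because these vanish outside of the interval by themselves.\<close>

lemma restricted_basis_eq_half_line:
  assumes J: "2 * N < 2 ^ J" and k: "k < 2 ^ J - N"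
  shows "restricted_basis J k t = 2 powr (real J / 2) * half_line_basis N \<phi> \<phi>l k (2 ^ J * t)"
proof (cases "t \<in> {0..1}")
  case True
  then show ?thesis using k by (auto simp: restricted_basis_def wav_basis_def half_line_basis_def)
next
  case False
  have "half_line_basis N \<phi> \<phi>l k (2 ^ J * t) = 0"
    by (rule half_line_basis_eq_0[OF scaling left J k False])
  then show ?thesis using False by (simp only: restricted_basis_def if_False mult_zero_right)
qed

lemma restricted_basis_eq_mirrored:
  assumes J: "2 * N < 2 ^ J" and k: "N \<le> k" "k < 2 ^ J"
  shows "restricted_basis J k t = 2 powr (real J / 2) * mirrored_basis (2 ^ J - 1 - k) (2 ^ J * (1 - t))"
proof (cases "t \<in> {0..1}")
  case True
  define r where "r = 2 ^ J - 1 - k"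
  have r: "real r = 2 ^ J - 1 - real k" "Suc r = 2 ^ J - k" "r < N \<longleftrightarrow> \<not> k < 2 ^ J - N"
    using k J by (auto simp: r_def of_nat_diff)
  have eq: "2 ^ J * t - real k = 1 - (2 ^ J * (1 - t) - real r)" "- (2 ^ J * (1 - t)) = 2 ^ J * (t - 1)"
    unfolding r by (simp_all add: algebra_simps)
  have "\<not> k < N" using k by simp
  then show ?thesis unfolding r_def[symmetric]
    using True by (simp add: restricted_basis_def wav_basis_def mirrored_basis_def half_line_basis_def
        r(2,3) eq del: right_diff_distrib' left_diff_distrib')
next
  case False
  then have "1 - t \<notin> {0..1}" by auto
  then have "mirrored_basis (2 ^ J - 1 - k) (2 ^ J * (1 - t)) = 0"
    unfolding mirrored_basis_def
    using J k by (intro half_line_basis_eq_0[OF mirror_scaling mirror_left J]) auto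
  then show ?thesis using False by (simp only: restricted_basis_def if_False mult_zero_right)
qed

lemma two_powr_half_squared: "2 powr (real J / 2) * 2 powr (real J / 2) = (2 :: real) ^ J"
  by (simp add: powr_add[symmetric] powr_realpow)

text \<open>Two functions that are not near opposite boundaries are both covered by the half-line picture seen
from one of the ends. A left and a right boundary function have disjoint supports once \<open>4 N < 2 ^ J\<close>.\<close>

lemma restricted_basis_orthonormal:
  assumes J: "4 * N < 2 ^ J" and k: "k < 2 ^ J" and m: "m < 2 ^ J"
  shows "(LINT t|lborel. restricted_basis J k t * restricted_basis J m t) = (if k = m then 1 else 0)"
proof -
  have J2: "2 * N < 2 ^ J" using J by simp
  have wlog: ?thesis if "k < 2 ^ J - N \<and> m < 2 ^ J - N \<or> N \<le> k \<and> N \<le> m"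
    using that
  proof
    assume km: "k < 2 ^ J - N \<and> m < 2 ^ J - N"
    have "(if k = m then 1 else 0) = (LINT y|lborel. half_line_basis N \<phi> \<phi>l k y * half_line_basis N \<phi> \<phi>l m y)"
      by (rule half_line_basis_orthonormal[OF scaling left, symmetric])
    also have "\<dots> = (LINT t|lborel. 2 ^ J * (half_line_basis N \<phi> \<phi>l k (2 ^ J * t) * half_line_basis N \<phi> \<phi>l m (2 ^ J * t)))"
      by (subst lborel_integral_real_affine[where c = "2 ^ J" and t = 0]) simp_all
    also have "\<dots> = (LINT t|lborel. restricted_basis J k t * restricted_basis J m t)"
      using km by (simp add: restricted_basis_eq_half_line[OF J2] two_powr_half_squared[symmetric] mult_ac)
    finally show ?thesis by simp
  next
    assume km: "N \<le> k \<and> N \<le> m"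
    have "(if k = m then 1 else 0) = (LINT y|lborel. mirrored_basis (2 ^ J - 1 - k) y * mirrored_basis (2 ^ J - 1 - m) y)"
      using k m unfolding mirrored_basis_def half_line_basis_orthonormal[OF mirror_scaling mirror_left] by auto
    also have "\<dots> = (LINT t|lborel. 2 ^ J * (mirrored_basis (2 ^ J - 1 - k) (2 ^ J * (1 - t)) * mirrored_basis (2 ^ J - 1 - m) (2 ^ J * (1 - t))))"
      by (subst lborel_integral_real_affine[where c = "- (2 ^ J)" and t = "2 ^ J"]) (simp_all add: algebra_simps)
    also have "\<dots> = (LINT t|lborel. restricted_basis J k t * restricted_basis J m t)"
      using km k m by (simp add: restricted_basis_eq_mirrored[OF J2] two_powr_half_squared[symmetric] mult_ac)
    finally show ?thesis by simp
  qed
  have far: "restricted_basis J k t * restricted_basis J m t = 0"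
    if k: "k < N" and m: "2 ^ J - N \<le> m" "m < 2 ^ J" for k m t
  proof (rule ccontr)
    assume "\<not> ?thesis"
    then have nz: "restricted_basis J k t \<noteq> 0" "restricted_basis J m t \<noteq> 0" by auto
    have nz1: "half_line_basis N \<phi> \<phi>l k (2 ^ J * t) \<noteq> 0"
      using nz(1) restricted_basis_eq_half_line[OF J2, of k t] k J by auto
    have nz2: "mirrored_basis (2 ^ J - 1 - m) (2 ^ J * (1 - t)) \<noteq> 0"
      using nz(2) restricted_basis_eq_mirrored[OF J2, of m t] m J by auto
    have "2 ^ J * t \<le> 2 * real N - 1"
      using half_line_basis_support(3)[OF scaling left nz1] k by simp
    moreover have "2 ^ J * (1 - t) \<le> 2 * real N - 1"
      using half_line_basis_support(3)[OF mirror_scaling mirror_left nz2[unfolded mirrored_basis_def]] m by simp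
    ultimately have "2 ^ J \<le> 4 * real N - 2" by (simp add: algebra_simps)
    moreover have "4 * real N < 2 ^ J" using J by (metis of_nat_less_iff of_nat_mult of_nat_numeral of_nat_power)
    ultimately show False by linarith
  qed
  show ?thesis
  proof (cases "k < 2 ^ J - N \<and> m < 2 ^ J - N \<or> N \<le> k \<and> N \<le> m")
    case False
    then consider "k < N" "2 ^ J - N \<le> m" | "m < N" "2 ^ J - N \<le> k" by linarith
    then have "restricted_basis J k t * restricted_basis J m t = 0" for t
      using far[of k m t] far[of m k t] k m by cases (auto simp: mult.commute)
    moreover have "k \<noteq> m" using False J by auto
    ultimately show ?thesis by (simp only: Bochner_Integration.integral_zero if_False)
  qed (rule wlog)
qed

text \<open>The mirror image of index \<open>k\<close> is \<open>2 ^ J - 1 - k\<close>, which accounts for the additional \<open>1\<close> in the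
bound.\<close>

lemma restricted_basis_support:
  assumes J: "2 * N < 2 ^ J" and k: "k < 2 ^ J" and nz: "restricted_basis J k t \<noteq> 0"
  shows "\<bar>2 ^ J * t - real k\<bar> \<le> 2 * real N + 1"
proof (cases "k < 2 ^ J - N")
  case True
  then have "half_line_basis N \<phi> \<phi>l k (2 ^ J * t) \<noteq> 0" using restricted_basis_eq_half_line[OF J True] nz by auto
  then show ?thesis using half_line_basis_support(2)[OF scaling left] by fastforce
next
  case False
  then have "N \<le> k" using J by simp
  then have "mirrored_basis (2 ^ J - 1 - k) (2 ^ J * (1 - t)) \<noteq> 0"
    using restricted_basis_eq_mirrored[OF J _ k] nz by auto
  then have "\<bar>2 ^ J * (1 - t) - real (2 ^ J - 1 - k)\<bar> \<le> 2 * real N"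
    unfolding mirrored_basis_def using half_line_basis_support(2)[OF mirror_scaling mirror_left] by blast
  moreover have "real (2 ^ J - 1 - k) = 2 ^ J - 1 - real k" using k by (simp add: of_nat_diff)
  ultimately show ?thesis by (simp add: algebra_simps abs_le_iff)
qed

lemma restricted_basis_bounded:
  obtains B where "0 \<le> B" "\<And>J k t. 2 * N < 2 ^ J \<Longrightarrow> k < 2 ^ J \<Longrightarrow> \<bar>restricted_basis J k t\<bar> \<le> B * 2 powr (real J / 2)"
proof -
  obtain B1 where B1: "0 \<le> B1" "\<And>k y. \<bar>half_line_basis N \<phi> \<phi>l k y\<bar> \<le> B1"
    using half_line_basis_bounded[OF scaling left] by blast
  obtain B2 where B2: "0 \<le> B2" "\<And>k y. \<bar>mirrored_basis k y\<bar> \<le> B2"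
    using half_line_basis_bounded[OF mirror_scaling mirror_left] unfolding mirrored_basis_def by blast
  show thesis
  proof (rule that[of "max B1 B2"])
    fix J k t assume J: "2 * N < 2 ^ J" and k: "k < (2::nat) ^ J"
    show "\<bar>restricted_basis J k t\<bar> \<le> max B1 B2 * 2 powr (real J / 2)"
    proof (cases "k < 2 ^ J - N")
      case True
      show ?thesis unfolding restricted_basis_eq_half_line[OF J True]
        using B1(2)[of k "2 ^ J * t"] by (simp add: abs_mult le_max_iff_disj)
    next
      case False
      then have "N \<le> k" using J by simp
      show ?thesis unfolding restricted_basis_eq_mirrored[OF J \<open>N \<le> k\<close> k]
        using B2(2)[of "2 ^ J - 1 - k" "2 ^ J * (1 - t)"] by (simp add: abs_mult le_max_iff_disj)
    qed
  qed (use B1 in simp)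
qed

lemma restricted_basis_continuous:
  assumes J: "2 * N < 2 ^ J" and k: "k < 2 ^ J"
  shows "continuous_on {0..1} (restricted_basis J k)"
proof (cases "k < 2 ^ J - N")
  case True
  show ?thesis unfolding restricted_basis_eq_half_line[OF J True, abs_def]
    by (intro continuous_intros continuous_on_compose2[OF half_line_basis_continuous[OF scaling left]]) auto
next
  case False
  then have "N \<le> k" using J by simp
  show ?thesis unfolding restricted_basis_eq_mirrored[OF J \<open>N \<le> k\<close> k, abs_def] mirrored_basis_def
    by (intro continuous_intros continuous_on_compose2[OF half_line_basis_continuous[OF mirror_scaling mirror_left]]) auto
qed

end

text \<open>Lebesgue measure on \<open>real ^ 'd\<close> is the product measure over the basis vectors, which are indexed by
the coordinates.\<close>

lemma integral_prod_components:
  fixes g :: "'d::finite \<Rightarrow> real \<Rightarrow> real"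
  assumes g: "\<And>l. integrable lborel (g l)"
  shows "(LINT x|(lborel :: (real ^ 'd) measure). (\<Prod>l\<in>UNIV. g l (x $ l))) = (\<Prod>l\<in>UNIV. LINT t|lborel. g l t)"
proof -
  interpret product_sigma_finite "\<lambda>_ :: real ^ 'd. lborel :: real measure" ..
  have gm [measurable]: "g l \<in> borel_measurable borel" for l
    using borel_measurable_integrable[OF g[of l]] by simp
  let ?c = "\<lambda>f :: real ^ 'd \<Rightarrow> real. \<Sum>b\<in>Basis. f b *\<^sub>R b"
  have comp: "?c f $ l = f (axis l 1)" for f l
  proof -
    have "?c f $ l = ?c f \<bullet> axis l 1" by (simp only: cart_eq_inner_axis)
    also have "\<dots> = f (axis l 1)" by (rule inner_sum_left_Basis) (simp add: axis_in_Basis_iff)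
    finally show ?thesis .
  qed
  have "(LINT x|(lborel :: (real ^ 'd) measure). (\<Prod>l\<in>UNIV. g l (x $ l))) =
      (LINT f|Pi\<^sub>M (Basis :: (real ^ 'd) set) (\<lambda>_. lborel). (\<Prod>l\<in>UNIV. g l (?c f $ l)))"
    by (subst lborel_eq, subst integral_distr) (auto intro!: borel_measurable_prod)
  also have "(\<lambda>f. \<Prod>l\<in>UNIV. g l (?c f $ l)) =
      (\<lambda>f :: real ^ 'd \<Rightarrow> real. \<Prod>b\<in>Basis. g (axis_index b) (f b))"
  proof
    fix f :: "real ^ 'd \<Rightarrow> real"
    show "(\<Prod>l\<in>UNIV. g l (?c f $ l)) = (\<Prod>b\<in>Basis. g (axis_index b) (f b))"
      unfolding comp
      by (rule prod.reindex_bij_witness[of _ axis_index "\<lambda>l. axis l 1"])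
        (auto simp: axis_index[symmetric] axis_in_Basis_iff)
  qed
  also have "(LINT f|Pi\<^sub>M Basis (\<lambda>_. lborel). (\<Prod>b\<in>(Basis :: (real ^ 'd) set). g (axis_index b) (f b))) =
      (\<Prod>b\<in>(Basis :: (real ^ 'd) set). LINT t|lborel. g (axis_index b) t)"
    using g by (intro product_integral_prod) auto
  also have "\<dots> = (\<Prod>l\<in>UNIV. LINT t|lborel. g l t)"
    by (rule prod.reindex_bij_witness[of _ "\<lambda>l. axis l 1" axis_index])
      (auto simp: axis_index[symmetric] axis_in_Basis_iff)
  finally show ?thesis .
qed

lemma integrable_bounded_on_cbox:
  fixes g :: "'x::euclidean_space \<Rightarrow> real"
  assumes "g \<in> borel_measurable borel" "\<And>x. \<bar>g x\<bar> \<le> B" "\<And>x. x \<notin> cbox a b \<Longrightarrow> g x = 0"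
  shows "integrable lborel g"
proof (rule Bochner_Integration.integrable_bound)
  show "integrable lborel (\<lambda>x. B * indicator (cbox a b) x :: real)"
    by (intro integrable_mult_right integrable_real_indicator) (use emeasure_lborel_cbox_finite[of a b] in auto)
  show "AE x in lborel. norm (g x) \<le> norm (B * indicator (cbox a b) x :: real)"
    using assms(2,3) by (intro AE_I2) (auto simp: indicator_def intro: order_trans[OF _ abs_ge_self])
qed (use assms(1) in simp)

context cdv_basis begin

abbreviation tb :: "nat \<Rightarrow> ('d::finite \<Rightarrow> nat) \<Rightarrow> real ^ 'd \<Rightarrow> real" where
  "tb J \<equiv> tensor_basis N \<phi> \<phi>l \<phi>r J"

lemma restricted_basis_zero: "t \<notin> {0..1} \<Longrightarrow> restricted_basis J k t = 0"
  by (simp only: restricted_basis_def if_False)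

lemma tensor_basis_eq_prod: "tb J k x = (\<Prod>l\<in>UNIV. restricted_basis J (k l) (x $ l))"
proof (cases "x \<in> cbox 0 1")
  case True
  then show ?thesis by (simp add: tensor_basis_def restricted_basis_def mem_box_cart)
next
  case False
  then obtain l where "x $ l \<notin> {0..1}" by (auto simp: mem_box_cart)
  then have "restricted_basis J (k l) (x $ l) = 0" by (rule restricted_basis_zero)
  then have "(\<Prod>l\<in>UNIV. restricted_basis J (k l) (x $ l)) = 0"
    by (intro prod_zero) auto
  then show ?thesis using False by (simp only: tensor_basis_def if_False)
qed

lemma tensor_basis_zero: "x \<notin> cbox 0 1 \<Longrightarrow> tb J k x = 0"
  by (simp add: tensor_basis_def)

lemma tensor_basis_continuous:
  assumes "2 * N < 2 ^ J" "k \<in> tensor_index J"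
  shows "continuous_on (cbox 0 1) (tb J k)"
  unfolding tensor_basis_eq_prod[abs_def]
  using assms
  by (intro continuous_on_prod continuous_on_compose2[OF restricted_basis_continuous] continuous_intros)
    (auto simp: tensor_index_def mem_box_cart)

lemma tensor_basis_measurable:
  assumes "2 * N < 2 ^ J" "k \<in> tensor_index J"
  shows "tb J k \<in> borel_measurable borel"
proof -
  have "(\<lambda>x. indicator (cbox 0 1) x *\<^sub>R tb J k x) \<in> borel_measurable borel"
    using tensor_basis_continuous[OF assms]
    by (intro borel_measurable_continuous_on_indicator) auto
  moreover have "(\<lambda>x. indicator (cbox 0 1) x *\<^sub>R tb J k x) = tb J k"
    by (auto simp: fun_eq_iff tensor_basis_def)
  ultimately show ?thesis by simp
qed

lemma restricted_basis_measurable: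
  assumes J: "2 * N < 2 ^ J" and k: "k < 2 ^ J"
  shows "restricted_basis J k \<in> borel_measurable borel"
proof -
  have "(\<lambda>x. indicator {0..1} x *\<^sub>R restricted_basis J k x) \<in> borel_measurable borel"
    using restricted_basis_continuous[OF assms]
    by (intro borel_measurable_continuous_on_indicator) auto
  moreover have "(\<lambda>x. indicator {0..1} x *\<^sub>R restricted_basis J k x) = restricted_basis J k"
    by (auto simp: fun_eq_iff restricted_basis_def)
  ultimately show ?thesis by simp
qed

lemma sqrt_card_tensor_index: "(2 powr (real J / 2)) ^ CARD('d::finite) = sqrt (2 ^ (CARD('d) * J))"
proof -
  have "(2 powr (real J / 2)) ^ CARD('d) = sqrt (((2 powr (real J / 2)) ^ CARD('d))\<^sup>2)" by simp
  also have "((2 powr (real J / 2)) ^ CARD('d))\<^sup>2 = (2 powr (real J / 2) * 2 powr (real J / 2)) ^ CARD('d)"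
    by (simp add: power_mult_distrib power2_eq_square)
  also have "\<dots> = 2 ^ (CARD('d) * J)"
    unfolding two_powr_half_squared by (simp add: power_mult[symmetric] mult.commute)
  finally show ?thesis .
qed

text \<open>With \<open>K = 2 ^ (CARD('d) * J)\<close>, the functions are of size \<open>\<surd>K\<close> on a set of measure of order \<open>1 / K\<close>, so
that their integrals are of order \<open>1 / \<surd>K\<close>.\<close>

lemma tensor_basis_bounds:
  obtains B where "1 \<le> B"
    and "\<And>J k x. 2 * N < 2 ^ J \<Longrightarrow> k \<in> (tensor_index J :: ('d::finite \<Rightarrow> nat) set) \<Longrightarrow>
      \<bar>tb J k x\<bar> \<le> B * sqrt (2 ^ (CARD('d) * J))"
    and "\<And>J k. 2 * N < 2 ^ J \<Longrightarrow> k \<in> (tensor_index J :: ('d::finite \<Rightarrow> nat) set) \<Longrightarrow>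
      sqrt (2 ^ (CARD('d) * J)) * (LINT x|lborel. \<bar>tb J k x\<bar>) \<le> B"
proof -
  obtain B where B: "0 \<le> B"
    and le: "\<And>J k t. 2 * N < 2 ^ J \<Longrightarrow> k < 2 ^ J \<Longrightarrow> \<bar>restricted_basis J k t\<bar> \<le> B * 2 powr (real J / 2)"
    using restricted_basis_bounded by blast
  define D where "D = B * (4 * N + 2)"
  have D: "0 \<le> D" using B by (simp add: D_def)
  have int: "integrable lborel (\<lambda>t. \<bar>restricted_basis J k t\<bar>)" if "2 * N < 2 ^ J" "k < 2 ^ J" for J k
  proof (rule integrable_bounded_on_cbox[where a = 0 and b = 1])
    show "\<bar>\<bar>restricted_basis J k t\<bar>\<bar> \<le> B * 2 powr (real J / 2)" for t using le[OF that] by simp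
  qed (use restricted_basis_measurable[OF that] in \<open>auto intro: restricted_basis_zero\<close>)
  have L1: "2 powr (real J / 2) * (LINT t|lborel. \<bar>restricted_basis J k t\<bar>) \<le> D"
    if J: "2 * N < 2 ^ J" and k: "k < 2 ^ J" for J k
  proof -
    let ?S = "{(real k - (2 * real N + 1)) / 2 ^ J..(real k + (2 * real N + 1)) / 2 ^ J}"
    have "(LINT t|lborel. \<bar>restricted_basis J k t\<bar>) \<le> (LINT t|lborel. B * 2 powr (real J / 2) * indicator ?S t)"
    proof (rule integral_mono)
      show "integrable lborel (\<lambda>t. \<bar>restricted_basis J k t\<bar>)" by (rule int[OF J k])
      show "integrable lborel (\<lambda>t. B * 2 powr (real J / 2) * indicator ?S t)"
        by (intro integrable_mult_right integrable_real_indicator) (auto simp: emeasure_lborel_Icc_eq)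
      fix t
      show "\<bar>restricted_basis J k t\<bar> \<le> B * 2 powr (real J / 2) * indicator ?S t"
      proof (cases "restricted_basis J k t = 0")
        case False
        then have "\<bar>2 ^ J * t - real k\<bar> \<le> 2 * real N + 1" by (rule restricted_basis_support[OF J k])
        then have "t \<in> ?S" by (simp add: field_simps abs_le_iff)
        then show ?thesis using le[OF J k] by simp
      qed (use B in simp)
    qed
    also have "\<dots> = B * 2 powr (real J / 2) * ((4 * N + 2) / 2 ^ J)"
      by (simp add: measure_def emeasure_lborel_Icc_eq field_simps)
    finally have "2 powr (real J / 2) * (LINT t|lborel. \<bar>restricted_basis J k t\<bar>) \<le>
        2 powr (real J / 2) * (B * 2 powr (real J / 2) * ((4 * N + 2) / 2 ^ J))"
      by (intro mult_left_mono) auto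
    also have "\<dots> = (2 powr (real J / 2) * 2 powr (real J / 2)) * (D / 2 ^ J)"
      by (simp add: D_def)
    also have "\<dots> = D" unfolding two_powr_half_squared by simp
    finally show ?thesis .
  qed
  show thesis
  proof (rule that[of "1 + B ^ CARD('d) + D ^ CARD('d)"])
    fix J and k :: "'d \<Rightarrow> nat" assume J: "2 * N < (2::nat) ^ J" and k: "k \<in> tensor_index J"
    then have kl: "k l < 2 ^ J" for l by (simp add: tensor_index_def)
    fix x
    have "\<bar>tb J k x\<bar> = (\<Prod>l\<in>UNIV. \<bar>restricted_basis J (k l) (x $ l)\<bar>)"
      unfolding tensor_basis_eq_prod by (rule abs_prod)
    also have "\<dots> \<le> (\<Prod>l\<in>(UNIV::'d set). B * 2 powr (real J / 2))"
      using le[OF J kl] by (intro prod_mono) auto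
    also have "\<dots> = B ^ CARD('d) * sqrt (2 ^ (CARD('d) * J))"
      by (simp add: power_mult_distrib sqrt_card_tensor_index)
    also have "\<dots> \<le> (1 + B ^ CARD('d) + D ^ CARD('d)) * sqrt (2 ^ (CARD('d) * J))"
      using B D by (intro mult_right_mono) auto
    finally show "\<bar>tb J k x\<bar> \<le> (1 + B ^ CARD('d) + D ^ CARD('d)) * sqrt (2 ^ (CARD('d) * J))" .
  next
    fix J and k :: "'d \<Rightarrow> nat" assume J: "2 * N < (2::nat) ^ J" and k: "k \<in> tensor_index J"
    then have kl: "k l < 2 ^ J" for l by (simp add: tensor_index_def)
    have "(LINT x|lborel. \<bar>tb J k x\<bar>) = (\<Prod>l\<in>UNIV. LINT t|lborel. \<bar>restricted_basis J (k l) t\<bar>)"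
      unfolding tensor_basis_eq_prod abs_prod by (intro integral_prod_components int J kl)
    then have "sqrt (2 ^ (CARD('d) * J)) * (LINT x|lborel. \<bar>tb J k x\<bar>) =
        (\<Prod>l\<in>UNIV. 2 powr (real J / 2) * (LINT t|lborel. \<bar>restricted_basis J (k l) t\<bar>))"
      by (simp add: prod.distrib sqrt_card_tensor_index)
    also have "\<dots> \<le> (\<Prod>l\<in>(UNIV::'d set). D)"
      using L1[OF J kl] by (intro prod_mono) (auto intro!: mult_nonneg_nonneg integral_nonneg_AE)
    also have "\<dots> \<le> 1 + B ^ CARD('d) + D ^ CARD('d)" using B by simp
    finally show "sqrt (2 ^ (CARD('d) * J)) * (LINT x|lborel. \<bar>tb J k x\<bar>) \<le> 1 + B ^ CARD('d) + D ^ CARD('d)" .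
  qed (use B D in simp)
qed

lemma tensor_basis_integrable_mult:
  assumes J: "2 * N < 2 ^ J" and k: "k \<in> tensor_index J" and m: "m \<in> tensor_index J"
  shows "integrable lborel (\<lambda>x. tb J k x * tb J m x)"
proof -
  obtain B where B: "1 \<le> B" "\<And>J k x. 2 * N < 2 ^ J \<Longrightarrow> k \<in> (tensor_index J :: ('a \<Rightarrow> nat) set) \<Longrightarrow>
      \<bar>tb J k x\<bar> \<le> B * sqrt (2 ^ (CARD('a) * J))"
    using tensor_basis_bounds[where 'd = 'a] by metis
  let ?c = "B * sqrt (2 ^ (CARD('a) * J))"
  show ?thesis
  proof (rule integrable_bounded_on_cbox[where a = 0 and b = 1])
    show "\<bar>tb J k x * tb J m x\<bar> \<le> ?c * ?c" for x
      unfolding abs_mult using B J k m by (intro mult_mono) auto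
  qed (use tensor_basis_measurable[OF J k] tensor_basis_measurable[OF J m] in
      \<open>auto simp: tensor_basis_zero\<close>)
qed

lemma tensor_basis_orthonormal:
  assumes J: "4 * N < 2 ^ J" and k: "k \<in> tensor_index J" and m: "m \<in> tensor_index J"
  shows "(LINT x|lborel. tb J k x * tb J m x) = (if k = m then 1 else 0)"
proof -
  have J2: "2 * N < 2 ^ J" using J by simp
  have kl: "k l < 2 ^ J" and ml: "m l < 2 ^ J" for l using k m by (auto simp: tensor_index_def)
  obtain B where B: "0 \<le> B" "\<And>J k t. 2 * N < 2 ^ J \<Longrightarrow> k < 2 ^ J \<Longrightarrow> \<bar>restricted_basis J k t\<bar> \<le> B * 2 powr (real J / 2)"
    using restricted_basis_bounded by blast
  let ?c = "B * 2 powr (real J / 2)"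
  have int: "integrable lborel (\<lambda>t. restricted_basis J (k l) t * restricted_basis J (m l) t)" for l
  proof (rule integrable_bounded_on_cbox[where a = 0 and b = 1])
    show "\<bar>restricted_basis J (k l) t * restricted_basis J (m l) t\<bar> \<le> ?c * ?c" for t
      unfolding abs_mult using B J2 kl ml by (intro mult_mono) auto
  qed (use restricted_basis_measurable[OF J2 kl] restricted_basis_measurable[OF J2 ml] in
      \<open>auto intro: restricted_basis_zero\<close>)
  have "(LINT x|lborel. tb J k x * tb J m x) =
      (LINT x|lborel. (\<Prod>l\<in>UNIV. restricted_basis J (k l) (x $ l) * restricted_basis J (m l) (x $ l)))"
    by (simp add: tensor_basis_eq_prod prod.distrib)
  also have "\<dots> = (\<Prod>l\<in>UNIV. LINT t|lborel. restricted_basis J (k l) t * restricted_basis J (m l) t)"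
    by (rule integral_prod_components[OF int])
  also have "\<dots> = (\<Prod>l\<in>UNIV. if k l = m l then 1 else 0)"
    using restricted_basis_orthonormal[OF J kl ml] by simp
  also have "\<dots> = (if k = m then 1 else 0)"
  proof (cases "k = m")
    case False
    then obtain l where "k l \<noteq> m l" by auto
    then have "(\<Prod>l\<in>UNIV. if k l = m l then 1 else 0 :: real) = 0" by (intro prod_zero) auto
    then show ?thesis using False by simp
  qed simp
  finally show ?thesis .
qed

lemma tensor_basis_band:
  assumes J: "2 * N < 2 ^ J" and k: "k \<in> tensor_index J" and m: "m \<in> tensor_index J"
    and far: "\<not> grid_nbr (4 * N + 2) k m"
  shows "tb J k x * tb J m x = 0"
proof (rule ccontr)
  assume "\<not> ?thesis"
  then have "restricted_basis J (k l) (x $ l) \<noteq> 0" "restricted_basis J (m l) (x $ l) \<noteq> 0" for l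
    unfolding tensor_basis_eq_prod by auto
  moreover have kl: "k l < 2 ^ J" and ml: "m l < 2 ^ J" for l using k m by (auto simp: tensor_index_def)
  ultimately have "\<bar>2 ^ J * (x $ l) - real (k l)\<bar> \<le> 2 * real N + 1" "\<bar>2 ^ J * (x $ l) - real (m l)\<bar> \<le> 2 * real N + 1" for l
    using restricted_basis_support[OF J] by blast+
  note near = this
  have "\<bar>int (k l) - int (m l)\<bar> \<le> int (4 * N + 2)" for l
  proof -
    have "\<bar>real (k l) - real (m l)\<bar> \<le> 4 * real N + 2"
      using near[of l] by linarith
    then have "real_of_int \<bar>int (k l) - int (m l)\<bar> \<le> real_of_int (int (4 * N + 2))" by simp
    then show ?thesis by (simp only: of_int_le_iff)
  qed
  then show False using far by (simp add: grid_nbr_def)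
qed

end

section \<open>The empirical Gram matrix of the sample\<close>

text \<open>Identically distributed observations with a density between \<open>c0\<close> and \<open>c1\<close> on the cube. Their
dependence enters through \<open>dependence_le\<close>.\<close>

locale sampled_cdv_basis = prob_space M + cdv_basis N \<phi> \<phi>l \<phi>r
  for M :: "'a measure" and N \<phi> \<phi>l \<phi>r +
  fixes X :: "int \<Rightarrow> 'a \<Rightarrow> real ^ 'd::finite" and S :: "(real ^ 'd) set"
    and f :: "real ^ 'd \<Rightarrow> real" and c0 c1 :: real
  assumes X: "\<And>i. X i \<in> borel_measurable M"
    and cube: "cbox 0 1 \<subseteq> S" and XS: "\<And>i \<omega>. \<omega> \<in> space M \<Longrightarrow> X i \<omega> \<in> S"
    and f_nonneg: "\<And>x. 0 \<le> f x"
    and density: "\<And>i. distributed M lborel (X i) (\<lambda>x. ennreal (f x))"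
    and c0: "0 < c0" "\<And>x. x \<in> cbox 0 1 \<Longrightarrow> c0 \<le> f x"
    and c1: "\<And>x. x \<in> cbox 0 1 \<Longrightarrow> f x \<le> c1"
begin

text \<open>The expectation of \<open>g (X i)\<close>, in a form that does not refer to \<open>i\<close>.\<close>

definition mean :: "(real ^ 'd \<Rightarrow> real) \<Rightarrow> real" where
  "mean g = (LINT x|lborel. f x * g x)"

lemma expectation_eq_mean:
  assumes "g \<in> borel_measurable borel"
  shows "expectation (\<lambda>\<omega>. g (X i \<omega>)) = mean g"
  unfolding mean_def using distributed_integral[OF density[of i], of g] assms f_nonneg by simp

lemma density_integrable:
  assumes "g \<in> borel_measurable borel" "\<And>x. \<bar>g x\<bar> \<le> B"
  shows "integrable lborel (\<lambda>x. f x * g x)"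
proof -
  have "integrable M (\<lambda>\<omega>. g (X 0 \<omega>))"
    using assms X measurable_compose[OF X assms(1)] by (intro integrable_const_bound[where B = B]) auto
  then show ?thesis using distributed_integrable[OF density[of 0], of g] assms(1) f_nonneg by simp
qed

lemma c1_nonneg: "0 \<le> c1"
proof -
  have "(0 :: real ^ 'd) \<in> cbox 0 1" by (simp add: mem_box_cart)
  then show ?thesis using c0 c1 by fastforce
qed

lemma mean_bounds:
  assumes g: "g \<in> borel_measurable borel" "\<And>x. \<bar>g x\<bar> \<le> B" "\<And>x. 0 \<le> g x" "\<And>x. x \<notin> cbox 0 1 \<Longrightarrow> g x = 0"
  shows "c0 * (LINT x|lborel. g x) \<le> mean g" "mean g \<le> c1 * (LINT x|lborel. g x)"
proof -
  have int: "integrable lborel g" using g by (intro integrable_bounded_on_cbox[where a = 0 and b = 1]) auto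
  have le: "c0 * g x \<le> f x * g x \<and> f x * g x \<le> c1 * g x" for x
    using g(3)[of x] g(4)[of x] c0(2)[of x] c1[of x] by (cases "x \<in> cbox 0 1") (auto intro: mult_right_mono)
  have "(LINT x|lborel. c0 * g x) \<le> mean g" "mean g \<le> (LINT x|lborel. c1 * g x)"
    unfolding mean_def using le
    by (intro integral_mono integrable_mult_right int density_integrable[OF g(1,2)]; blast)+
  then show "c0 * (LINT x|lborel. g x) \<le> mean g" "mean g \<le> c1 * (LINT x|lborel. g x)" by simp_all
qed

lemma mean_abs_le:
  assumes "g \<in> borel_measurable borel" "\<And>x. \<bar>g x\<bar> \<le> B"
  shows "\<bar>mean g\<bar> \<le> mean (\<lambda>x. \<bar>g x\<bar>)"
proof -
  have "\<bar>mean g\<bar> \<le> (LINT x|lborel. \<bar>f x * g x\<bar>)" unfolding mean_def by (rule integral_abs_bound)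
  then show ?thesis unfolding mean_def using f_nonneg by (simp add: abs_mult)
qed

text \<open>The resolution from which on the two boundaries do not interact, so that the basis is
orthonormal.\<close>

definition resolved :: "nat \<Rightarrow> bool" where
  "resolved J \<longleftrightarrow> 4 * N < 2 ^ J"

lemma resolved2: "resolved J \<Longrightarrow> 2 * N < 2 ^ J"
  by (simp add: resolved_def)

text \<open>The quadratic form is the expectation of the square of \<open>\<Sum>i. v\<^sub>i b\<^sub>i\<close>, which is at least \<open>c0\<close> times its
Lebesgue integral, and this is the squared length of \<open>v\<close> by orthonormality.\<close>

lemma mean_gram_coercive:
  assumes J: "resolved J"
  shows "c0 * (\<Sum>i\<in>tensor_index J. (v i)\<^sup>2) \<le>
    (\<Sum>i\<in>tensor_index J. \<Sum>j\<in>tensor_index J. mean (\<lambda>x. tb J i x * tb J j x) * v i * v j)"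
proof -
  let ?I = "tensor_index J :: ('d \<Rightarrow> nat) set"
  note J2 = resolved2[OF J]
  obtain B where B: "1 \<le> B" "\<And>J k x. 2 * N < 2 ^ J \<Longrightarrow> k \<in> (tensor_index J :: ('d \<Rightarrow> nat) set) \<Longrightarrow>
      \<bar>tb J k x\<bar> \<le> B * sqrt (2 ^ (CARD('d) * J))"
    using tensor_basis_bounds[where 'd = 'd] by metis
  define b where "b = B * sqrt (2 ^ (CARD('d) * J))"
  have bb: "\<bar>tb J k x\<bar> \<le> b" if "k \<in> ?I" for k x using B(2)[OF J2 that] by (simp add: b_def)
  have b0: "0 \<le> b" using B by (simp add: b_def)
  have meas [measurable]: "tb J k \<in> borel_measurable borel" if "k \<in> ?I" for k
    by (rule tensor_basis_measurable[OF J2 that])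
  define g where "g = (\<lambda>x. (\<Sum>i\<in>?I. v i * tb J i x)\<^sup>2)"
  have g_expand: "g x = (\<Sum>i\<in>?I. \<Sum>j\<in>?I. v i * v j * (tb J i x * tb J j x))" for x
    unfolding g_def power2_eq_square sum_product by (simp add: mult_ac)
  have "c0 * (LINT x|lborel. g x) \<le> mean g"
  proof (rule mean_bounds(1))
    show "g \<in> borel_measurable borel" unfolding g_def by (intro borel_measurable_power borel_measurable_sum borel_measurable_times) auto
    fix x
    have "\<bar>\<Sum>i\<in>?I. v i * tb J i x\<bar> \<le> (\<Sum>i\<in>?I. \<bar>v i\<bar> * b)"
      using bb by (intro order_trans[OF sum_abs] sum_mono) (simp add: abs_mult mult_left_mono)
    then have "\<bar>\<Sum>i\<in>?I. v i * tb J i x\<bar>\<^sup>2 \<le> (\<Sum>i\<in>?I. \<bar>v i\<bar> * b)\<^sup>2"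
      by (intro power_mono) auto
    then show "\<bar>g x\<bar> \<le> (\<Sum>i\<in>?I. \<bar>v i\<bar> * b)\<^sup>2" by (simp add: g_def)
    show "0 \<le> g x" by (simp add: g_def)
    show "g x = 0" if "x \<notin> cbox 0 1" using that by (simp add: g_def tensor_basis_zero)
  qed
  also have "mean g = (\<Sum>i\<in>?I. \<Sum>j\<in>?I. mean (\<lambda>x. tb J i x * tb J j x) * v i * v j)"
  proof -
    have int: "integrable lborel (\<lambda>x. f x * (tb J i x * tb J j x))" if "i \<in> ?I" "j \<in> ?I" for i j
    proof (rule density_integrable)
      show "\<bar>tb J i x * tb J j x\<bar> \<le> b * b" for x
        unfolding abs_mult using bb that b0 by (intro mult_mono) auto
    qed (use meas that in \<open>intro borel_measurable_times; auto\<close>)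
    have "mean g = (LINT x|lborel. (\<Sum>i\<in>?I. \<Sum>j\<in>?I. v i * v j * (f x * (tb J i x * tb J j x))))"
      unfolding mean_def g_expand by (intro Bochner_Integration.integral_cong refl) (simp add: sum_distrib_left mult_ac)
    also have "\<dots> = (\<Sum>i\<in>?I. LINT x|lborel. (\<Sum>j\<in>?I. v i * v j * (f x * (tb J i x * tb J j x))))"
      using int by (intro Bochner_Integration.integral_sum Bochner_Integration.integrable_sum integrable_mult_right)
    also have "\<dots> = (\<Sum>i\<in>?I. \<Sum>j\<in>?I. LINT x|lborel. v i * v j * (f x * (tb J i x * tb J j x)))"
      using int by (intro sum.cong refl Bochner_Integration.integral_sum integrable_mult_right)
    also have "\<dots> = (\<Sum>i\<in>?I. \<Sum>j\<in>?I. mean (\<lambda>x. tb J i x * tb J j x) * v i * v j)"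
      unfolding mean_def integral_mult_right_zero by (simp only: mult_ac)
    finally show ?thesis .
  qed
  also have "(LINT x|lborel. g x) = (\<Sum>i\<in>?I. (v i)\<^sup>2)"
  proof -
    have "(LINT x|lborel. g x) = (\<Sum>i\<in>?I. LINT x|lborel. (\<Sum>j\<in>?I. v i * v j * (tb J i x * tb J j x)))"
      unfolding g_expand using tensor_basis_integrable_mult[OF J2]
      by (intro Bochner_Integration.integral_sum Bochner_Integration.integrable_sum integrable_mult_right)
    also have "\<dots> = (\<Sum>i\<in>?I. \<Sum>j\<in>?I. LINT x|lborel. v i * v j * (tb J i x * tb J j x))"
      using tensor_basis_integrable_mult[OF J2]
      by (intro sum.cong refl Bochner_Integration.integral_sum integrable_mult_right)
    also have "\<dots> = (\<Sum>i\<in>?I. \<Sum>j\<in>?I. if i = j then v i * v j else 0)"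
      by (intro sum.cong refl) (simp add: tensor_basis_orthonormal[OF J[unfolded resolved_def]])
    finally show ?thesis by (simp add: power2_eq_square)
  qed
  finally show ?thesis .
qed

lemma tensor_product_moments:
  "\<exists>C\<ge>1. \<forall>J. resolved J \<longrightarrow>
     (\<forall>i\<in>tensor_index J. \<forall>j\<in>(tensor_index J :: ('d \<Rightarrow> nat) set).
        mean (\<lambda>x. \<bar>tb J i x * tb J j x\<bar>) \<le> C \<and>
        mean (\<lambda>x. (tb J i x * tb J j x)\<^sup>2) \<le> C * 2 ^ (CARD('d) * J)) \<and>
     (\<forall>i\<in>(tensor_index J :: ('d \<Rightarrow> nat) set).
        mean (\<lambda>x. sqrt (2 ^ (CARD('d) * J)) * \<bar>tb J i x\<bar>) \<le> C \<and>
        mean (\<lambda>x. (sqrt (2 ^ (CARD('d) * J)) * \<bar>tb J i x\<bar>)\<^sup>2) \<le> C * 2 ^ (CARD('d) * J) \<and>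
        (\<forall>x. \<bar>tb J i x\<bar> \<le> C * sqrt (2 ^ (CARD('d) * J))))"
proof -
  obtain B where B: "1 \<le> B" and sup: "\<And>J k x. 2 * N < 2 ^ J \<Longrightarrow> k \<in> (tensor_index J :: ('d \<Rightarrow> nat) set) \<Longrightarrow>
      \<bar>tb J k x\<bar> \<le> B * sqrt (2 ^ (CARD('d) * J))"
    and L1: "\<And>J k. 2 * N < 2 ^ J \<Longrightarrow> k \<in> (tensor_index J :: ('d \<Rightarrow> nat) set) \<Longrightarrow>
      sqrt (2 ^ (CARD('d) * J)) * (LINT x|lborel. \<bar>tb J k x\<bar>) \<le> B"
    using tensor_basis_bounds[where 'd = 'd] by metis
  have B2: "B \<le> B\<^sup>2" using B by (simp add: power2_eq_square)
  define C where "C = (1 + c1) * B\<^sup>2"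
  have C: "c1 \<le> C" "B \<le> C" "c1 * B \<le> C" "c1 * B\<^sup>2 \<le> C" "1 \<le> C"
  proof -
    have 1: "1 \<le> B\<^sup>2" using B by simp
    show "c1 * B\<^sup>2 \<le> C" using 1 by (simp add: C_def distrib_right)
    have "c1 * 1 \<le> c1 * B\<^sup>2" using 1 c1_nonneg by (intro mult_left_mono)
    then show "c1 \<le> C" using 1 by (simp add: C_def distrib_right)
    have "c1 * B \<le> c1 * B\<^sup>2" using B2 c1_nonneg by (intro mult_left_mono)
    then show "c1 * B \<le> C" using 1 by (simp add: C_def distrib_right)
    have "0 \<le> c1 * B\<^sup>2" using c1_nonneg by simp
    then show "B \<le> C" "1 \<le> C" using 1 B2 by (simp_all add: C_def distrib_right)
  qed
  {
    fix J assume J: "resolved J"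
    note J2 = resolved2[OF J]
    let ?K = "2 ^ (CARD('d) * J) :: real"
    define b where "b = B * sqrt ?K"
    have b2: "b\<^sup>2 = B\<^sup>2 * ?K" by (simp add: b_def power_mult_distrib)
    have bb: "\<bar>tb J k x\<bar> \<le> b" if "k \<in> tensor_index J" for k :: "'d \<Rightarrow> nat" and x
      using sup[OF J2 that] by (simp add: b_def)
    have b0: "0 \<le> b" using B by (simp add: b_def)
    have meas [measurable]: "tb J k \<in> borel_measurable borel" if "k \<in> tensor_index J" for k :: "'d \<Rightarrow> nat"
      by (rule tensor_basis_measurable[OF J2 that])
    have sq: "(LINT x|lborel. (tb J i x)\<^sup>2) = 1" if "i \<in> tensor_index J" for i :: "'d \<Rightarrow> nat"
      using tensor_basis_orthonormal[OF J[unfolded resolved_def] that that] by (simp add: power2_eq_square)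
    have sq_int: "integrable lborel (\<lambda>x. (tb J i x)\<^sup>2)" if "i \<in> tensor_index J" for i :: "'d \<Rightarrow> nat"
      using tensor_basis_integrable_mult[OF J2 that that] by (simp add: power2_eq_square)
    have pairs: "\<forall>i\<in>tensor_index J. \<forall>j\<in>(tensor_index J :: ('d \<Rightarrow> nat) set).
        mean (\<lambda>x. \<bar>tb J i x * tb J j x\<bar>) \<le> C \<and> mean (\<lambda>x. (tb J i x * tb J j x)\<^sup>2) \<le> C * ?K"
    proof (intro ballI conjI)
      fix i j :: "'d \<Rightarrow> nat" assume ij: "i \<in> tensor_index J" "j \<in> tensor_index J"
      have prod_int: "integrable lborel (\<lambda>x. \<bar>tb J i x * tb J j x\<bar>)"
        using tensor_basis_integrable_mult[OF J2 ij] by (rule integrable_abs)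
      have ij_b: "\<bar>tb J i x * tb J j x\<bar> \<le> b\<^sup>2" for x
        unfolding abs_mult power2_eq_square using bb ij b0 by (intro mult_mono) auto
      have ij_m: "(\<lambda>x. tb J i x * tb J j x) \<in> borel_measurable borel"
        using meas ij by (intro borel_measurable_times) auto
      have "mean (\<lambda>x. \<bar>tb J i x * tb J j x\<bar>) \<le> c1 * (LINT x|lborel. \<bar>tb J i x * tb J j x\<bar>)"
        using ij_m ij_b by (intro mean_bounds(2)[where B = "b\<^sup>2"]) (auto simp: tensor_basis_zero)
      also have "(LINT x|lborel. \<bar>tb J i x * tb J j x\<bar>) \<le> (LINT x|lborel. ((tb J i x)\<^sup>2 + (tb J j x)\<^sup>2) / 2)"
      proof (rule integral_mono[OF prod_int])
        show "integrable lborel (\<lambda>x. ((tb J i x)\<^sup>2 + (tb J j x)\<^sup>2) / 2)" using sq_int ij by simp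
        fix x
        have "0 \<le> (\<bar>tb J i x\<bar> - \<bar>tb J j x\<bar>)\<^sup>2" by simp
        then show "\<bar>tb J i x * tb J j x\<bar> \<le> ((tb J i x)\<^sup>2 + (tb J j x)\<^sup>2) / 2"
          by (simp add: power2_diff abs_mult)
      qed
      also have "\<dots> = 1" using sq sq_int ij by simp
      finally show "mean (\<lambda>x. \<bar>tb J i x * tb J j x\<bar>) \<le> C" using C(1) c1_nonneg by (simp add: mult_left_mono)
      have "mean (\<lambda>x. (tb J i x * tb J j x)\<^sup>2) \<le> c1 * (LINT x|lborel. (tb J i x * tb J j x)\<^sup>2)"
      proof (rule mean_bounds(2)[where B = "(b\<^sup>2)\<^sup>2"])
        show "\<bar>(tb J i x * tb J j x)\<^sup>2\<bar> \<le> (b\<^sup>2)\<^sup>2" for x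
          using power_mono[OF ij_b abs_ge_zero, of x 2] by simp
      qed (use ij_m in \<open>auto simp: tensor_basis_zero\<close>)
      also have "(LINT x|lborel. (tb J i x * tb J j x)\<^sup>2) \<le> (LINT x|lborel. b\<^sup>2 * (tb J j x)\<^sup>2)"
      proof (rule integral_mono)
        show "integrable lborel (\<lambda>x. b\<^sup>2 * (tb J j x)\<^sup>2)" using sq_int ij by simp
        have le: "(tb J i x * tb J j x)\<^sup>2 \<le> b\<^sup>2 * (tb J j x)\<^sup>2" for x
          using power_mono[OF bb[OF ij(1)] abs_ge_zero, of x 2] by (simp add: power_mult_distrib mult_right_mono)
        then show "(tb J i x * tb J j x)\<^sup>2 \<le> b\<^sup>2 * (tb J j x)\<^sup>2" for x .
        show "integrable lborel (\<lambda>x. (tb J i x * tb J j x)\<^sup>2)"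
        proof (rule Bochner_Integration.integrable_bound)
          show "integrable lborel (\<lambda>x. b\<^sup>2 * (tb J j x)\<^sup>2)" using sq_int ij by simp
          show "AE x in lborel. norm ((tb J i x * tb J j x)\<^sup>2) \<le> norm (b\<^sup>2 * (tb J j x)\<^sup>2)" using le by simp
        qed (use ij_m in simp)
      qed
      also have "\<dots> = b\<^sup>2" using sq ij by simp
      finally have "mean (\<lambda>x. (tb J i x * tb J j x)\<^sup>2) \<le> c1 * b\<^sup>2" using c1_nonneg by (simp add: mult_left_mono)
      also have "\<dots> \<le> C * ?K" unfolding b2 using mult_right_mono[OF C(4), of ?K] by (simp add: mult.assoc)
      finally show "mean (\<lambda>x. (tb J i x * tb J j x)\<^sup>2) \<le> C * ?K" .
    qed
    have singles: "\<forall>i\<in>(tensor_index J :: ('d \<Rightarrow> nat) set). mean (\<lambda>x. sqrt ?K * \<bar>tb J i x\<bar>) \<le> C \<and>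
        mean (\<lambda>x. (sqrt ?K * \<bar>tb J i x\<bar>)\<^sup>2) \<le> C * ?K \<and> (\<forall>x. \<bar>tb J i x\<bar> \<le> C * sqrt ?K)"
    proof (intro ballI conjI allI)
      fix i :: "'d \<Rightarrow> nat" assume i: "i \<in> tensor_index J"
      have sb: "\<bar>sqrt ?K * \<bar>tb J i x\<bar>\<bar> \<le> sqrt ?K * b" for x
        using bb[OF i, of x] by (simp add: abs_mult)
      have sm: "(\<lambda>x. sqrt ?K * \<bar>tb J i x\<bar>) \<in> borel_measurable borel" using meas[OF i] by simp
      have "mean (\<lambda>x. sqrt ?K * \<bar>tb J i x\<bar>) \<le> c1 * (LINT x|lborel. sqrt ?K * \<bar>tb J i x\<bar>)"
        using sm sb by (intro mean_bounds(2)[where B = "sqrt ?K * b"]) (auto simp: tensor_basis_zero)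
      also have "\<dots> \<le> c1 * B" using L1[OF J2 i] c1_nonneg by (simp add: mult_left_mono)
      finally show "mean (\<lambda>x. sqrt ?K * \<bar>tb J i x\<bar>) \<le> C" using C(3) by simp
      have "mean (\<lambda>x. (sqrt ?K * \<bar>tb J i x\<bar>)\<^sup>2) \<le> c1 * (LINT x|lborel. (sqrt ?K * \<bar>tb J i x\<bar>)\<^sup>2)"
      proof (rule mean_bounds(2)[where B = "(sqrt ?K * b)\<^sup>2"])
        show "\<bar>(sqrt ?K * \<bar>tb J i x\<bar>)\<^sup>2\<bar> \<le> (sqrt ?K * b)\<^sup>2" for x
          using power_mono[OF sb abs_ge_zero, of x 2] by (simp only: power2_abs abs_power2)
      qed (use sm in \<open>auto simp: tensor_basis_zero\<close>)
      also have "\<dots> = c1 * ?K" using sq[OF i] by (simp add: power_mult_distrib)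
      also have "\<dots> \<le> C * ?K" using C(1) by (intro mult_right_mono) auto
      finally show "mean (\<lambda>x. (sqrt ?K * \<bar>tb J i x\<bar>)\<^sup>2) \<le> C * ?K" .
      fix x
      show "\<bar>tb J i x\<bar> \<le> C * sqrt ?K"
      proof (rule order_trans[OF bb[OF i, of x]])
        show "b \<le> C * sqrt ?K" unfolding b_def using C(2) by (rule mult_right_mono) simp
      qed
    qed
    note pairs singles
  } note * = this
  show ?thesis using C(5) * by (intro exI[of _ C]) blast
qed

end

text \<open>The bound for the probability that the projection is unstable: Chernoff's inequality and the union
over all entries of the Gram matrix give the first term, the comparison with independent blocks the
second.\<close>

definition failure_bound :: "real \<Rightarrow> real \<Rightarrow> nat \<Rightarrow> nat \<Rightarrow> real \<Rightarrow> real" where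
  "failure_bound \<kappa> K n q \<tau> =
     2 * (4 * K\<^sup>2 * exp (- \<kappa> * (real n / (real q * K))) + 2 * real n / real q * \<tau>)"

context sampled_cdv_basis begin

definition stable :: "real \<Rightarrow> nat \<Rightarrow> nat \<Rightarrow> 'a set" where
  "stable C J n = {\<omega> \<in> space M.
     sup_op_norm S (emp_proj (tensor_index J) (tb J) n (\<lambda>m. X (int m) \<omega>)) \<le> ereal C}"

text \<open>Both signs are included because the deviation bound is one-sided.\<close>

lemma centred_moments:
  assumes g: "g \<in> borel_measurable borel" "\<And>x. \<bar>g x\<bar> \<le> b" and V: "mean (\<lambda>x. (g x)\<^sup>2) \<le> V"
    and s: "s \<in> {1, - 1}"
  defines "e \<equiv> \<lambda>x. s * (g x - mean g)"
  shows "e \<in> borel_measurable borel" "\<bar>e x\<bar> \<le> 2 * b"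
    "expectation (\<lambda>\<omega>. e (X i \<omega>)) = 0" "expectation (\<lambda>\<omega>. (e (X i \<omega>))\<^sup>2) \<le> V"
proof -
  have gX [measurable]: "(\<lambda>\<omega>. g (X i \<omega>)) \<in> borel_measurable M" by (rule measurable_compose[OF X g(1)])
  have int: "integrable M (\<lambda>\<omega>. g (X i \<omega>))"
    using g(2) by (intro integrable_const_bound[where B = b]) auto
  have int2: "integrable M (\<lambda>\<omega>. (g (X i \<omega>))\<^sup>2)"
  proof (rule integrable_const_bound[where B = "b\<^sup>2"])
    show "AE \<omega> in M. norm ((g (X i \<omega>))\<^sup>2) \<le> b\<^sup>2" using power_mono[OF g(2) abs_ge_zero, of _ 2] by simp
  qed simp
  have m: "expectation (\<lambda>\<omega>. g (X i \<omega>)) = mean g" by (rule expectation_eq_mean[OF g(1)])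
  have m2: "expectation (\<lambda>\<omega>. (g (X i \<omega>))\<^sup>2) = mean (\<lambda>x. (g x)\<^sup>2)"
    using g(1) by (intro expectation_eq_mean[of "\<lambda>x. (g x)\<^sup>2"]) simp
  show "e \<in> borel_measurable borel" unfolding e_def using g(1) by simp
  have "\<bar>mean g\<bar> \<le> b"
  proof -
    have "\<bar>mean g\<bar> \<le> expectation (\<lambda>\<omega>. \<bar>g (X i \<omega>)\<bar>)" unfolding m[symmetric] by (rule integral_abs_bound)
    also have "\<dots> \<le> expectation (\<lambda>\<omega>. b)" using int g(2) by (intro integral_mono) auto
    finally show ?thesis by (simp add: prob_space)
  qed
  moreover have "\<bar>e x\<bar> = \<bar>g x - mean g\<bar>" using s by (auto simp: e_def)
  ultimately show "\<bar>e x\<bar> \<le> 2 * b" using g(2)[of x] by linarith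
  show "expectation (\<lambda>\<omega>. e (X i \<omega>)) = 0" unfolding e_def using int m by (simp add: prob_space)
  have "expectation (\<lambda>\<omega>. (e (X i \<omega>))\<^sup>2) = variance (\<lambda>\<omega>. g (X i \<omega>))"
    unfolding m e_def using s by (auto simp: power_mult_distrib)
  also have "\<dots> = mean (\<lambda>x. (g x)\<^sup>2) - (mean g)\<^sup>2" using variance_eq[OF int int2] by (simp add: m m2)
  also have "\<dots> \<le> V" using V by (smt (verit) zero_le_power2)
  finally show "expectation (\<lambda>\<omega>. (e (X i \<omega>))\<^sup>2) \<le> V" .
qed

text \<open>Outside of the event that some \<open>b\<^sub>i b\<^sub>j\<close> or \<open>\<surd>K \<bar>b\<^sub>i\<bar>\<close> has an empirical mean at distance of more than
\<open>t\<close> from its expectation, the design is well conditioned. The choice of \<open>t\<close> makes the perturbation of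
the quadratic form at most half of \<open>c0\<close>.\<close>

lemma projection_bounded_probability:
  "\<exists>C\<ge>0. \<exists>\<kappa>>0. \<forall>n J q \<tau>. resolved J \<and> 1 \<le> q \<and> q \<le> n \<and> 0 \<le> \<tau> \<and>
      (\<forall>i. dependence_le M (gen_sigma M X {1..i}) (gen_sigma M X {i + int q..}) \<tau>) \<longrightarrow>
      1 - failure_bound \<kappa> (2 ^ (CARD('d) * J)) n q \<tau> \<le> prob (stable C J n)"
proof -
  obtain D where D: "1 \<le> D" and D_all: "\<forall>J. resolved J \<longrightarrow>
     (\<forall>i\<in>tensor_index J. \<forall>j\<in>(tensor_index J :: ('d \<Rightarrow> nat) set).
        mean (\<lambda>x. \<bar>tb J i x * tb J j x\<bar>) \<le> D \<and>
        mean (\<lambda>x. (tb J i x * tb J j x)\<^sup>2) \<le> D * 2 ^ (CARD('d) * J)) \<and>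
     (\<forall>i\<in>(tensor_index J :: ('d \<Rightarrow> nat) set).
        mean (\<lambda>x. sqrt (2 ^ (CARD('d) * J)) * \<bar>tb J i x\<bar>) \<le> D \<and>
        mean (\<lambda>x. (sqrt (2 ^ (CARD('d) * J)) * \<bar>tb J i x\<bar>)\<^sup>2) \<le> D * 2 ^ (CARD('d) * J) \<and>
        (\<forall>x. \<bar>tb J i x\<bar> \<le> D * sqrt (2 ^ (CARD('d) * J))))"
    using tensor_product_moments by (elim exE conjE)
  define w where "w = 4 * N + 2"
  define m where "m = (2 * w + 1) ^ CARD('d)"
  define t where "t = c0 / (2 * m)"
  have m: "0 < m" by (simp add: m_def)
  have t: "0 < t" using c0 m by (simp add: t_def)
  have tm: "t * m = c0 / 2" using m by (simp add: t_def)
  have DT: "0 \<le> D + t" "0 \<le> D" using D t by auto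
  have c02: "0 < c0 / 2" using c0(1) by simp
  obtain C where C: "0 \<le> C"
    and bound: "\<forall>J r n (b :: ('d \<Rightarrow> nat) \<Rightarrow> real ^ 'd \<Rightarrow> real) xs x.
      well_conditioned_design w (c0 / 2) (D + t) D (D + t) J r n b xs \<longrightarrow> lebesgue_fn (tensor_index J) b n xs x \<le> C"
    using lebesgue_fn_bounded[OF c02 DT(1,2) DT(1), where w = w and 'd = 'd and 'x = "real ^ 'd"]
    by (elim exE conjE)
  \<comment> \<open>The Chernoff parameter is \<open>a / (q K)\<close>: the first bound keeps the exponent of a block sum in \<open>[- 1, 1]\<close>, the second makes the quadratic term at most half of the linear one.\<close>
  define a where "a = min (1 / (2 * D\<^sup>2)) (t / (16 * D))"
  have a: "0 < a" "a * (2 * D\<^sup>2) \<le> 1" "2 * a * D \<le> t / 8"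
  proof -
    show "0 < a" using D t by (simp add: a_def)
    have "a * (2 * D\<^sup>2) \<le> 1 / (2 * D\<^sup>2) * (2 * D\<^sup>2)" by (intro mult_right_mono) (auto simp: a_def)
    then show "a * (2 * D\<^sup>2) \<le> 1" using D by simp
    have "a * (2 * D) \<le> t / (16 * D) * (2 * D)" using D by (intro mult_right_mono) (auto simp: a_def)
    then show "2 * a * D \<le> t / 8" using D by simp
  qed
  define \<kappa> where "\<kappa> = a * t / 8"
  show ?thesis
  proof (rule exI[of _ C], intro conjI, rule C, rule exI[of _ \<kappa>], intro conjI allI impI)
    show "0 < \<kappa>" using a t by (simp add: \<kappa>_def)
    fix n J q :: nat and \<tau> :: real
    assume "resolved J \<and> 1 \<le> q \<and> q \<le> n \<and> 0 \<le> \<tau> \<and>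
      (\<forall>i. dependence_le M (gen_sigma M X {1..i}) (gen_sigma M X {i + int q..}) \<tau>)"
    then have J: "resolved J" and q: "1 \<le> q" "q \<le> n" and \<tau>: "0 \<le> \<tau>"
      and dep: "\<And>i. dependence_le M (gen_sigma M X {1..i}) (gen_sigma M X {i + int q..}) \<tau>" by blast+
    let ?I = "tensor_index J :: ('d \<Rightarrow> nat) set"
    note J2 = resolved2[OF J]
    note D_pairs = D_all[rule_format, OF J, THEN conjunct1, rule_format]
    note D_singles = D_all[rule_format, OF J, THEN conjunct2, rule_format]
    define K :: real where "K = 2 ^ (CARD('d) * J)"
    have K: "1 \<le> K" by (simp add: K_def)
    have n: "0 < real n" using q by simp
    define gram :: "('d \<Rightarrow> nat) \<times> ('d \<Rightarrow> nat) \<Rightarrow> real ^ 'd \<Rightarrow> real"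
      where "gram = (\<lambda>(i, j) x. tb J i x * tb J j x)"
    define size :: "('d \<Rightarrow> nat) \<Rightarrow> real ^ 'd \<Rightarrow> real" where "size = (\<lambda>i x. sqrt K * \<bar>tb J i x\<bar>)"
    define G where "G = gram ` (?I \<times> ?I) \<union> size ` ?I"
    define E where "E = (\<lambda>(s, g) x. s * (g x - mean g)) ` ({1, - 1} \<times> G)"
    have gram_in: "gram (i, j) \<in> G" if "i \<in> ?I" "j \<in> ?I" for i j
      unfolding G_def by (intro UnI1 imageI SigmaI that)
    have size_in: "size i \<in> G" if "i \<in> ?I" for i
      unfolding G_def by (intro UnI2 imageI that)
    have finG: "finite G" by (simp add: G_def)
    have finE: "finite E" using finG by (simp add: E_def)
    have "card G \<le> card (?I \<times> ?I) + card ?I"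
      unfolding G_def by (intro order_trans[OF card_Un_le] add_mono card_image_le) auto
    also have "\<dots> = 2 ^ (CARD('d) * J) * 2 ^ (CARD('d) * J) + 2 ^ (CARD('d) * J)"
      by (simp add: card_cartesian_product card_tensor_index)
    finally have "real (card G) \<le> real (2 ^ (CARD('d) * J) * 2 ^ (CARD('d) * J) + 2 ^ (CARD('d) * J))"
      by (simp only: of_nat_le_iff)
    then have cardG: "real (card G) \<le> K\<^sup>2 + K" by (simp add: K_def power2_eq_square)
    have "card E \<le> card ({1, - 1 :: real} \<times> G)" unfolding E_def using finG by (intro card_image_le) auto
    then have cardE: "real (card E) \<le> 2 * (K\<^sup>2 + K)" using cardG by (simp add: card_cartesian_product)
    have sup: "\<bar>tb J i x\<bar> \<le> D * sqrt K" if "i \<in> ?I" for i x using D_singles[OF that] by (simp add: K_def)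
    have meas: "tb J i \<in> borel_measurable borel" if "i \<in> ?I" for i by (rule tensor_basis_measurable[OF J2 that])
    have G_facts: "g \<in> borel_measurable borel \<and> (\<forall>x. \<bar>g x\<bar> \<le> D\<^sup>2 * K) \<and> mean (\<lambda>x. (g x)\<^sup>2) \<le> D * K"
      if "g \<in> G" for g
    proof -
      have "(\<exists>i\<in>?I. \<exists>j\<in>?I. g = gram (i, j)) \<or> (\<exists>i\<in>?I. g = size i)"
        using that unfolding G_def by blast
      then consider i j where "g = gram (i, j)" "i \<in> ?I" "j \<in> ?I" | i where "g = size i" "i \<in> ?I"
        by blast
      then show ?thesis
      proof cases
        case 1
        have "\<bar>tb J i x\<bar> * \<bar>tb J j x\<bar> \<le> (D * sqrt K) * (D * sqrt K)" for x
          using sup 1 D K by (intro mult_mono) auto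
        also have "(D * sqrt K) * (D * sqrt K) = D\<^sup>2 * K" using K by (simp add: power2_eq_square)
        finally have "\<bar>tb J i x * tb J j x\<bar> \<le> D\<^sup>2 * K" for x by (simp add: abs_mult)
        moreover have "(\<lambda>x. tb J i x * tb J j x) \<in> borel_measurable borel"
          using meas 1 by (intro borel_measurable_times) auto
        ultimately show ?thesis using D_pairs[OF 1(2,3)] by (simp add: 1(1) gram_def K_def)
      next
        case 2
        have "\<bar>sqrt K * \<bar>tb J i x\<bar>\<bar> \<le> D\<^sup>2 * K" for x
        proof -
          have "sqrt K * \<bar>tb J i x\<bar> \<le> sqrt K * (D * sqrt K)" using sup[OF 2(2)] K by (intro mult_left_mono) auto
          also have "\<dots> = D * K" using K by simp
          also have "\<dots> \<le> D\<^sup>2 * K" using D K by (intro mult_right_mono) (auto simp: power2_eq_square)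
          finally show ?thesis using K by (simp add: abs_mult)
        qed
        moreover have "(\<lambda>x. sqrt K * \<bar>tb J i x\<bar>) \<in> borel_measurable borel" using meas[OF 2(2)] by simp
        ultimately show ?thesis using D_singles[OF 2(2)] by (simp add: 2(1) size_def K_def)
      qed
    qed
    have E_facts: "e \<in> borel_measurable borel \<and> (\<forall>x. \<bar>e x\<bar> \<le> 2 * (D\<^sup>2 * K)) \<and>
        (\<forall>i. expectation (\<lambda>\<omega>. e (X i \<omega>)) = 0) \<and> (\<forall>i. expectation (\<lambda>\<omega>. (e (X i \<omega>))\<^sup>2) \<le> D * K)"
      if eE: "e \<in> E" for e
    proof -
      obtain p where p: "e = (\<lambda>(s, g) x. s * (g x - mean g)) p" "p \<in> {1, - 1} \<times> G"
        using eE unfolding E_def by (rule imageE)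
      obtain s g where "p = (s, g)" by (cases p)
      then have sg: "s \<in> {1, - 1}" "g \<in> G" and e: "e = (\<lambda>x. s * (g x - mean g))"
        using p by simp_all
      have g: "g \<in> borel_measurable borel" "\<bar>g x\<bar> \<le> D\<^sup>2 * K" "mean (\<lambda>x. (g x)\<^sup>2) \<le> D * K" for x
        using G_facts[OF sg(2)] by blast+
      note moments = centred_moments[OF g sg(1)]
      show ?thesis unfolding e
        by (intro conjI allI; rule moments)
    qed
    define \<theta> where "\<theta> = a / (real q * K)"
    have \<theta>: "0 < \<theta>" "\<theta> * real q * (2 * (D\<^sup>2 * K)) \<le> 1"
      using a q K by (simp_all add: \<theta>_def)
    let ?bad = "{\<omega> \<in> space M. \<exists>e\<in>E. real n * t < (\<Sum>m = 1..n. e (X (int m) \<omega>))}"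
    have "prob ?bad \<le> 2 * (real (card E) * exp (2 * real n * \<theta>\<^sup>2 * real q * (D * K) - \<theta> * real n * t / 4)
        + 2 * real n / real q * \<tau>)"
      by (rule block_deviation[OF X finE _ _ _ _ dep \<theta> t q _ \<tau>]) (use E_facts D K in auto)
    also have "2 * real n * \<theta>\<^sup>2 * real q * (D * K) - \<theta> * real n * t / 4 =
        a * (real n / (real q * K)) * (2 * a * D - t / 4)"
      using q K by (simp add: \<theta>_def power2_eq_square field_simps)
    also have "2 * (real (card E) * exp (a * (real n / (real q * K)) * (2 * a * D - t / 4)) + 2 * real n / real q * \<tau>)
      \<le> 2 * (2 * (K\<^sup>2 + K) * exp (- \<kappa> * (real n / (real q * K))) + 2 * real n / real q * \<tau>)"
    proof -
      have "a * (real n / (real q * K)) * (2 * a * D - t / 4) \<le> a * (real n / (real q * K)) * (- t / 8)"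
        using a K by (intro mult_left_mono) auto
      also have "\<dots> = - \<kappa> * (real n / (real q * K))" by (simp add: \<kappa>_def mult_ac)
      finally show ?thesis using cardE K by (intro mult_left_mono add_right_mono mult_mono) auto
    qed
    finally have bad: "prob ?bad \<le> 2 * (2 * (K\<^sup>2 + K) * exp (- \<kappa> * (real n / (real q * K))) + 2 * real n / real q * \<tau>)" .
    have bad_ev: "?bad \<in> events"
    proof (rule sets_exists_exceeds[OF finE])
      fix e assume "e \<in> E"
      then show "(\<lambda>\<omega>. \<Sum>m = 1..n. e (X (int m) \<omega>)) \<in> borel_measurable M"
        using E_facts measurable_compose[OF X] by (intro borel_measurable_sum) blast
    qed
    let ?good = "{\<omega> \<in> space M. sup_op_norm S (emp_proj ?I (tb J) n (\<lambda>m. X (int m) \<omega>)) \<le> ereal C}"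
    have good_ev: "?good \<in> events"
      by (rule sets_sup_op_norm_emp_proj_le[where Q = "cbox 0 1"])
        (use C meas tensor_basis_continuous[OF J2] cube X XS in \<open>auto simp: tensor_basis_zero\<close>)
    have "space M - ?bad \<subseteq> ?good"
    proof
      fix \<omega> assume "\<omega> \<in> space M - ?bad"
      then have \<omega>: "\<omega> \<in> space M" and small: "\<And>e. e \<in> E \<Longrightarrow> (\<Sum>m = 1..n. e (X (int m) \<omega>)) \<le> real n * t"
        by (auto simp: not_less)
      let ?xs = "\<lambda>m. X (int m) \<omega>"
      have dev: "\<bar>(\<Sum>m = 1..n. g (?xs m)) / real n - mean g\<bar> \<le> t" if g: "g \<in> G" for g
      proof -
        have "(\<lambda>x. s * (g x - mean g)) \<in> E" if "s \<in> {1, - 1}" for s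
          unfolding E_def using that g by (intro image_eqI[where x = "(s, g)"]) auto
        from small[OF this[of 1]] small[OF this[of "- 1"]]
        have "\<bar>(\<Sum>m = 1..n. g (?xs m)) - real n * mean g\<bar> \<le> real n * t"
          by (simp add: sum_subtractf abs_le_iff)
        moreover have "(\<Sum>m = 1..n. g (?xs m)) / real n - mean g = ((\<Sum>m = 1..n. g (?xs m)) - real n * mean g) / real n"
          using n by (simp add: field_simps)
        ultimately show ?thesis using n by (simp add: pos_divide_le_eq mult.commute)
      qed
      have gram_dev: "\<bar>emp_gram (tb J) n ?xs i j - mean (\<lambda>x. tb J i x * tb J j x)\<bar> \<le> t" if "i \<in> ?I" "j \<in> ?I" for i j
        using dev[OF gram_in[OF that]] by (simp add: gram_def emp_gram_def)
      have mean_le: "\<bar>mean (\<lambda>x. tb J i x * tb J j x)\<bar> \<le> D" if "i \<in> ?I" "j \<in> ?I" for i j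
      proof -
        from G_facts[OF gram_in[OF that]] have "\<bar>mean (\<lambda>x. tb J i x * tb J j x)\<bar> \<le> mean (\<lambda>x. \<bar>tb J i x * tb J j x\<bar>)"
          by (intro mean_abs_le[where B = "D\<^sup>2 * K"]) (auto simp: gram_def)
        then show ?thesis using D_pairs[OF that] by linarith
      qed
      have band: "tb J i x * tb J j x = 0" if "i \<in> ?I" "j \<in> ?I" "\<not> grid_nbr w i j" for i j x
        using tensor_basis_band[OF J2 that(1,2)] that(3) by (simp add: w_def)
      have coercive: "c0 / 2 * (\<Sum>i\<in>?I. (v i)\<^sup>2) \<le> (\<Sum>i\<in>?I. \<Sum>j\<in>?I. emp_gram (tb J) n ?xs i j * v i * v j)" for v
      proof -
        let ?\<Delta> = "\<lambda>i j. emp_gram (tb J) n ?xs i j - mean (\<lambda>x. tb J i x * tb J j x)"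
        have "\<bar>\<Sum>i\<in>?I. \<Sum>j\<in>?I. ?\<Delta> i j * v i * v j\<bar> \<le> t * m * (\<Sum>i\<in>?I. (v i)\<^sup>2)"
        proof (rule banded_quadratic_form_le[where nbr = "grid_nbr w"])
          show "?\<Delta> i j = 0" if "i \<in> ?I" "j \<in> ?I" "\<not> grid_nbr w i j" for i j
            unfolding emp_gram_def band[OF that] by (simp add: mean_def)
        qed (use gram_dev t card_grid_nbr_le grid_nbr_sym in \<open>auto simp: m_def\<close>)
        moreover have "(\<Sum>i\<in>?I. \<Sum>j\<in>?I. emp_gram (tb J) n ?xs i j * v i * v j) =
            (\<Sum>i\<in>?I. \<Sum>j\<in>?I. mean (\<lambda>x. tb J i x * tb J j x) * v i * v j) + (\<Sum>i\<in>?I. \<Sum>j\<in>?I. ?\<Delta> i j * v i * v j)"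
          unfolding sum.distrib[symmetric] by (intro sum.cong refl) (simp add: algebra_simps)
        ultimately show ?thesis using mean_gram_coercive[OF J, of v] unfolding tm by (simp add: abs_le_iff)
      qed
      have "well_conditioned_design w (c0 / 2) (D + t) D (D + t) J (sqrt K) n (tb J) ?xs"
        unfolding well_conditioned_design_def
      proof (intro conjI ballI allI impI)
        show "0 < sqrt K" using K by simp
        show "\<bar>emp_gram (tb J) n ?xs i j\<bar> \<le> D + t" if "i \<in> ?I" "j \<in> ?I" for i j
          using gram_dev[OF that] mean_le[OF that] by linarith
        show "(\<Sum>m = 1..n. sqrt K * \<bar>tb J i (?xs m)\<bar>) / real n \<le> D + t" if "i \<in> ?I" for i
          using dev[OF size_in[OF that]] D_singles[OF that] unfolding size_def K_def by linarith
      qed (use band sup coercive in auto)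
      then have "lebesgue_fn ?I (tb J) n ?xs x \<le> C" for x using bound by blast
      then show "\<omega> \<in> ?good"
        using \<omega> XS[OF \<omega>] sup_op_norm_emp_proj_le_iff[OF C, of n ?xs S ?I "tb J"] by blast
    qed
    then have "prob (space M - ?bad) \<le> prob ?good" using good_ev by (rule finite_measure_mono)
    then have good: "1 - prob ?bad \<le> prob ?good" using prob_compl[OF bad_ev] by simp
    have "K\<^sup>2 + K \<le> 2 * K\<^sup>2" using K by (simp add: power2_eq_square)
    then have "2 * (K\<^sup>2 + K) * exp (- \<kappa> * (real n / (real q * K))) \<le> 4 * K\<^sup>2 * exp (- \<kappa> * (real n / (real q * K)))"
      by (intro mult_right_mono) auto
    then have "2 * (2 * (K\<^sup>2 + K) * exp (- \<kappa> * (real n / (real q * K))) + 2 * real n / real q * \<tau>)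
        \<le> 2 * (4 * K\<^sup>2 * exp (- \<kappa> * (real n / (real q * K))) + 2 * real n / real q * \<tau>)"
      by (intro mult_left_mono add_right_mono) auto
    from order_trans[OF diff_left_mono[OF order_trans[OF bad this]] good]
    show "1 - failure_bound \<kappa> (2 ^ (CARD('d) * J)) n q \<tau> \<le> prob (stable C J n)"
      unfolding failure_bound_def stable_def K_def .
  qed
qed

end

section \<open>Rates\<close>

lemma eventually_one_le_ln: "\<forall>\<^sub>F n in sequentially. 1 \<le> ln (real n)"
  using eventually_ge_at_top[of 3]
proof eventually_elim
  case (elim n)
  then have "exp 1 \<le> real n" using exp_le by linarith
  then show ?case using elim by (simp add: ln_ge_iff)
qed

text \<open>By the rate condition \<open>n / (q K)\<close> eventually exceeds any multiple of \<open>ln n\<close>, and \<open>q K \<le> n\<close>. So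
the first term is of order \<open>n\<^sup>2 n\<^sup>-\<^sup>3\<close>.\<close>

lemma deviation_bound_tendsto_0:
  fixes K q :: "nat \<Rightarrow> nat" and \<tau> :: "nat \<Rightarrow> real"
  assumes K: "\<And>n. 1 \<le> K n" and q: "\<And>n. 1 \<le> q n" and \<kappa>: "0 < \<kappa>"
    and rate: "(\<lambda>n. real (q n) * real (K n) * ln (real n) / real n) \<longlonglongrightarrow> 0"
    and \<tau>: "(\<lambda>n. real n / real (q n) * \<tau> n) \<longlonglongrightarrow> 0"
  shows "\<forall>\<^sub>F n in sequentially. q n \<le> n"
    and "(\<lambda>n. failure_bound \<kappa> (real (K n)) n (q n) (\<tau> n)) \<longlonglongrightarrow> 0"
proof -
  have "\<forall>\<^sub>F n in sequentially. real (q n) * real (K n) * ln (real n) / real n < min 1 (\<kappa> / 3)"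
    using rate \<kappa> by (intro order_tendstoD) auto
  moreover have "\<forall>\<^sub>F n in sequentially. 1 \<le> ln (real n)" by (rule eventually_one_le_ln)
  ultimately have ev: "\<forall>\<^sub>F n in sequentially. 0 < real n \<and> real (q n) * real (K n) \<le> real n \<and>
      3 * ln (real n) \<le> \<kappa> * (real n / (real (q n) * real (K n)))"
  proof eventually_elim
    case (elim n)
    define p where "p = real (q n) * real (K n)"
    have "1 * 1 \<le> p" unfolding p_def using q[of n] K[of n] by (intro mult_mono) auto
    then have p: "1 \<le> p" by simp
    have n: "0 < real n" using elim(2) by (cases "n = 0") auto
    have 1: "p * ln (real n) < real n" and 2: "p * ln (real n) < \<kappa> / 3 * real n"
      using elim(1) n unfolding p_def[symmetric] by (simp_all add: pos_divide_less_eq)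
    have "p * 1 \<le> p * ln (real n)" using p elim(2) by (intro mult_left_mono) auto
    then have "p \<le> real n" using 1 by simp
    moreover have "3 * ln (real n) \<le> \<kappa> * (real n / p)" using 2 p by (simp add: field_simps)
    ultimately show ?case using n unfolding p_def by simp
  qed
  then show "\<forall>\<^sub>F n in sequentially. q n \<le> n"
  proof eventually_elim
    case (elim n)
    have "real (q n) * 1 \<le> real (q n) * real (K n)" using K[of n] by (intro mult_left_mono) auto
    then show ?case using elim by simp
  qed
  let ?e = "\<lambda>n. (real (K n))\<^sup>2 * exp (- \<kappa> * (real n / (real (q n) * real (K n))))"
  have "?e \<longlonglongrightarrow> 0"
  proof (rule tendsto_sandwich[of "\<lambda>_. 0" _ _ "\<lambda>n. 1 / real n"])
    show "\<forall>\<^sub>F n in sequentially. ?e n \<le> 1 / real n"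
      using ev
    proof eventually_elim
      case (elim n)
      have "1 * real (K n) \<le> real (q n) * real (K n)" using q[of n] by (intro mult_right_mono) auto
      then have "(real (K n))\<^sup>2 \<le> (real n)\<^sup>2" using elim by (intro power_mono) auto
      moreover have "exp (- \<kappa> * (real n / (real (q n) * real (K n)))) \<le> exp (- (3 * ln (real n)))"
        using elim by simp
      ultimately have "?e n \<le> (real n)\<^sup>2 * exp (- (3 * ln (real n)))" by (intro mult_mono) auto
      also have "exp (- (3 * ln (real n))) = 1 / (real n) ^ 3"
        using elim exp_of_nat_mult[of 3 "ln (real n)"] by (simp add: exp_minus inverse_eq_divide)
      also have "(real n)\<^sup>2 * (1 / (real n) ^ 3) = 1 / real n"
        using elim by (simp add: power2_eq_square power3_eq_cube)
      finally show ?case .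
    qed
    show "(\<lambda>n. 1 / real n) \<longlonglongrightarrow> 0" by (rule lim_const_over_n)
  qed auto
  then have "(\<lambda>n. 2 * (4 * ?e n + 2 * (real n / real (q n) * \<tau> n))) \<longlonglongrightarrow> 2 * (4 * 0 + 2 * 0)"
    using \<tau> by (intro tendsto_intros)
  then show "(\<lambda>n. failure_bound \<kappa> (real (K n)) n (q n) (\<tau> n)) \<longlonglongrightarrow> 0"
    by (simp add: failure_bound_def mult.assoc)
qed

lemma tendsto_sqrt_0D:
  fixes u :: "nat \<Rightarrow> real"
  assumes lim: "(\<lambda>n. sqrt (u n)) \<longlonglongrightarrow> 0" and nonneg: "\<forall>\<^sub>F n in sequentially. 0 \<le> u n"
  shows "u \<longlonglongrightarrow> 0"
proof -
  have "(\<lambda>n. (sqrt (u n))\<^sup>2) \<longlonglongrightarrow> 0\<^sup>2" using lim by (intro tendsto_intros)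
  moreover have "\<forall>\<^sub>F n in sequentially. (sqrt (u n))\<^sup>2 = u n" using nonneg by eventually_elim simp
  ultimately show ?thesis by (simp add: tendsto_cong)
qed

text \<open>Blocks of length \<open>(2 / \<gamma>) ln n\<close> make \<open>\<beta> q\<close> of order \<open>n\<^sup>-\<^sup>2\<close> and cost a logarithm in the rate.\<close>

lemma exponential_mixing_block_length:
  fixes K :: "nat \<Rightarrow> nat" and \<beta> :: "nat \<Rightarrow> real"
  assumes \<beta>: "\<And>q. 0 \<le> \<beta> q" "\<And>q. \<beta> q \<le> c * exp (- \<gamma> * real q)" and \<gamma>: "0 < \<gamma>" and c: "0 \<le> c"
    and rate: "(\<lambda>n. sqrt (real (K n) * (ln (real n))\<^sup>2 / real n)) \<longlonglongrightarrow> 0"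
  obtains q :: "nat \<Rightarrow> nat" where "\<And>n. 1 \<le> q n"
    "(\<lambda>n. real (q n) * real (K n) * ln (real n) / real n) \<longlonglongrightarrow> 0"
    "(\<lambda>n. real n / real (q n) * (2 * \<beta> (q n))) \<longlonglongrightarrow> 0"
proof -
  define q where "q = (\<lambda>n. nat \<lceil>2 / \<gamma> * ln (real n)\<rceil> + 1)"
  have q1: "1 \<le> q n" for n by (simp add: q_def)
  have r: "(\<lambda>n. real (K n) * (ln (real n))\<^sup>2 / real n) \<longlonglongrightarrow> 0"
    by (rule tendsto_sqrt_0D[OF rate]) simp
  have large: "\<forall>\<^sub>F n in sequentially. 1 \<le> ln (real n)" by (rule eventually_one_le_ln)
  have lim1: "(\<lambda>n. real (q n) * real (K n) * ln (real n) / real n) \<longlonglongrightarrow> 0"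
  proof (rule tendsto_sandwich[of "\<lambda>_. 0" _ _ "\<lambda>n. (2 / \<gamma> + 2) * (real (K n) * (ln (real n))\<^sup>2 / real n)"])
    have "(\<lambda>n. (2 / \<gamma> + 2) * (real (K n) * (ln (real n))\<^sup>2 / real n)) \<longlonglongrightarrow> (2 / \<gamma> + 2) * 0"
      using r by (intro tendsto_intros)
    then show "(\<lambda>n. (2 / \<gamma> + 2) * (real (K n) * (ln (real n))\<^sup>2 / real n)) \<longlonglongrightarrow> 0" by simp
    show "\<forall>\<^sub>F n in sequentially. real (q n) * real (K n) * ln (real n) / real n \<le>
        (2 / \<gamma> + 2) * (real (K n) * (ln (real n))\<^sup>2 / real n)"
      using large
    proof eventually_elim
      case (elim n)
      have "0 \<le> 2 / \<gamma> * ln (real n)" using elim \<gamma> by simp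
      then have "real (q n) \<le> 2 / \<gamma> * ln (real n) + 2" unfolding q_def by linarith
      also have "\<dots> \<le> (2 / \<gamma> + 2) * ln (real n)" using elim by (simp add: distrib_right)
      finally have "real (q n) * (real (K n) * ln (real n) / real n) \<le>
          (2 / \<gamma> + 2) * ln (real n) * (real (K n) * ln (real n) / real n)"
        using elim by (intro mult_right_mono) auto
      then show ?case by (simp add: power2_eq_square mult_ac)
    qed
    show "\<forall>\<^sub>F n in sequentially. 0 \<le> real (q n) * real (K n) * ln (real n) / real n"
      using large by eventually_elim simp
  qed simp
  have lim2: "(\<lambda>n. real n / real (q n) * (2 * \<beta> (q n))) \<longlonglongrightarrow> 0"
  proof (rule tendsto_sandwich[of "\<lambda>_. 0" _ _ "\<lambda>n. 2 * c / real n"])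
    show "(\<lambda>n. 2 * c / real n) \<longlonglongrightarrow> 0" by (rule lim_const_over_n)
    show "\<forall>\<^sub>F n in sequentially. real n / real (q n) * (2 * \<beta> (q n)) \<le> 2 * c / real n"
      using large
    proof eventually_elim
      case (elim n)
      have n: "0 < real n" using elim by (cases "n = 0") auto
      have "0 \<le> 2 / \<gamma> * ln (real n)" using elim \<gamma> by simp
      then have "2 / \<gamma> * ln (real n) \<le> real (q n)" unfolding q_def by linarith
      then have "\<gamma> * (2 / \<gamma> * ln (real n)) \<le> \<gamma> * real (q n)" using \<gamma> by (intro mult_left_mono) auto
      then have "- \<gamma> * real (q n) \<le> - (2 * ln (real n))" using \<gamma> by simp
      then have "exp (- \<gamma> * real (q n)) \<le> exp (- (2 * ln (real n)))" by simp
      also have "\<dots> = 1 / (real n)\<^sup>2"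
        using n exp_of_nat_mult[of 2 "ln (real n)"] by (simp add: exp_minus inverse_eq_divide)
      finally have "c * exp (- \<gamma> * real (q n)) \<le> c * (1 / (real n)\<^sup>2)" using c by (intro mult_left_mono)
      then have b: "\<beta> (q n) \<le> c * (1 / (real n)\<^sup>2)" using \<beta>(2)[of "q n"] by linarith
      have "real n / real (q n) \<le> real n / 1" using q1[of n] n by (intro divide_left_mono) auto
      then have "real n / real (q n) * (2 * \<beta> (q n)) \<le> real n * (2 * (c * (1 / (real n)\<^sup>2)))"
        using b \<beta>(1)[of "q n"] by (intro mult_mono) auto
      also have "\<dots> = 2 * c / real n" using n by (simp add: power2_eq_square)
      finally show ?case .
    qed
    show "\<forall>\<^sub>F n in sequentially. 0 \<le> real n / real (q n) * (2 * \<beta> (q n))" using \<beta>(1) by simp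
  qed simp
  show thesis by (rule that[OF q1 lim1 lim2])
qed

text \<open>The choice \<open>q \<approx> n powr (1 / (1 + \<gamma>))\<close> balances the two terms: \<open>n / q \<le> q powr \<gamma>\<close> makes the dependence
term vanish, and \<open>q / n\<close> is the reciprocal of \<open>n powr (\<gamma> / (1 + \<gamma>))\<close> up to a constant.\<close>

lemma algebraic_mixing_block_length:
  fixes K :: "nat \<Rightarrow> nat" and \<beta> :: "nat \<Rightarrow> real"
  assumes \<beta>: "\<And>q. 0 \<le> \<beta> q" "(\<lambda>q. real q powr \<gamma> * \<beta> q) \<longlonglongrightarrow> 0" and \<gamma>: "0 < \<gamma>"
    and rate: "(\<lambda>n. sqrt (real (K n) * ln (real n) / real n powr (\<gamma> / (1 + \<gamma>)))) \<longlonglongrightarrow> 0"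
  obtains q :: "nat \<Rightarrow> nat" where "\<And>n. 1 \<le> q n"
    "(\<lambda>n. real (q n) * real (K n) * ln (real n) / real n) \<longlonglongrightarrow> 0"
    "(\<lambda>n. real n / real (q n) * (2 * \<beta> (q n))) \<longlonglongrightarrow> 0"
proof -
  let ?p = "\<lambda>n. real n powr (1 / (1 + \<gamma>))"
  define q where "q = (\<lambda>n. nat \<lceil>?p n\<rceil> + 1)"
  have q1: "1 \<le> q n" for n by (simp add: q_def)
  have pq: "?p n \<le> real (q n)" for n unfolding q_def by linarith
  have large: "\<forall>\<^sub>F n in sequentially. 1 \<le> real n"
    using eventually_ge_at_top[of 1] by eventually_elim simp
  have r: "(\<lambda>n. real (K n) * ln (real n) / real n powr (\<gamma> / (1 + \<gamma>))) \<longlonglongrightarrow> 0"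
    by (rule tendsto_sqrt_0D[OF rate]) (use large in eventually_elim, simp)
  have lim1: "(\<lambda>n. real (q n) * real (K n) * ln (real n) / real n) \<longlonglongrightarrow> 0"
  proof (rule tendsto_sandwich[of "\<lambda>_. 0" _ _ "\<lambda>n. 3 * (real (K n) * ln (real n) / real n powr (\<gamma> / (1 + \<gamma>)))"])
    have "(\<lambda>n. 3 * (real (K n) * ln (real n) / real n powr (\<gamma> / (1 + \<gamma>)))) \<longlonglongrightarrow> 3 * 0"
      using r by (intro tendsto_intros)
    then show "(\<lambda>n. 3 * (real (K n) * ln (real n) / real n powr (\<gamma> / (1 + \<gamma>)))) \<longlonglongrightarrow> 0" by simp
    show "\<forall>\<^sub>F n in sequentially. real (q n) * real (K n) * ln (real n) / real n \<le>
        3 * (real (K n) * ln (real n) / real n powr (\<gamma> / (1 + \<gamma>)))"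
      using large
    proof eventually_elim
      case (elim n)
      have "1 \<le> ?p n" using elim \<gamma> by (intro ge_one_powr_ge_zero) auto
      then have "real (q n) \<le> 3 * ?p n" unfolding q_def by linarith
      then have "real (q n) * (real (K n) * ln (real n) / real n) \<le> 3 * ?p n * (real (K n) * ln (real n) / real n)"
        using elim by (intro mult_right_mono) auto
      also have "\<dots> = 3 * (real (K n) * ln (real n) * (?p n / real n))" by simp
      also have "?p n / real n = 1 / real n powr (\<gamma> / (1 + \<gamma>))"
      proof -
        have "1 / (1 + \<gamma>) - 1 = - (\<gamma> / (1 + \<gamma>))" using \<gamma> by (simp add: field_simps)
        then have "?p n / real n = real n powr (- (\<gamma> / (1 + \<gamma>)))"
          using elim powr_diff[of "real n" "1 / (1 + \<gamma>)" 1] by simp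
        then show ?thesis by (simp add: powr_minus_divide)
      qed
      finally show ?case by (simp add: mult_ac)
    qed
    show "\<forall>\<^sub>F n in sequentially. 0 \<le> real (q n) * real (K n) * ln (real n) / real n"
      using large by eventually_elim simp
  qed simp
  have "filterlim q at_top sequentially"
    unfolding filterlim_at_top
  proof
    fix Z :: nat
    show "\<forall>\<^sub>F n in sequentially. Z \<le> q n"
      using eventually_ge_at_top[of "nat \<lceil>real Z powr (1 + \<gamma>)\<rceil>"]
    proof eventually_elim
      case (elim n)
      then have "real Z powr (1 + \<gamma>) \<le> real n" by linarith
      then have "(real Z powr (1 + \<gamma>)) powr (1 / (1 + \<gamma>)) \<le> ?p n" using \<gamma> by (intro powr_mono2) auto
      then have "real Z \<le> ?p n" using \<gamma> by (simp add: powr_powr)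
      then show ?case using pq[of n] by linarith
    qed
  qed
  then have "(\<lambda>n. real (q n) powr \<gamma> * \<beta> (q n)) \<longlonglongrightarrow> 0"
    using filterlim_compose[OF \<beta>(2)] by blast
  then have b: "(\<lambda>n. 2 * (real (q n) powr \<gamma> * \<beta> (q n))) \<longlonglongrightarrow> 2 * 0" by (intro tendsto_intros)
  have lim2: "(\<lambda>n. real n / real (q n) * (2 * \<beta> (q n))) \<longlonglongrightarrow> 0"
  proof (rule tendsto_sandwich[of "\<lambda>_. 0" _ _ "\<lambda>n. 2 * (real (q n) powr \<gamma> * \<beta> (q n))"])
    show "(\<lambda>n. 2 * (real (q n) powr \<gamma> * \<beta> (q n))) \<longlonglongrightarrow> 0" using b by simp
    show "\<forall>\<^sub>F n in sequentially. real n / real (q n) * (2 * \<beta> (q n)) \<le> 2 * (real (q n) powr \<gamma> * \<beta> (q n))"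
      using large
    proof eventually_elim
      case (elim n)
      have "real n = ?p n powr (1 + \<gamma>)" using elim \<gamma> by (simp add: powr_powr)
      also have "\<dots> \<le> real (q n) powr (1 + \<gamma>)" using pq \<gamma> by (intro powr_mono2) auto
      also have "\<dots> = real (q n) * real (q n) powr \<gamma>" using q1[of n] by (simp add: powr_add)
      finally have "real n / real (q n) \<le> real (q n) powr \<gamma>" using q1[of n] by (simp add: field_simps)
      then have "real n / real (q n) * (2 * \<beta> (q n)) \<le> real (q n) powr \<gamma> * (2 * \<beta> (q n))"
        using \<beta>(1) by (intro mult_right_mono) auto
      then show ?case by simp
    qed
    show "\<forall>\<^sub>F n in sequentially. 0 \<le> real n / real (q n) * (2 * \<beta> (q n))" using \<beta>(1) by simp
  qed simp
  show thesis by (rule that[OF q1 lim1 lim2])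
qed

section \<open>Stability of the empirical projection\<close>

lemma eventually_resolved:
  fixes J K :: "nat \<Rightarrow> nat" and N d :: nat
  assumes K: "\<And>n. K n = 2 ^ (d * J n)" and lim: "filterlim K at_top sequentially" and d: "0 < d"
  shows "\<forall>\<^sub>F n in sequentially. 4 * N < 2 ^ J n"
proof -
  have "\<forall>\<^sub>F n in sequentially. Suc ((4 * N) ^ d) \<le> K n"
    using lim unfolding filterlim_at_top by blast
  then show ?thesis
  proof eventually_elim
    case (elim n)
    then have "(4 * N) ^ d < (2 ^ J n) ^ d" unfolding Suc_le_eq K by (simp only: power_mult[symmetric] mult.commute[of d])
    then show ?case by (rule power_less_imp_less_base) simp
  qed
qed

context sampled_cdv_basis begin

theorem projection_bounded_with_probability_tending_to_1:
  fixes J K q :: "nat \<Rightarrow> nat" and \<tau> :: "nat \<Rightarrow> real"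
  assumes K: "\<And>n. K n = 2 ^ (CARD('d) * J n)" and lim: "filterlim K at_top sequentially"
    and q: "\<And>n. 1 \<le> q n" and \<tau>: "\<And>n. 0 \<le> \<tau> n"
    and dep: "\<And>n i. dependence_le M (gen_sigma M X {1..i}) (gen_sigma M X {i + int (q n)..}) (\<tau> n)"
    and rate: "(\<lambda>n. real (q n) * real (K n) * ln (real n) / real n) \<longlonglongrightarrow> 0"
    and rate\<tau>: "(\<lambda>n. real n / real (q n) * \<tau> n) \<longlonglongrightarrow> 0"
  shows "\<exists>C::real. (\<lambda>n. prob (stable C (J n) n)) \<longlonglongrightarrow> 1"
proof -
  obtain C \<kappa> :: real where "0 \<le> C" and \<kappa>: "0 < \<kappa>"
    and bound: "\<forall>n J q \<tau>. resolved J \<and> 1 \<le> q \<and> q \<le> n \<and> 0 \<le> \<tau> \<and>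
      (\<forall>i. dependence_le M (gen_sigma M X {1..i}) (gen_sigma M X {i + int q..}) \<tau>) \<longrightarrow>
      1 - failure_bound \<kappa> (2 ^ (CARD('d) * J)) n q \<tau> \<le> prob (stable C J n)"
    using projection_bounded_probability by (elim exE conjE)
  have K1: "1 \<le> K n" for n by (simp add: K)
  let ?err = "\<lambda>n. failure_bound \<kappa> (real (K n)) n (q n) (\<tau> n)"
  note err = deviation_bound_tendsto_0[OF K1 q \<kappa> rate rate\<tau>]
  have "(\<lambda>n. prob (stable C (J n) n)) \<longlonglongrightarrow> 1"
  proof (rule tendsto_sandwich[of "\<lambda>n. 1 - ?err n" _ _ "\<lambda>_. 1"])
    have "(\<lambda>n. 1 - ?err n) \<longlonglongrightarrow> 1 - 0" by (intro tendsto_diff tendsto_const err(2))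
    then show "(\<lambda>n. 1 - ?err n) \<longlonglongrightarrow> 1" by simp
    show "\<forall>\<^sub>F n in sequentially. 1 - ?err n \<le> prob (stable C (J n) n)"
      using err(1) eventually_resolved[OF K lim zero_less_card_finite, of N]
    proof eventually_elim
      case (elim n)
      have "resolved (J n)" using elim(2) by (simp add: resolved_def)
      then have "resolved (J n) \<and> 1 \<le> q n \<and> q n \<le> n \<and> 0 \<le> \<tau> n \<and>
          (\<forall>i. dependence_le M (gen_sigma M X {1..i}) (gen_sigma M X {i + int (q n)..}) (\<tau> n))"
        using q elim(1) \<tau> dep by blast
      from bound[rule_format, OF this] show ?case by (simp only: K of_nat_power of_nat_numeral)
    qed
  qed (auto simp: prob_le_1)
  then show ?thesis by blast
qed

end

theorem theorem5p2:
  fixes M :: "'a measure"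
    and X :: "int \<Rightarrow> 'a \<Rightarrow> real ^ 'd"
    and \<X> :: "(real ^ 'd) set"
    and f\<^sub>X :: "real ^ 'd \<Rightarrow> real"
    and N :: nat
    and \<phi> \<psi> :: "real \<Rightarrow> real"
    and \<phi>l \<phi>r :: "nat \<Rightarrow> real \<Rightarrow> real"
    and J K :: "nat \<Rightarrow> nat"
  assumes prob: "prob_space M"
    and stationary: "strictly_stationary M X"
    and cube: "cbox 0 1 \<subseteq> \<X>"
    and X_values: "\<And>i \<omega>. \<omega> \<in> space M \<Longrightarrow> X i \<omega> \<in> \<X>"
    and density_nonneg: "\<And>x. 0 \<le> f\<^sub>X x"
    and density: "\<And>i. distributed M lborel (X i) (\<lambda>x. ennreal (f\<^sub>X x))"
    and density_lower: "0 < (INF x\<in>cbox 0 1. ereal (f\<^sub>X x))"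
    and density_upper: "(SUP x\<in>cbox 0 1. ereal (f\<^sub>X x)) < \<infinity>"
    and daubechies: "daubechies_pair N \<phi> \<psi>"
    and continuous: "continuous_on UNIV \<phi>"
    and left_boundary: "cdv_left N \<phi> \<phi>l"
    and right_boundary: "cdv_right N \<phi> \<phi>r"
    and J_large: "\<And>n. 2 ^ J n > 2 * N"
    and K_def: "\<And>n. K n = 2 ^ (CARD('d) * J n)"
    and K_infinity: "filterlim K at_top sequentially"
    and cases:
      "(prob_space.indep_vars M (\<lambda>_. borel) X {1..} \<and>
          (\<lambda>n. sqrt (real (K n) * ln (real n) / real n)) \<longlonglongrightarrow> 0)
       \<or> (exp_beta_mixing M X \<and>
          (\<lambda>n. sqrt (real (K n) * (ln (real n))\<^sup>2 / real n)) \<longlonglongrightarrow> 0)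
       \<or> (\<exists>\<gamma>. alg_beta_mixing M X \<gamma> \<and>
          (\<lambda>n. sqrt (real (K n) * ln (real n) / real n powr (\<gamma> / (1 + \<gamma>)))) \<longlonglongrightarrow> 0)"
  shows "\<exists>C::real. (\<lambda>n. measure M {\<omega> \<in> space M.
            sup_op_norm \<X>
              (emp_proj (tensor_index (J n)) (tensor_basis N \<phi> \<phi>l \<phi>r (J n)) n
                 (\<lambda>m. X (int m) \<omega>)) \<le> ereal C}) \<longlonglongrightarrow> 1"
proof -
  \<comment> \<open>The interpretation below brings another fact of the name \<open>density_nonneg\<close>.\<close>
  note f_nonneg = density_nonneg
  interpret prob_space M by (rule prob)
  have X: "X i \<in> borel_measurable M" for i
    using stationary unfolding strictly_stationary_def by blast
  obtain c0 :: real where c0: "0 < ereal c0" "ereal c0 < (INF x\<in>cbox 0 1. ereal (f\<^sub>X x))"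
    using ereal_dense2[OF density_lower] by blast
  have c0_pos: "0 < c0" using c0(1) by simp
  have c0_le: "c0 \<le> f\<^sub>X x" if "x \<in> cbox 0 1" for x
    using order_less_le_trans[OF c0(2) INF_lower[OF that]] by simp
  obtain c1 :: real where c1: "(SUP x\<in>cbox 0 1. ereal (f\<^sub>X x)) < ereal c1"
    using ereal_dense2[OF density_upper] by blast
  have c1_ge: "f\<^sub>X x \<le> c1" if "x \<in> cbox 0 1" for x
    using order_le_less_trans[OF SUP_upper[OF that] c1] by simp
  have scaling: "scaling_fn N \<phi>"
    using daubechies continuous unfolding daubechies_pair_def scaling_fn_def
    by (elim conjE, intro conjI)
  interpret sampled_cdv_basis M N \<phi> \<phi>l \<phi>r X \<X> f\<^sub>X c0 c1
    by unfold_locales (fact scaling left_boundary right_boundary X cube X_values f_nonneg density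
        c0_pos c0_le c1_ge)+
  note conclusion = projection_bounded_with_probability_tending_to_1[OF K_def K_infinity, unfolded stable_def]
  consider (iid) "indep_vars (\<lambda>_. borel) X {1..}" "(\<lambda>n. sqrt (real (K n) * ln (real n) / real n)) \<longlonglongrightarrow> 0"
    | (exponential) "exp_beta_mixing M X" "(\<lambda>n. sqrt (real (K n) * (ln (real n))\<^sup>2 / real n)) \<longlonglongrightarrow> 0"
    | (algebraic) \<gamma> where "alg_beta_mixing M X \<gamma>"
        "(\<lambda>n. sqrt (real (K n) * ln (real n) / real n powr (\<gamma> / (1 + \<gamma>)))) \<longlonglongrightarrow> 0"
    using cases by blast
  then show ?thesis
  proof cases
    case iid
    have "(\<lambda>n. real (K n) * ln (real n) / real n) \<longlonglongrightarrow> 0"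
    proof (rule tendsto_sqrt_0D[OF iid(2)])
      show "\<forall>\<^sub>F n in sequentially. 0 \<le> real (K n) * ln (real n) / real n"
        using eventually_one_le_ln by eventually_elim simp
    qed
    then show ?thesis
      using conclusion[of "\<lambda>_. 1" "\<lambda>_. 0"] dependence_le_indep_vars[OF X iid(1)] by simp
  next
    case exponential
    obtain \<gamma> c where \<gamma>: "0 < \<gamma>" and c: "0 \<le> c" and decay: "\<And>q. beta_mix M X q \<le> c * exp (- \<gamma> * real q)"
      using exponential(1) unfolding exp_beta_mixing_def by blast
    obtain q where q: "\<And>n. 1 \<le> q n"
      "(\<lambda>n. real (q n) * real (K n) * ln (real n) / real n) \<longlonglongrightarrow> 0"
      "(\<lambda>n. real n / real (q n) * (2 * beta_mix M X (q n))) \<longlonglongrightarrow> 0"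
      using exponential_mixing_block_length[OF dependence_le_beta_mix(2)[OF X] decay \<gamma> c exponential(2)]
      by blast
    have "0 \<le> 2 * beta_mix M X q" for q using dependence_le_beta_mix(2)[OF X] by simp
    from conclusion[OF q(1) this dependence_le_beta_mix(1)[OF X] q(2,3)] show ?thesis .
  next
    case algebraic
    have \<gamma>: "0 < \<gamma>" and decay: "(\<lambda>q. real q powr \<gamma> * beta_mix M X q) \<longlonglongrightarrow> 0"
      using algebraic(1) unfolding alg_beta_mixing_def by simp_all
    obtain q where q: "\<And>n. 1 \<le> q n"
      "(\<lambda>n. real (q n) * real (K n) * ln (real n) / real n) \<longlonglongrightarrow> 0"
      "(\<lambda>n. real n / real (q n) * (2 * beta_mix M X (q n))) \<longlonglongrightarrow> 0"
      using algebraic_mixing_block_length[OF dependence_le_beta_mix(2)[OF X] decay \<gamma> algebraic(2)]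
      by blast
    have "0 \<le> 2 * beta_mix M X q" for q using dependence_le_beta_mix(2)[OF X] by simp
    from conclusion[OF q(1) this dependence_le_beta_mix(1)[OF X] q(2,3)] show ?thesis .
  qed
qed

end
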